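(* Let $\lambda>\sigma>\partial>\theta^+>\theta>\aleph_0$ where $\lambda,\sigma,\partial,\theta$ are regular cardinals. (1) There is $S\in\check I_\theta[\lambda]$ which reflects in every $\delta\in S^\lambda_\sigma$. (2) Moreover, $S$ can be taken such that for every $\delta\in S^\lambda_\sigma$ the set $\{\delta_1<\delta:\mathrm{cf}(\delta_1)=\partial\text{ and }S\text{ reflects in }\delta_1\}$ is a stationary subset of $\delta$. (3) Moreover, for any $(\partial,\le\theta,<\sigma)$-system $\bar{\mathcal P}^*=\langle\mathcal P^*_\alpha:\alpha<\partial\rangle$ there is a $(\lambda,\lambda,<\lambda)$-system $\bar{\mathcal P}$ such that for every ordinal $\delta\in S^\lambda_\sigma$ and every increasing continuous sequence $\langle\delta_i:i<\sigma\rangle$ of ordinals with limit $\delta$, there is $S_1\in\check I^{\rm ac}_\partial\langle\sigma,\sigma\rangle$ such that: for every $j\in S^\sigma_\partial\setminus S_1$ there is $S_2\in I^{\rm cg}_\theta(\bar{\mathcal P}^* )$ such that for some increasing continuous sequence $\langle i_\varepsilon:\varepsilon<\partial\rangle$ of ordinals with limit $j$ we have $$\varepsilon\in S^\partial_\theta\setminus S_2\ \Rightarrow\ \delta_{i_\varepsilon}\in\mathrm{good}''_\theta(\bar{\mathcal P}).$$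
   Context: For regular $\kappa<\lambda$, $S^\lambda_\kappa=\{\delta<\lambda:\mathrm{cf}(\delta)=\kappa\}$. $S$ reflects in $\delta$ means that $\mathrm{cf}(\delta)>\aleph_0$ and $S\cap\delta$ is a stationary subset of $\delta$. Systems. For a regular cardinal $\rho$ and cardinals $\tau,\nu$, a $(\rho,\tau,<\nu)$-system is a sequence $\bar{\mathcal P}=\langle\mathcal P_\alpha:\alpha<\rho\rangle$ such that for each $\alpha$: every $a\in\mathcal P_\alpha$ satisfies $a\subseteq\alpha$ and $|a|<\tau$; if $\beta\in a\in\mathcal P_\alpha$ then $a\cap\beta\in\mathcal P_\beta$; and $|\mathcal P_\alpha|<\nu$. Writing $\le\theta$ in place of $\tau$ means $\tau=\theta^+$, i.e. $|a|\le\theta$. Good points. For a $(\lambda,\lambda,<\lambda)$-system $\bar{\mathcal P}$, $\mathrm{good}''_\theta(\bar{\mathcal P})$ is the set of $\delta<\lambda$ with $\mathrm{cf}(\delta)=\theta$ for which there is an unbounded $u\subseteq\delta$ of order type $\mathrm{cf}(\delta)=\theta$ such that $u\in\mathcal P_\delta$ and $u\cap\alpha\in\mathcal P_\alpha$ for every $\alpha\in u$. The ideal $\check I_\theta[\lambda]$. It is the family of $S\subseteq S^\lambda_\theta$ such that for some $(\lambda,\lambda,<\lambda)$-system $\bar{\mathcal P}$ and some club $E$ of $\lambda$ we have $S\cap E\subseteq\mathrm{good}''_\theta(\bar{\mathcal P})$. For general $S\subseteq\lambda$, $S\in\check I_\theta[\lambda]$ means $S\cap S^\lambda_\theta\in\check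 I_\theta[\lambda]$. The family $I^{\rm cg}_\theta(\bar{\mathcal P}^* )$. It is the family of $A\subseteq\partial$ such that for some club $E$ of $\partial$ there are no $\zeta\in A$ and $a\in\mathcal P^*_\zeta$ with $a\subseteq E$ and $\sup(a)=\zeta$. The family $\check I^{\rm ac}_\partial\langle\sigma,\sigma\rangle$. $\mathcal H(\chi)$ is the set of sets whose transitive closure has cardinality $<\chi$, and $<^*_\chi$ is a well ordering of $\mathcal H(\chi)$. $\check I^{\rm ac}_\partial\langle\sigma,\sigma\rangle$ is the family of $A\subseteq S^\sigma_\partial$ such that there are a cardinal $\chi>\sigma$ and $x\in\mathcal H(\chi)$ for which there is no sequence $\langle N_\varepsilon:\varepsilon<\partial\rangle$ satisfying: (a) $N_\varepsilon\prec(\mathcal H(\chi),\in,<^*_\chi)$; (b) the sequence is increasing continuous; (c) $\langle N_\zeta:\zeta\le\varepsilon\rangle\in N_{\varepsilon+1}$; (d) $\|N_\varepsilon\|<\sigma$ and $N_\varepsilon\cap\sigma$ is an ordinal; (e) $x,\sigma,\partial\in N_0$; (f) $\bigcup\{N_\varepsilon\cap\sigma:\varepsilon<\partial\}\in A$. *)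

theory Defs
  imports Main
begin

unbundle cardinal_syntax

section \<open>Ordinals as elements of a well-ordered type\<close>

text \<open>
  A type \<open>'a::wellorder\<close> is an initial segment of the ordinals: an element \<open>\<alpha>\<close> plays the role of
  an ordinal, and the set of its members is \<open>{..<\<alpha>}\<close>.
\<close>

definition zero_ord :: "'a::wellorder" where
  "zero_ord = (LEAST \<alpha>. True)"

definition succ_ord :: "'a::wellorder \<Rightarrow> 'a" where
  "succ_ord \<alpha> = (LEAST \<beta>. \<alpha> < \<beta>)"

definition limit_ord :: "'a::wellorder \<Rightarrow> bool" where
  "limit_ord \<delta> \<longleftrightarrow> {..<\<delta>} \<noteq> {} \<and> (\<forall>\<beta><\<delta>. \<exists>\<gamma><\<delta>. \<beta> < \<gamma>)"

definition is_sup :: "'a::wellorder set \<Rightarrow> 'a \<Rightarrow> bool" where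
  "is_sup A \<zeta> \<longleftrightarrow> (\<forall>\<alpha>\<in>A. \<alpha> \<le> \<zeta>) \<and> (\<forall>\<beta>. (\<forall>\<alpha>\<in>A. \<alpha> \<le> \<beta>) \<longrightarrow> \<zeta> \<le> \<beta>)"

definition has_order_type :: "'a::wellorder set \<Rightarrow> 'a \<Rightarrow> bool" where
  "has_order_type u \<alpha> \<longleftrightarrow> (\<exists>f. strict_mono_on {..<\<alpha>} f \<and> f ` {..<\<alpha>} = u)"

definition unbounded_in :: "'a::wellorder set \<Rightarrow> 'a \<Rightarrow> bool" where
  "unbounded_in u \<delta> \<longleftrightarrow> u \<subseteq> {..<\<delta>} \<and> (\<forall>\<beta><\<delta>. \<exists>\<gamma>\<in>u. \<beta> \<le> \<gamma>)"

definition cf :: "'a::wellorder \<Rightarrow> 'a" where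
  "cf \<delta> = (LEAST \<alpha>. \<exists>u. unbounded_in u \<delta> \<and> has_order_type u \<alpha>)"

definition cardinal :: "'a::wellorder \<Rightarrow> bool" where
  "cardinal \<kappa> \<longleftrightarrow> (\<forall>\<alpha><\<kappa>. |{..<\<alpha>}| <o |{..<\<kappa>}| )"

definition regular_cardinal :: "'a::wellorder \<Rightarrow> bool" where
  "regular_cardinal \<kappa> \<longleftrightarrow> infinite {..<\<kappa>} \<and> cardinal \<kappa> \<and> cf \<kappa> = \<kappa>"

text \<open>The next two are meaningful only if the type has an infinite element, respectively a
  cardinal above \<open>\<kappa>\<close>.\<close>

definition aleph0 :: "'a::wellorder" where
  "aleph0 = (LEAST \<alpha>. infinite {..<\<alpha>})"

definition succ_card :: "'a::wellorder \<Rightarrow> 'a" where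
  "succ_card \<kappa> = (LEAST \<mu>. cardinal \<mu> \<and> \<kappa> < \<mu>)"

text \<open>\<open>incr_cont \<rho> s \<delta>\<close>: the sequence \<open>s\<close>, of which only the restriction to \<open>{..<\<rho>}\<close> matters, is
  strictly increasing and continuous with limit \<open>\<delta>\<close>.\<close>

definition incr_cont :: "'a::wellorder \<Rightarrow> ('a \<Rightarrow> 'a) \<Rightarrow> 'a \<Rightarrow> bool" where
  "incr_cont \<rho> s \<delta> \<longleftrightarrow> strict_mono_on {..<\<rho>} s
     \<and> (\<forall>i<\<rho>. limit_ord i \<longrightarrow> is_sup (s ` {..<i}) (s i))
     \<and> is_sup (s ` {..<\<rho>}) \<delta>"

definition club :: "'a::wellorder set \<Rightarrow> 'a \<Rightarrow> bool" where
  "club C \<delta> \<longleftrightarrow> unbounded_in C \<delta>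
     \<and> (\<forall>\<alpha><\<delta>. limit_ord \<alpha> \<and> unbounded_in (C \<inter> {..<\<alpha>}) \<alpha> \<longrightarrow> \<alpha> \<in> C)"

definition stationary :: "'a::wellorder set \<Rightarrow> 'a \<Rightarrow> bool" where
  "stationary S \<delta> \<longleftrightarrow> S \<subseteq> {..<\<delta>} \<and> (\<forall>C. club C \<delta> \<longrightarrow> S \<inter> C \<noteq> {})"

text \<open>\<open>cof_set \<lambda> \<kappa>\<close> is the set usually written as \<open>S\<close> with upper index \<open>\<lambda>\<close> and lower index \<open>\<kappa>\<close>.\<close>

definition cof_set :: "'a::wellorder \<Rightarrow> 'a \<Rightarrow> 'a set" where
  "cof_set lam \<kappa> = {\<delta>. \<delta> < lam \<and> cf \<delta> = \<kappa>}"

definition reflects_in :: "'a::wellorder set \<Rightarrow> 'a \<Rightarrow> bool" where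
  "reflects_in S \<delta> \<longleftrightarrow> aleph0 < cf \<delta> \<and> stationary (S \<inter> {..<\<delta>}) \<delta>"


section \<open>Systems, good points, and the associated ideals\<close>

text \<open>\<open>set_system \<rho> \<tau> \<nu> P\<close>: \<open>P\<close>, restricted to \<open>{..<\<rho>}\<close>, is a \<open>(\<rho>,\<tau>,<\<nu>)\<close>-system. A
  \<open>(\<rho>,\<le>\<theta>,<\<nu>)\<close>-system is obtained with \<open>\<tau> = succ_card \<theta>\<close>.\<close>

definition set_system :: "'a::wellorder \<Rightarrow> 'a \<Rightarrow> 'a \<Rightarrow> ('a \<Rightarrow> 'a set set) \<Rightarrow> bool" where
  "set_system \<rho> \<tau> \<nu> P \<longleftrightarrow> (\<forall>\<alpha><\<rho>.
       (\<forall>a\<in>P \<alpha>. a \<subseteq> {..<\<alpha>} \<and> |a| <o |{..<\<tau>}| )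
     \<and> (\<forall>a\<in>P \<alpha>. \<forall>\<beta>\<in>a. a \<inter> {..<\<beta>} \<in> P \<beta>)
     \<and> |P \<alpha>| <o |{..<\<nu>}| )"

definition good :: "'a::wellorder \<Rightarrow> 'a \<Rightarrow> ('a \<Rightarrow> 'a set set) \<Rightarrow> 'a set" where
  "good lam \<theta> P = {\<delta>. \<delta> < lam \<and> cf \<delta> = \<theta> \<and>
     (\<exists>u. unbounded_in u \<delta> \<and> has_order_type u \<theta> \<and> u \<in> P \<delta>
        \<and> (\<forall>\<alpha>\<in>u. u \<inter> {..<\<alpha>} \<in> P \<alpha>))}"

text \<open>Members of the ideal are subsets of \<open>cof_set lam \<theta>\<close>. The extension of membership to arbitrary
  \<open>S \<subseteq> {..<lam}\<close>, through \<open>S \<inter> cof_set lam \<theta>\<close>, is deliberately not used: every set avoiding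
  \<open>cof_set lam \<theta>\<close> would be a member.\<close>

definition ideal_I :: "'a::wellorder \<Rightarrow> 'a \<Rightarrow> 'a set set" where
  "ideal_I lam \<theta> = {S. S \<subseteq> cof_set lam \<theta> \<and>
     (\<exists>P E. set_system lam lam lam P \<and> club E lam \<and> S \<inter> E \<subseteq> good lam \<theta> P)}"

text \<open>The lower index \<open>\<theta>\<close> of this family in the literature only records the size bound of the
  system \<open>P\<close>.\<close>

definition ideal_cg :: "'a::wellorder \<Rightarrow> ('a \<Rightarrow> 'a set set) \<Rightarrow> 'a set set" where
  "ideal_cg \<rho> P = {A. A \<subseteq> {..<\<rho>} \<and>
     (\<exists>E. club E \<rho> \<and> \<not> (\<exists>\<zeta>\<in>A. \<exists>a\<in>P \<zeta>. a \<subseteq> E \<and> is_sup a \<zeta>))}"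


section \<open>Sets hereditarily of size at most that of a type\<close>

text \<open>
  \<open>'c pre_set\<close> consists of the well-founded trees branching over \<open>'c\<close>; identifying bisimilar trees
  yields \<open>'c hset\<close>, the well-founded extensional universe of all sets that are hereditarily of
  cardinality at most that of \<open>'c\<close>.
\<close>

datatype 'c pre_set = PSet "'c \<Rightarrow> 'c pre_set option"

inductive bisim :: "'c pre_set \<Rightarrow> 'c pre_set \<Rightarrow> bool" where
  "(\<forall>x\<in>ran f. \<exists>y\<in>ran g. bisim x y) \<Longrightarrow> (\<forall>y\<in>ran g. \<exists>x\<in>ran f. bisim x y)
     \<Longrightarrow> bisim (PSet f) (PSet g)"

lemma bisim_PSet:
  "bisim (PSet f) (PSet g) \<longleftrightarrow>
     (\<forall>x\<in>ran f. \<exists>y\<in>ran g. bisim x y) \<and> (\<forall>y\<in>ran g. \<exists>x\<in>ran f. bisim x y)"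
  by (subst bisim.simps) blast

lemma pre_set_induct [case_names PSet]:
  assumes "\<And>f. (\<And>x. x \<in> ran f \<Longrightarrow> Q x) \<Longrightarrow> Q (PSet f)"
  shows "Q t"
proof (induction t)
  case (PSet f)
  show ?case
  proof (rule assms)
    fix x assume "x \<in> ran f"
    then obtain i where "f i = Some x" by (auto simp: ran_def)
    then have "Some x \<in> range f" by (metis rangeI)
    then show "Q x" using PSet by simp
  qed
qed

lemma bisim_refl: "bisim t t"
  by (induction t rule: pre_set_induct) (auto simp: bisim_PSet)

lemma bisim_sym: "bisim s t \<Longrightarrow> bisim t s"
proof (induction s arbitrary: t rule: pre_set_induct)
  case (PSet f)
  obtain g where t: "t = PSet g" by (cases t)
  show ?case using PSet unfolding t bisim_PSet by blast
qed

lemma bisim_trans: "bisim s t \<Longrightarrow> bisim t u \<Longrightarrow> bisim s u"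
proof (induction s arbitrary: t u rule: pre_set_induct)
  case (PSet f)
  obtain g h where tu: "t = PSet g" "u = PSet h" by (metis pre_set.exhaust)
  have 1: "\<exists>z\<in>ran h. bisim x z" if x: "x \<in> ran f" for x
  proof -
    obtain y where y: "y \<in> ran g" "bisim x y"
      using PSet.prems(1) x unfolding tu bisim_PSet by blast
    obtain z where "z \<in> ran h" "bisim y z"
      using PSet.prems(2) y unfolding tu bisim_PSet by blast
    then show ?thesis using PSet.IH[OF x y(2)] by blast
  qed
  have 2: "\<exists>x\<in>ran f. bisim x z" if z: "z \<in> ran h" for z
  proof -
    obtain y where y: "y \<in> ran g" "bisim y z"
      using PSet.prems(2) z unfolding tu bisim_PSet by blast
    obtain x where x: "x \<in> ran f" "bisim x y"
      using PSet.prems(1) y unfolding tu bisim_PSet by blast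
    then show ?thesis using PSet.IH[OF x y(2)] by blast
  qed
  show ?case using 1 2 unfolding tu bisim_PSet by blast
qed

quotient_type 'c hset = "'c pre_set" / bisim
  by (rule equivpI) (auto intro!: reflpI sympI transpI intro: bisim_refl bisim_sym bisim_trans)

definition elts :: "'c hset \<Rightarrow> 'c hset set" where
  "elts x = {abs_hset t | t f. x = abs_hset (PSet f) \<and> t \<in> ran f}"

lemma elts_abs: "elts (abs_hset (PSet f)) = abs_hset ` ran f"
proof (intro set_eqI iffI)
  fix y assume "y \<in> elts (abs_hset (PSet f))"
  then obtain t g where y: "y = abs_hset t" "bisim (PSet f) (PSet g)" "t \<in> ran g"
    by (auto simp: elts_def hset.abs_eq_iff)
  then obtain s where "s \<in> ran f" "bisim s t" by (auto simp: bisim_PSet)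
  then show "y \<in> abs_hset ` ran f" using y(1) by (metis hset.abs_eq_iff image_eqI)
next
  fix y assume "y \<in> abs_hset ` ran f"
  then show "y \<in> elts (abs_hset (PSet f))" by (auto simp: elts_def)
qed

lemma hset_cases:
  obtains f where "x = abs_hset (PSet f)"
proof -
  have "\<exists>f. x = abs_hset (PSet f)"
  proof (induction x rule: hset.abs_induct)
    case (1 t)
    show ?case by (cases t) blast
  qed
  then show thesis using that by blast
qed

lemma elts_inj: "inj elts"
proof (rule injI)
  fix x y :: "'c hset" assume eq: "elts x = elts y"
  obtain f where x: "x = abs_hset (PSet f)" by (rule hset_cases)
  obtain g where y: "y = abs_hset (PSet g)" by (rule hset_cases)
  have fg: "abs_hset ` ran f = abs_hset ` ran g" using eq by (simp add: x y elts_abs)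
  have "\<exists>t\<in>ran g. bisim s t" if "s \<in> ran f" for s
  proof -
    have "abs_hset s \<in> abs_hset ` ran g" using that fg by blast
    then show ?thesis by (auto simp: hset.abs_eq_iff)
  qed
  moreover have "\<exists>s\<in>ran f. bisim s t" if "t \<in> ran g" for t
  proof -
    have "abs_hset t \<in> abs_hset ` ran f" using that fg by blast
    then show ?thesis by (auto simp: hset.abs_eq_iff) (blast intro: bisim_sym)
  qed
  ultimately show "x = y" by (simp add: x y hset.abs_eq_iff bisim_PSet)
qed

lemma hset_induct [case_names step]:
  assumes "\<And>x. (\<And>y. y \<in> elts x \<Longrightarrow> Q y) \<Longrightarrow> Q x"
  shows "Q x"
proof -
  have "Q (abs_hset t)" for t
    by (induction t rule: pre_set_induct) (rule assms, auto simp: elts_abs)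
  then show ?thesis by (metis hset.abs_induct)
qed

lemma not_mem_self: "x \<notin> elts x"
  by (induction x rule: hset_induct) blast

definition set_of :: "'c hset set \<Rightarrow> 'c hset" where
  "set_of X = inv elts X"

lemma elts_set_of:
  fixes X :: "'c hset set"
  assumes "|X| \<le>o |UNIV :: 'c set|"
  shows "elts (set_of X) = X"
proof -
  obtain h :: "'c hset \<Rightarrow> 'c" where h: "inj_on h X"
    using assms unfolding card_of_ordLeq[symmetric] by blast
  define f where "f c = (if c \<in> h ` X then Some (rep_hset (inv_into X h c)) else None)" for c
  have "f (h x) = Some (rep_hset x)" if "x \<in> X" for x
    using that h by (simp add: f_def)
  moreover have "f c = None" if "c \<notin> h ` X" for c
    using that by (auto simp: f_def)
  ultimately have f: "f c = Some t \<longleftrightarrow> (\<exists>x\<in>X. c = h x \<and> t = rep_hset x)" for c t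
    by (cases "c \<in> h ` X") auto
  have "ran f = rep_hset ` X"
    unfolding ran_def f by blast
  then have "elts (abs_hset (PSet f)) = X"
    by (simp add: elts_abs image_image Quotient3_abs_rep[OF Quotient3_hset])
  then show ?thesis
    unfolding set_of_def by (metis f_inv_into_f rangeI)
qed

definition kpair :: "'c hset \<Rightarrow> 'c hset \<Rightarrow> 'c hset" where
  "kpair x y = set_of {set_of {x}, set_of {x, y}}"

text \<open>The von Neumann ordinal in \<open>'c hset\<close> that corresponds to the element \<open>\<alpha>\<close>; meaningful when
  \<open>{..<\<alpha>}\<close> injects into \<open>'c\<close>.\<close>

function von :: "'a::wellorder \<Rightarrow> 'c hset" where
  "von \<alpha> = set_of (von ` {..<\<alpha>})"
  by auto
termination
  by (relation "{(\<beta>, \<alpha>). \<beta> < \<alpha>}") (auto simp: wf)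

declare von.simps [simp del]

lemma elts_von:
  fixes \<alpha> :: "'a::wellorder"
  assumes "|{..<\<alpha>}| \<le>o |UNIV :: 'c set|"
  shows "elts (von \<alpha> :: 'c hset) = von ` {..<\<alpha>}"
  unfolding von.simps[of \<alpha>] by (rule elts_set_of[OF ordLeq_transitive[OF card_of_image assms]])

lemma von_inject:
  fixes \<alpha> \<beta> :: "'a::wellorder"
  assumes "|{..<\<alpha>}| \<le>o |UNIV :: 'c set|" "|{..<\<beta>}| \<le>o |UNIV :: 'c set|"
    and eq: "(von \<alpha> :: 'c hset) = von \<beta>"
  shows "\<alpha> = \<beta>"
proof (rule ccontr)
  assume "\<alpha> \<noteq> \<beta>"
  then consider "\<alpha> < \<beta>" | "\<beta> < \<alpha>" by (rule linorder_neqE)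
  then show False
  proof cases
    case 1
    then have "(von \<alpha> :: 'c hset) \<in> elts (von \<beta>)" unfolding elts_von[OF assms(2)] by blast
    then show False using not_mem_self eq by metis
  next
    case 2
    then have "(von \<beta> :: 'c hset) \<in> elts (von \<alpha>)" unfolding elts_von[OF assms(1)] by blast
    then show False using not_mem_self eq by metis
  qed
qed

definition sequence_code :: "'a::wellorder \<Rightarrow> ('a \<Rightarrow> 'c hset set) \<Rightarrow> 'c hset" where
  "sequence_code \<epsilon> N = set_of {kpair (von \<zeta>) (set_of (N \<zeta>)) | \<zeta>. \<zeta> \<le> \<epsilon>}"

definition trans_closure :: "'c hset \<Rightarrow> 'c hset set" where
  "trans_closure x = {y. (y, x) \<in> {(u, v). u \<in> elts v}\<^sup>+}"

definition H :: "'c rel \<Rightarrow> 'c hset set" where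
  "H \<chi> = {x. |trans_closure x| <o \<chi>}"


section \<open>Elementary submodels\<close>

text \<open>First-order formulas, with named variables, in the language of two binary relation symbols.\<close>

datatype fm = Mem nat nat | Less nat nat | Equal nat nat | Neg fm | Conj fm fm | Exists nat fm

primrec sat :: "'c hset set \<Rightarrow> 'c hset rel \<Rightarrow> (nat \<Rightarrow> 'c hset) \<Rightarrow> fm \<Rightarrow> bool" where
  "sat M R e (Mem m n) \<longleftrightarrow> e m \<in> elts (e n)"
| "sat M R e (Less m n) \<longleftrightarrow> (e m, e n) \<in> R"
| "sat M R e (Equal m n) \<longleftrightarrow> e m = e n"
| "sat M R e (Neg \<phi>) \<longleftrightarrow> \<not> sat M R e \<phi>"
| "sat M R e (Conj \<phi> \<psi>) \<longleftrightarrow> sat M R e \<phi> \<and> sat M R e \<psi>"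
| "sat M R e (Exists n \<phi>) \<longleftrightarrow> (\<exists>v\<in>M. sat M R (e(n := v)) \<phi>)"

definition elem_submodel :: "'c hset set \<Rightarrow> 'c hset set \<Rightarrow> 'c hset rel \<Rightarrow> bool" where
  "elem_submodel N M R \<longleftrightarrow> N \<noteq> {} \<and> N \<subseteq> M
     \<and> (\<forall>\<phi> e. range e \<subseteq> N \<longrightarrow> (sat N R e \<phi> \<longleftrightarrow> sat M R e \<phi>))"

text \<open>
  \<open>ac_sequence W \<chi> x \<sigma> \<rho> A N\<close>: the sequence of the \<open>N \<epsilon>\<close> for \<open>\<epsilon> < \<rho>\<close> satisfies the requirements
  (a)--(f), one per line (two lines for (b)), with respect to the structure
  \<open>(H \<chi>, \<in>, W \<chi>)\<close>. Well-orders in the library are reflexive, hence the subtraction of \<open>Id\<close>.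
\<close>

definition ac_sequence ::
  "('c rel \<Rightarrow> 'c hset rel) \<Rightarrow> 'c rel \<Rightarrow> 'c hset \<Rightarrow> 'a::wellorder \<Rightarrow> 'a \<Rightarrow> 'a set
     \<Rightarrow> ('a \<Rightarrow> 'c hset set) \<Rightarrow> bool" where
  "ac_sequence W \<chi> x \<sigma> \<rho> A N \<longleftrightarrow>
     (\<forall>\<epsilon><\<rho>. elem_submodel (N \<epsilon>) (H \<chi>) (W \<chi> - Id))
   \<and> (\<forall>\<epsilon><\<rho>. \<forall>\<zeta><\<epsilon>. N \<zeta> \<subseteq> N \<epsilon>)
   \<and> (\<forall>\<epsilon><\<rho>. limit_ord \<epsilon> \<longrightarrow> N \<epsilon> = (\<Union>\<zeta><\<epsilon>. N \<zeta>))
   \<and> (\<forall>\<epsilon><\<rho>. sequence_code \<epsilon> N \<in> N (succ_ord \<epsilon>))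
   \<and> (\<forall>\<epsilon><\<rho>. |N \<epsilon>| <o |{..<\<sigma>}| \<and> (\<exists>\<alpha>\<le>\<sigma>. N \<epsilon> \<inter> von ` {..<\<sigma>} = von ` {..<\<alpha>}))
   \<and> x \<in> N zero_ord \<and> von \<sigma> \<in> N zero_ord \<and> von \<rho> \<in> N zero_ord
   \<and> (\<exists>\<alpha>\<in>A. (\<Union>\<epsilon><\<rho>. N \<epsilon> \<inter> von ` {..<\<sigma>}) = von ` {..<\<alpha>})"

text \<open>
  The cardinal \<open>\<chi>\<close> is taken to be regular, the usual convention for \<open>H \<chi>\<close>. For singular \<open>\<chi>\<close> the
  models \<open>N \<epsilon>\<close> need not be elements of \<open>H \<chi>\<close> (for instance if \<open>\<chi>\<close> is the \<open>\<omega>\<close>-th cardinal after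
  \<open>\<sigma>\<close>), so that no sequence as above exists and every subset of \<open>cof_set \<sigma> \<rho>\<close> would qualify.
\<close>

definition ideal_ac ::
  "('c rel \<Rightarrow> 'c hset rel) \<Rightarrow> 'a::wellorder \<Rightarrow> 'a \<Rightarrow> 'a set set" where
  "ideal_ac W \<rho> \<sigma> = {A. A \<subseteq> cof_set \<sigma> \<rho> \<and>
     (\<exists>\<chi> x. Card_order \<chi> \<and> regularCard \<chi> \<and> |{..<\<sigma>}| <o \<chi> \<and> x \<in> H \<chi>
        \<and> \<not> (\<exists>N. ac_sequence W \<chi> x \<sigma> \<rho> A N))}"

end

theory Submission
  imports Defs
begin

text \<open>
  Fix a club \<open>e \<gamma>\<close> of order type \<open>\<rho>\<close> in every \<open>\<gamma>\<close> of cofinality \<open>\<rho>\<close>. For \<open>\<delta>\<close> of cofinality \<open>\<sigma>\<close>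
  enumerated by \<open>d\<close>, and \<open>i\<close> converging to \<open>j\<close>, the sequences \<open>e (d j)\<close> and \<open>d \<circ> i\<close> agree on a club
  \<open>E\<close> of \<open>\<rho>\<close>. If a guess \<open>a\<close> at \<open>\<epsilon>\<close> is contained in \<open>E\<close>, a thin cofinal \<open>c \<subseteq> a\<close> yields
  \<open>u = d ` i ` c\<close>, unbounded in \<open>d (i \<epsilon>)\<close>, whose initial segments are \<open>e (d j) ` b\<close> for initial segments
  \<open>b\<close> of \<open>c\<close>; there are fewer than \<open>\<sigma>\<close> such \<open>b\<close>. So each initial segment has a code \<open>(\<gamma>, b)\<close> with
  \<open>\<gamma> < \<delta>\<close>, and if \<open>i\<close> grows fast enough (a closure condition, which holds if \<open>i \<epsilon>\<close> is the trace on
  \<open>\<sigma>\<close> of an elementary submodel) then \<open>\<gamma>\<close> can be found below the next point of \<open>u\<close>. Hence the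
  sets coded below \<open>\<beta>\<close>, of which there are fewer than \<open>\<lambda>\<close>, form a system for which \<open>d (i \<epsilon>)\<close> is good.
  The first two parts apply this to a system that guesses clubs of \<open>\<rho>\<close>, with \<open>i\<close> chosen
  recursively inside a given club of \<open>\<sigma>\<close>.
\<close>

section \<open>Ordinals and cofinality\<close>

text \<open>In a code, \<open>b\<close> comes from a family determined by the guesses alone, so one
  system serves all \<open>\<delta>\<close>, \<open>d\<close> and \<open>i\<close>. The obvious code
  of an initial segment is \<open>(d j, b)\<close>, but \<open>d j\<close> lies above all of
  \<open>u\<close>; the closure condition exists to trade it for a smaller ordinal. Each stage
  concerns fewer than \<open>\<sigma>\<close> sets \<open>b\<close>, so regularity of
  \<open>\<sigma>\<close> supplies a bound. The whole \<open>u\<close> may have no code below its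
  supremum; since goodness asks for a single witness, each level can afford to add one such set. The
  gaps in size: \<open>aleph0 < \<rho>\<close> makes two continuous sequences with a common limit
  agree on a club, \<open>\<rho> < \<sigma>\<close> leaves room for \<open>\<rho>\<close> guesses at
  a point, and \<open>succ_card \<theta> < \<rho>\<close> makes club guessing provable. For
  submodels, the closure condition is first turned into a function on subsets of
  \<open>\<sigma>\<close>, so that its graph can be coded by an element of \<open>H \<chi>\<close>
  and evaluated inside the next model.\<close>

lemma wellorder_rec:
  fixes F :: "('a::wellorder \<Rightarrow> 'b) \<Rightarrow> 'a \<Rightarrow> 'b"
  assumes "\<And>f g x. (\<And>z. z < x \<Longrightarrow> f z = g z) \<Longrightarrow> F f x = F g x"
  shows "\<exists>f. \<forall>x. f x = F f x"
proof -
  have "wfrec {(x, y). x < y} F = F (wfrec {(x, y). x < y} F)"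
    by (rule wfrec_fixpoint) (auto simp: wf adm_wf_def intro: assms)
  then show ?thesis by metis
qed

text \<open>The function \<open>G\<close> is the transitive collapse of \<open>u\<close>. Since
  \<open>G x \<le> x\<close>, no point of \<open>u\<close> is sent to \<open>\<delta>\<close>; as
  the image is closed downwards, it is an initial segment of length at most \<open>\<delta>\<close>,
  and the inverse of \<open>G\<close> enumerates \<open>u\<close>.\<close>

lemma order_type_exists:
  fixes \<delta> :: "'a::wellorder"
  assumes u: "u \<subseteq> {..<\<delta>}"
  shows "\<exists>\<alpha>\<le>\<delta>. has_order_type u \<alpha>"
proof -
  have "\<exists>G. \<forall>x. G x = (LEAST y. \<forall>z\<in>u. z < x \<longrightarrow> G z < y)"
    by (rule wellorder_rec[where F = "\<lambda>G x. (LEAST y. \<forall>z\<in>u. z < x \<longrightarrow> G z < y)"]) simp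
  then obtain G :: "'a \<Rightarrow> 'a" where G: "\<And>x. G x = (LEAST y. \<forall>z\<in>u. z < x \<longrightarrow> G z < y)"
    by blast
  have le: "G x \<le> x" for x
  proof (induction x rule: less_induct)
    case (less x)
    have "\<forall>z\<in>u. z < x \<longrightarrow> G z < x" using less order_le_less_trans by blast
    then show ?case by (subst G) (rule Least_le)
  qed
  have bd: "\<forall>z\<in>u. z < x \<longrightarrow> G z < G x" for x
  proof -
    have "\<forall>z\<in>u. z < x \<longrightarrow> G z < x" using le order_le_less_trans by blast
    then have "\<forall>z\<in>u. z < x \<longrightarrow> G z < (LEAST y. \<forall>z\<in>u. z < x \<longrightarrow> G z < y)"
      by (rule LeastI)
    then show ?thesis by (simp only: G[of x, symmetric])
  qed
  have below: "y \<in> G ` u" if "x \<in> u" "y < G x" for x y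
    using that
  proof (induction x rule: less_induct)
    case (less x)
    have "\<not> (\<forall>z\<in>u. z < x \<longrightarrow> G z < y)"
      using less.prems(2) by (subst (asm) G) (rule not_less_Least)
    then obtain z where z: "z \<in> u" "z < x" "y \<le> G z" by (metis not_less)
    then show ?case using less.IH by (cases "y = G z") auto
  qed
  define \<alpha> where "\<alpha> = (LEAST y. y \<notin> G ` u)"
  have \<delta>: "\<delta> \<notin> G ` u" using u le by (metis imageE lessThan_iff not_le subsetD)
  have \<alpha>: "\<alpha> \<notin> G ` u" "\<alpha> \<le> \<delta>" unfolding \<alpha>_def by (rule LeastI, rule \<delta>, rule Least_le, rule \<delta>)
  have im: "G ` u = {..<\<alpha>}"
  proof
    show "{..<\<alpha>} \<subseteq> G ` u" unfolding \<alpha>_def using not_less_Least by blast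
    show "G ` u \<subseteq> {..<\<alpha>}"
    proof clarify
      fix z assume "z \<in> u"
      then have "\<not> \<alpha> < G z" "\<alpha> \<noteq> G z" using \<alpha>(1) below by blast+
      then show "G z < \<alpha>" by simp
    qed
  qed
  have inj: "inj_on G u" by (rule linorder_inj_onI') (metis bd less_irrefl)
  define f where "f = inv_into u G"
  have fu: "f y \<in> u" "G (f y) = y" if "y < \<alpha>" for y
    using that im by (simp_all add: f_def inv_into_into f_inv_into_f)
  have "strict_mono_on {..<\<alpha>} f"
  proof (rule strict_mono_onI)
    fix r s assume rs: "r \<in> {..<\<alpha>}" "s \<in> {..<\<alpha>}" "r < s"
    then have 1: "f r \<in> u" "f s \<in> u" "G (f r) < G (f s)" using fu by simp_all
    then have "\<not> f s < f r" using bd[of "f r"] less_asym by blast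
    moreover have "f r \<noteq> f s" using 1(3) by auto
    ultimately show "f r < f s" by simp
  qed
  moreover have "f ` {..<\<alpha>} = u"
    using inj im by (auto simp: f_def im[symmetric] inv_into_into)
  ultimately show ?thesis using \<alpha>(2) unfolding has_order_type_def by blast
qed

lemma order_type_card:
  assumes "has_order_type u \<alpha>"
  shows "|u| =o |{..<\<alpha>}|"
proof -
  obtain f where "strict_mono_on {..<\<alpha>} f" "f ` {..<\<alpha>} = u"
    using assms unfolding has_order_type_def by blast
  then have "bij_betw f {..<\<alpha>} u"
    by (simp add: bij_betw_def strict_mono_on_imp_inj_on)
  then show ?thesis using card_of_ordIso ordIso_symmetric by blast
qed

lemma order_type_image:
  assumes "strict_mono_on {..<\<alpha>} f"
  shows "has_order_type (f ` {..<\<alpha>}) \<alpha>"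
  using assms unfolding has_order_type_def by blast

section \<open>Cofinality and bounds for small sets\<close>

lemma cf_le:
  assumes "unbounded_in u \<delta>" "has_order_type u \<alpha>"
  shows "cf \<delta> \<le> \<alpha>"
  unfolding cf_def by (rule Least_le) (use assms in blast)

lemma cf_witness:
  fixes \<delta> :: "'a::wellorder"
  shows "\<exists>u. unbounded_in u \<delta> \<and> has_order_type u (cf \<delta>)"
proof -
  have 1: "unbounded_in {..<\<delta>} \<delta>" unfolding unbounded_in_def by auto
  have 2: "has_order_type {..<\<delta>} \<delta>"
    unfolding has_order_type_def by (rule exI[of _ id]) (auto simp: strict_mono_on_def)
  show ?thesis unfolding cf_def by (rule LeastI) (use 1 2 in blast)
qed

lemma cf_sequence:
  fixes \<delta> :: "'a::wellorder"
  obtains f where "strict_mono_on {..<cf \<delta>} f" "f ` {..<cf \<delta>} \<subseteq> {..<\<delta>}"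
    "\<forall>\<beta><\<delta>. \<exists>\<eta><cf \<delta>. \<beta> \<le> f \<eta>"
proof -
  obtain u where u: "unbounded_in u \<delta>" "has_order_type u (cf \<delta>)" using cf_witness by blast
  then obtain f where f: "strict_mono_on {..<cf \<delta>} f" "f ` {..<cf \<delta>} = u"
    unfolding has_order_type_def by blast
  have "\<exists>\<eta><cf \<delta>. \<beta> \<le> f \<eta>" if "\<beta> < \<delta>" for \<beta>
    using u(1) that f(2) unfolding unbounded_in_def by blast
  moreover have "f ` {..<cf \<delta>} \<subseteq> {..<\<delta>}" using u(1) f(2) unfolding unbounded_in_def by blast
  ultimately show thesis using that f(1) by blast
qed

text \<open>The records of \<open>f\<close>, i.e. the values exceeding all earlier ones, form a cofinal subset of the
  range along which \<open>f\<close> is strictly increasing.\<close>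

lemma cofinal_subset_order_type:
  fixes f :: "'a::wellorder \<Rightarrow> 'a"
  shows "\<exists>c \<alpha>. \<alpha> \<le> \<zeta> \<and> c \<subseteq> f ` {..<\<zeta>} \<and> has_order_type c \<alpha> \<and> (\<forall>\<eta><\<zeta>. \<exists>y\<in>c. f \<eta> \<le> y)"
proof -
  define R where "R = {\<eta>. \<eta> < \<zeta> \<and> (\<forall>\<eta>'<\<eta>. f \<eta>' < f \<eta>)}"
  have "R \<subseteq> {..<\<zeta>}" by (auto simp: R_def)
  then obtain \<alpha> g where \<alpha>: "\<alpha> \<le> \<zeta>" and g: "strict_mono_on {..<\<alpha>} g" "g ` {..<\<alpha>} = R"
    using order_type_exists[of R \<zeta>] unfolding has_order_type_def by blast
  have "strict_mono_on {..<\<alpha>} (f \<circ> g)"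
  proof (rule strict_mono_onI)
    fix r s assume rs: "r \<in> {..<\<alpha>}" "s \<in> {..<\<alpha>}" "r < s"
    then have "g r < g s" "g s \<in> R" using g by (auto simp: strict_mono_on_def)
    then show "(f \<circ> g) r < (f \<circ> g) s" by (auto simp: R_def)
  qed
  moreover have "(f \<circ> g) ` {..<\<alpha>} = f ` R" using g(2) by (metis image_comp)
  ultimately have "has_order_type (f ` R) \<alpha>" unfolding has_order_type_def by blast
  moreover have "\<exists>y\<in>f ` R. f \<eta> \<le> y" if "\<eta> < \<zeta>" for \<eta>
  proof -
    define \<eta>' where "\<eta>' = (LEAST \<xi>. f \<eta> \<le> f \<xi>)"
    have 1: "f \<eta> \<le> f \<eta>'" unfolding \<eta>'_def by (rule LeastI[of _ \<eta>]) simp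
    have "\<eta>' \<le> \<eta>" unfolding \<eta>'_def by (rule Least_le) simp
    moreover have "f \<xi> < f \<eta>'" if "\<xi> < \<eta>'" for \<xi>
      using not_less_Least[OF that[unfolded \<eta>'_def]] 1 by auto
    ultimately have "\<eta>' \<in> R" using \<open>\<eta> < \<zeta>\<close> by (auto simp: R_def)
    then show ?thesis using 1 by blast
  qed
  moreover have "f ` R \<subseteq> f ` {..<\<zeta>}" by (auto simp: R_def)
  ultimately show ?thesis using \<alpha> by blast
qed

text \<open>As \<open>f\<close> need not be monotone, the order type of its range may exceed
  \<open>\<zeta>\<close>. The records are cofinal in the range and have order type at most
  \<open>\<zeta>\<close>, so an unbounded range would contradict the minimality of
  \<open>cf \<delta>\<close>.\<close>

lemma cf_bounded:
  fixes f :: "'a::wellorder \<Rightarrow> 'a"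
  assumes \<zeta>: "\<zeta> < cf \<delta>" and f: "f ` {..<\<zeta>} \<subseteq> {..<\<delta>}"
  shows "\<exists>\<beta><\<delta>. \<forall>\<eta><\<zeta>. f \<eta> < \<beta>"
proof (rule ccontr)
  assume "\<not> ?thesis"
  then have unb: "\<exists>\<eta><\<zeta>. \<beta> \<le> f \<eta>" if "\<beta> < \<delta>" for \<beta> using that by force
  obtain c \<alpha> where c: "\<alpha> \<le> \<zeta>" "c \<subseteq> f ` {..<\<zeta>}" "has_order_type c \<alpha>" "\<forall>\<eta><\<zeta>. \<exists>y\<in>c. f \<eta> \<le> y"
    using cofinal_subset_order_type[of \<zeta> f] by blast
  have "unbounded_in c \<delta>"
    unfolding unbounded_in_def
  proof (intro conjI allI impI)
    show "c \<subseteq> {..<\<delta>}" using c(2) f by blast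
    fix \<beta> assume "\<beta> < \<delta>"
    then obtain \<eta> where \<eta>: "\<eta> < \<zeta>" "\<beta> \<le> f \<eta>" using unb by blast
    then obtain y where "y \<in> c" "f \<eta> \<le> y" using c(4) by blast
    then show "\<exists>\<gamma>\<in>c. \<beta> \<le> \<gamma>" using \<eta>(2) order_trans by blast
  qed
  from cf_le[OF this c(3)] show False using c(1) \<zeta> by auto
qed

lemma card_less_initial:
  fixes \<kappa> :: "'a::wellorder"
  assumes "|X| <o |{..<\<kappa>}|"
  shows "\<exists>\<zeta><\<kappa>. \<exists>h. h ` {..<\<zeta>} = X"
proof -
  obtain g where g: "inj_on g X" "g ` X \<subseteq> {..<\<kappa>}"
    using ordLess_imp_ordLeq[OF assms] unfolding card_of_ordLeq[symmetric] by blast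
  obtain \<zeta> where \<zeta>: "\<zeta> \<le> \<kappa>" "has_order_type (g ` X) \<zeta>" using order_type_exists[OF g(2)] by blast
  have 1: "|X| =o |{..<\<zeta>}|"
    using order_type_card[OF \<zeta>(2)] g(1) card_of_ordIso ordIso_transitive inj_on_imp_bij_betw
    by blast
  then have "\<zeta> \<noteq> \<kappa>" using assms not_ordLess_ordIso by blast
  moreover obtain h where "bij_betw h {..<\<zeta>} X"
    using 1 ordIso_symmetric card_of_ordIso by blast
  ultimately show ?thesis using \<zeta>(1) unfolding bij_betw_def by (metis order_le_imp_less_or_eq)
qed

lemma cf_small_bounded:
  fixes X :: "'a::wellorder set"
  assumes "X \<subseteq> {..<\<delta>}" "|X| <o |{..<cf \<delta>}|"
  shows "\<exists>\<beta><\<delta>. \<forall>x\<in>X. x < \<beta>"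
proof -
  obtain \<zeta> h where "\<zeta> < cf \<delta>" "h ` {..<\<zeta>} = X" using card_less_initial[OF assms(2)] by blast
  then show ?thesis using cf_bounded[of \<zeta> \<delta> h] assms(1) by auto
qed

text \<open>Because \<open>unbounded_in\<close> compares with \<open>\<le>\<close>, a last element
  \<open>\<beta>\<close> below \<open>\<kappa>\<close> would make \<open>{\<beta>}\<close>
  unbounded, and the cofinality would be finite.\<close>

lemma regular_limit:
  assumes "regular_cardinal (\<kappa>::'a::wellorder)"
  shows "limit_ord \<kappa>"
proof -
  have inf: "infinite {..<\<kappa>}" and cf: "cf \<kappa> = \<kappa>" using assms unfolding regular_cardinal_def by auto
  have "\<exists>\<gamma><\<kappa>. \<beta> < \<gamma>" if \<beta>: "\<beta> < \<kappa>" for \<beta>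
  proof (rule ccontr)
    assume "\<not> ?thesis"
    then have unb: "unbounded_in {\<beta>} \<kappa>" using \<beta> unfolding unbounded_in_def by force
    obtain \<alpha> where \<alpha>: "has_order_type {\<beta>} \<alpha>" using order_type_exists[of "{\<beta>}" \<kappa>] \<beta> by auto
    have "\<kappa> \<le> \<alpha>" using cf_le[OF unb \<alpha>] cf by simp
    then have "infinite {..<\<alpha>}" using inf by (meson finite_subset lessThan_subset_iff)
    then show False using order_type_card[OF \<alpha>] card_of_ordIso_finite by blast
  qed
  moreover have "{..<\<kappa>} \<noteq> {}" using inf by force
  ultimately show ?thesis unfolding limit_ord_def by blast
qed

text \<open>The element \<open>\<beta>\<close> guarantees that something lies above
  \<open>\<alpha>\<close> in the type; at a last element of the type, \<open>succ_ord\<close> would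
  be an unspecified value.\<close>

lemma succ_ord_greater:
  assumes "\<alpha> < (\<beta>::'a::wellorder)"
  shows "\<alpha> < succ_ord \<alpha>" "succ_ord \<alpha> \<le> \<beta>"
  unfolding succ_ord_def by (rule LeastI[of _ \<beta>], rule assms, rule Least_le, rule assms)

lemma limit_succ:
  assumes "limit_ord \<delta>" "\<alpha> < \<delta>"
  shows "succ_ord \<alpha> < \<delta>"
  using assms succ_ord_greater(2) unfolding limit_ord_def by (metis order_le_less_trans)

lemma regular_card_less:
  assumes "regular_cardinal \<kappa>" "\<alpha> < \<kappa>"
  shows "|{..<\<alpha>}| <o |{..<\<kappa>}|"
  using assms unfolding regular_cardinal_def cardinal_def by blast

lemma regular_bounded:
  fixes X :: "'a::wellorder set"
  assumes "regular_cardinal \<kappa>" "X \<subseteq> {..<\<kappa>}" "|X| <o |{..<\<kappa>}|"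
  shows "\<exists>\<beta><\<kappa>. \<forall>x\<in>X. x < \<beta>"
  using cf_small_bounded[of X \<kappa>] assms unfolding regular_cardinal_def by simp

lemma regular_bounded_fun:
  assumes "regular_cardinal \<kappa>" "\<zeta> < \<kappa>" "\<And>\<eta>. \<eta> < \<zeta> \<Longrightarrow> f \<eta> < \<kappa>"
  shows "\<exists>\<beta><\<kappa>. \<forall>\<eta><\<zeta>. f \<eta> < \<beta>"
  using cf_bounded[of \<zeta> \<kappa> f] assms unfolding regular_cardinal_def by auto

lemma is_sup_lub: "is_sup A \<zeta> \<Longrightarrow> \<alpha> < \<zeta> \<Longrightarrow> \<exists>x\<in>A. \<alpha> < x"
  unfolding is_sup_def by (meson leD leI)

lemma is_sup_upper: "is_sup A \<zeta> \<Longrightarrow> x \<in> A \<Longrightarrow> x \<le> \<zeta>"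
  unfolding is_sup_def by blast

lemma is_sup_iff_unbounded:
  assumes "limit_ord (\<delta>::'a::wellorder)" "u \<subseteq> {..<\<delta>}"
  shows "is_sup u \<delta> \<longleftrightarrow> unbounded_in u \<delta>"
proof
  assume "is_sup u \<delta>"
  then show "unbounded_in u \<delta>"
    using assms(2) is_sup_lub unfolding unbounded_in_def by (metis less_imp_le)
next
  assume u: "unbounded_in u \<delta>"
  have "\<delta> \<le> \<beta>" if "\<forall>\<alpha>\<in>u. \<alpha> \<le> \<beta>" for \<beta>
  proof (rule ccontr)
    assume "\<not> \<delta> \<le> \<beta>"
    then have "\<beta> < \<delta>" by simp
    then obtain \<gamma> where "\<gamma> < \<delta>" "\<beta> < \<gamma>" using assms(1) unfolding limit_ord_def by blast
    then show False using u that unfolding unbounded_in_def by (meson leD order_trans)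
  qed
  then show "is_sup u \<delta>" using assms(2) unfolding is_sup_def by (auto simp: less_imp_le)
qed

section \<open>Increasing continuous sequences\<close>

lemma incr_cont_less:
  "incr_cont \<rho> s \<delta> \<Longrightarrow> \<xi> < \<zeta> \<Longrightarrow> \<zeta> < \<rho> \<Longrightarrow> s \<xi> < s \<zeta>"
  unfolding incr_cont_def by (meson lessThan_iff less_trans strict_mono_onD)

lemma incr_cont_le_iff:
  "incr_cont \<rho> s \<delta> \<Longrightarrow> \<xi> < \<rho> \<Longrightarrow> \<zeta> < \<rho> \<Longrightarrow> s \<xi> \<le> s \<zeta> \<longleftrightarrow> \<xi> \<le> \<zeta>"
  by (metis incr_cont_less leD linorder_le_less_linear nle_le)

lemma incr_cont_less_iff:
  "incr_cont \<rho> s \<delta> \<Longrightarrow> \<xi> < \<rho> \<Longrightarrow> \<zeta> < \<rho> \<Longrightarrow> s \<xi> < s \<zeta> \<longleftrightarrow> \<xi> < \<zeta>"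
  by (metis incr_cont_le_iff not_le)

lemma incr_cont_below:
  assumes "incr_cont \<rho> s \<delta>" "limit_ord \<rho>" "\<xi> < \<rho>"
  shows "s \<xi> < \<delta>"
proof -
  obtain \<zeta> where "\<xi> < \<zeta>" "\<zeta> < \<rho>" using assms unfolding limit_ord_def by blast
  then show ?thesis using incr_cont_less[OF assms(1)] assms(1)
    unfolding incr_cont_def by (meson imageI is_sup_upper lessThan_iff order_less_le_trans)
qed

lemma incr_cont_cofinal:
  assumes "incr_cont \<rho> s \<delta>" "\<beta> < \<delta>"
  shows "\<exists>\<xi><\<rho>. \<beta> < s \<xi>"
  using assms is_sup_lub[of "s ` {..<\<rho>}" \<delta> \<beta>] unfolding incr_cont_def by auto

lemma incr_cont_cofinal_limit:
  assumes "incr_cont \<rho> s \<delta>" "\<zeta> < \<rho>" "limit_ord \<zeta>" "\<beta> < s \<zeta>"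
  shows "\<exists>\<xi><\<zeta>. \<beta> < s \<xi>"
  using assms is_sup_lub[of "s ` {..<\<zeta>}" "s \<zeta>" \<beta>] unfolding incr_cont_def by auto

lemma incr_cont_limit:
  assumes "incr_cont \<rho> s \<delta>" "limit_ord \<rho>"
  shows "limit_ord \<delta>"
proof -
  obtain \<xi> where "\<xi> < \<rho>" using assms(2) unfolding limit_ord_def by auto
  then show ?thesis
    using incr_cont_below[OF assms] incr_cont_cofinal[OF assms(1)] unfolding limit_ord_def by blast
qed

lemma incr_cont_limit_at:
  assumes "incr_cont \<rho> s \<delta>" "\<zeta> < \<rho>" "limit_ord \<zeta>"
  shows "limit_ord (s \<zeta>)"
proof -
  have "\<forall>\<xi><\<zeta>. s \<xi> < s \<zeta>" using incr_cont_less[OF assms(1)] assms(2) by blast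
  moreover obtain \<xi> where "\<xi> < \<zeta>" using assms(3) unfolding limit_ord_def by auto
  ultimately show ?thesis
    using incr_cont_cofinal_limit[OF assms] unfolding limit_ord_def by blast
qed

text \<open>If a cofinal sequence were shorter than \<open>\<rho>\<close>, each of its values could
  be moved up to some \<open>s (g \<eta>)\<close>; by regularity of \<open>\<rho>\<close> these
  indices have a bound \<open>\<beta>\<close> below \<open>\<rho>\<close>, so the sequence would
  stay below \<open>s \<beta>\<close>.\<close>

lemma cf_incr_cont:
  assumes s: "incr_cont \<rho> s \<delta>" and \<rho>: "regular_cardinal \<rho>"
  shows "cf \<delta> = \<rho>"
proof (rule antisym)
  note lim = regular_limit[OF \<rho>]
  have "unbounded_in (s ` {..<\<rho>}) \<delta>"
    unfolding unbounded_in_def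
    using incr_cont_below[OF s lim] incr_cont_cofinal[OF s] by (fastforce intro: less_imp_le)
  moreover have "has_order_type (s ` {..<\<rho>}) \<rho>"
    using s order_type_image unfolding incr_cont_def by blast
  ultimately show "cf \<delta> \<le> \<rho>" by (rule cf_le)
  show "\<rho> \<le> cf \<delta>"
  proof (rule ccontr)
    assume "\<not> \<rho> \<le> cf \<delta>"
    then have less: "cf \<delta> < \<rho>" by simp
    obtain f where "strict_mono_on {..<cf \<delta>} f" and f: "f ` {..<cf \<delta>} \<subseteq> {..<\<delta>}"
      "\<forall>\<beta><\<delta>. \<exists>\<eta><cf \<delta>. \<beta> \<le> f \<eta>"
      by (rule cf_sequence[of \<delta>])
    have "\<exists>\<xi>. \<xi> < \<rho> \<and> f \<eta> < s \<xi>" if "\<eta> < cf \<delta>" for \<eta>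
    proof -
      have "f \<eta> < \<delta>" using f(1) that by blast
      then show ?thesis using incr_cont_cofinal[OF s] by blast
    qed
    then obtain g where g: "\<And>\<eta>. \<eta> < cf \<delta> \<Longrightarrow> g \<eta> < \<rho> \<and> f \<eta> < s (g \<eta>)" by metis
    obtain \<beta> where \<beta>: "\<beta> < \<rho>" "\<forall>\<eta><cf \<delta>. g \<eta> < \<beta>"
      using regular_bounded_fun[OF \<rho> less, of g] g by blast
    obtain \<eta> where "\<eta> < cf \<delta>" "s \<beta> \<le> f \<eta>" using f(2) incr_cont_below[OF s lim \<beta>(1)] by blast
    then show False
      using g[of \<eta>] \<beta> incr_cont_less[OF s, of "g \<eta>" \<beta>] by force
  qed
qed

lemma incr_cont_exists:
  fixes \<delta> :: "'a::wellorder"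
  assumes \<rho>: "regular_cardinal \<rho>" and cf: "cf \<delta> = \<rho>"
  shows "\<exists>s. incr_cont \<rho> s \<delta>"
proof -
  note lim = regular_limit[OF \<rho>]
  obtain f where f: "strict_mono_on {..<\<rho>} f" "f ` {..<\<rho>} \<subseteq> {..<\<delta>}"
    "\<forall>\<beta><\<delta>. \<exists>\<eta><\<rho>. \<beta> \<le> f \<eta>"
    by (rule cf_sequence[of \<delta>, unfolded cf])
  have fm: "f \<xi> < f \<zeta>" if "\<xi> < \<zeta>" "\<zeta> < \<rho>" for \<xi> \<zeta>
    using f(1) that by (meson lessThan_iff less_trans strict_mono_onD)
  \<comment> \<open>The least strict upper bound of the earlier values of \<open>f\<close> replaces
    \<open>f \<zeta>\<close>. This makes \<open>s\<close> continuous at limits, and as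
    \<open>s\<close> exceeds \<open>f \<eta>\<close> at every index after \<open>\<eta>\<close>, it
    remains cofinal.\<close>
  define s where "s \<zeta> = (LEAST x. \<forall>\<eta><\<zeta>. f \<eta> < x)" for \<zeta>
  have s1: "s \<zeta> \<le> f \<zeta>" if "\<zeta> < \<rho>" for \<zeta>
    unfolding s_def by (rule Least_le) (use fm that in blast)
  have s2: "f \<eta> < s \<zeta>" if "\<eta> < \<zeta>" "\<zeta> < \<rho>" for \<eta> \<zeta>
  proof -
    have "\<forall>\<eta><\<zeta>. f \<eta> < s \<zeta>"
      unfolding s_def by (rule LeastI[of _ "f \<zeta>"]) (use fm that in blast)
    then show ?thesis using that by blast
  qed
  have sm: "s \<xi> < s \<zeta>" if "\<xi> < \<zeta>" "\<zeta> < \<rho>" for \<xi> \<zeta>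
    using s1[of \<xi>] s2[of \<xi> \<zeta>] that by (metis less_trans order_le_less_trans)
  have "strict_mono_on {..<\<rho>} s" using sm by (auto intro: strict_mono_onI)
  moreover have "is_sup (s ` {..<\<zeta>}) (s \<zeta>)" if \<zeta>: "\<zeta> < \<rho>" "limit_ord \<zeta>" for \<zeta>
    unfolding is_sup_def
  proof (intro conjI allI impI ballI)
    fix \<alpha> assume "\<alpha> \<in> s ` {..<\<zeta>}"
    then show "\<alpha> \<le> s \<zeta>" using sm \<zeta> by (auto intro: less_imp_le)
  next
    fix \<beta> assume b: "\<forall>\<alpha>\<in>s ` {..<\<zeta>}. \<alpha> \<le> \<beta>"
    have "f \<eta> < \<beta>" if \<eta>: "\<eta> < \<zeta>" for \<eta>
    proof -
      obtain \<xi> where "\<eta> < \<xi>" "\<xi> < \<zeta>" using \<zeta>(2) \<eta> unfolding limit_ord_def by blast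
      then have "f \<eta> < s \<xi>" "s \<xi> \<le> \<beta>" using s2[of \<eta> \<xi>] \<zeta>(1) b less_trans by blast+
      then show ?thesis by simp
    qed
    then show "s \<zeta> \<le> \<beta>" unfolding s_def by (intro Least_le) blast
  qed
  moreover have "is_sup (s ` {..<\<rho>}) \<delta>"
    unfolding is_sup_def
  proof (intro conjI allI impI ballI)
    fix \<alpha> assume "\<alpha> \<in> s ` {..<\<rho>}"
    then show "\<alpha> \<le> \<delta>" using s1 f(2) by fastforce
  next
    fix \<beta> assume b: "\<forall>\<alpha>\<in>s ` {..<\<rho>}. \<alpha> \<le> \<beta>"
    show "\<delta> \<le> \<beta>"
    proof (rule ccontr)
      assume "\<not> \<delta> \<le> \<beta>"
      then obtain \<eta> where \<eta>: "\<eta> < \<rho>" "\<beta> \<le> f \<eta>" using f(3) by force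
      then obtain \<xi> where \<xi>: "\<eta> < \<xi>" "\<xi> < \<rho>" using lim unfolding limit_ord_def by blast
      have "s \<xi> \<le> \<beta>" using b \<xi> by blast
      then show False using s2[of \<eta> \<xi>] \<xi> \<eta> by auto
    qed
  qed
  ultimately show ?thesis unfolding incr_cont_def by blast
qed

section \<open>Closure points of functions\<close>

lemma regular_uncountable:
  assumes "regular_cardinal \<kappa>" "aleph0 < \<kappa>"
  shows "|UNIV :: nat set| <o |{..<\<kappa>}|"
proof -
  have "infinite {..<aleph0::'a}"
    unfolding aleph0_def
    by (rule LeastI) (use assms(1) in \<open>auto simp: regular_cardinal_def\<close>)
  then have "|UNIV :: nat set| \<le>o |{..<aleph0::'a}|" using infinite_iff_card_of_nat by blast
  then show ?thesis using regular_card_less[OF assms] ordLeq_ordLess_trans by blast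
qed

text \<open>Common source of the clubs used for intersections, for agreement of sequences and for
  pulling clubs back: each arises from closure under a suitable \<open>F\<close>. A closure point
  above \<open>\<beta>\<close> is the limit of \<open>\<omega>\<close> steps of a function
  \<open>Y\<close> dominating \<open>F\<close>; it stays below \<open>\<kappa>\<close> because
  \<open>\<kappa>\<close> is regular and uncountable.\<close>

lemma closure_points_club:
  fixes \<kappa> :: "'a::wellorder"
  assumes \<kappa>: "regular_cardinal \<kappa>" "aleph0 < \<kappa>" and F: "\<And>\<eta>. \<eta> < \<kappa> \<Longrightarrow> F \<eta> < \<kappa>"
  shows "club {\<epsilon>. \<epsilon> < \<kappa> \<and> limit_ord \<epsilon> \<and> (\<forall>\<eta><\<epsilon>. F \<eta> < \<epsilon>)} \<kappa>" (is "club ?C \<kappa>")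
proof -
  note lim = regular_limit[OF \<kappa>(1)]
  have "\<exists>\<gamma>\<in>?C. \<beta> \<le> \<gamma>" if \<beta>: "\<beta> < \<kappa>" for \<beta>
  proof -
    have "\<exists>y<\<kappa>. x < y \<and> (\<forall>\<eta>\<le>x. F \<eta> < y)" if x: "x < \<kappa>" for x
    proof -
      obtain y where y: "y < \<kappa>" "\<forall>\<eta><succ_ord x. F \<eta> < y"
        using regular_bounded_fun[OF \<kappa>(1) limit_succ[OF lim x], of F] F limit_succ[OF lim x]
        by (meson less_trans)
      have "\<forall>\<eta>\<le>x. F \<eta> < y" using y(2) succ_ord_greater(1)[OF x] by (meson order_le_less_trans)
      moreover have "max y (succ_ord x) < \<kappa>" using y(1) limit_succ[OF lim x] by auto
      moreover have "x < max y (succ_ord x)" using succ_ord_greater(1)[OF x] by (auto simp: less_max_iff_disj)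
      ultimately show ?thesis by (metis less_max_iff_disj)
    qed
    then obtain Y where Y: "\<And>x. x < \<kappa> \<Longrightarrow> Y x < \<kappa> \<and> x < Y x \<and> (\<forall>\<eta>\<le>x. F \<eta> < Y x)" by metis
    define X where "X n = (Y ^^ n) \<beta>" for n
    have Xs: "X (Suc n) = Y (X n)" for n by (simp add: X_def)
    have X0: "X 0 = \<beta>" by (simp add: X_def)
    have Xk: "X n < \<kappa>" for n by (induction n) (use \<beta> Y in \<open>auto simp: X0 Xs\<close>)
    define \<epsilon> where "\<epsilon> = (LEAST y. \<forall>n. X n < y)"
    have "|range X| <o |{..<\<kappa>}|"
      using regular_uncountable[OF \<kappa>] card_of_image ordLeq_ordLess_trans by blast
    then obtain b where b: "b < \<kappa>" "\<forall>n. X n < b"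
      using regular_bounded[OF \<kappa>(1), of "range X"] Xk by blast
    have e1: "X n < \<epsilon>" for n
      using LeastI[of "\<lambda>y. \<forall>n. X n < y", OF b(2)] unfolding \<epsilon>_def by blast
    have e2: "\<epsilon> < \<kappa>" using Least_le[of "\<lambda>y. \<forall>n. X n < y", OF b(2)] b(1) unfolding \<epsilon>_def by simp
    have e3: "\<exists>n. y \<le> X n" if "y < \<epsilon>" for y
      using not_less_Least[OF that[unfolded \<epsilon>_def]] not_less by blast
    have "limit_ord \<epsilon>"
      unfolding limit_ord_def
    proof (intro conjI allI impI)
      show "{..<\<epsilon>} \<noteq> {}" using e1 by blast
      fix y assume "y < \<epsilon>"
      then obtain n where "y \<le> X n" using e3 by blast
      then have "y < X (Suc n)" using Y[OF Xk[of n]] Xs order_le_less_trans by metis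
      then show "\<exists>\<gamma><\<epsilon>. y < \<gamma>" using e1 by blast
    qed
    moreover have "\<forall>\<eta><\<epsilon>. F \<eta> < \<epsilon>"
    proof (intro allI impI)
      fix \<eta> assume "\<eta> < \<epsilon>"
      then obtain n where "\<eta> \<le> X n" using e3 by blast
      then have "F \<eta> < X (Suc n)" using Y[OF Xk[of n]] by (simp add: Xs)
      then show "F \<eta> < \<epsilon>" using e1 by (meson less_trans)
    qed
    ultimately have "\<epsilon> \<in> ?C" using e2 by blast
    moreover have "\<beta> \<le> \<epsilon>" using e1[of 0] X0 by simp
    ultimately show ?thesis by blast
  qed
  moreover have "\<alpha> \<in> ?C" if \<alpha>: "\<alpha> < \<kappa>" "limit_ord \<alpha>" "unbounded_in (?C \<inter> {..<\<alpha>}) \<alpha>" for \<alpha>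
  proof -
    have "F \<eta> < \<alpha>" if \<eta>: "\<eta> < \<alpha>" for \<eta>
    proof -
      obtain \<xi> where "\<xi> < \<alpha>" "\<eta> < \<xi>" using \<alpha>(2) \<eta> unfolding limit_ord_def by blast
      then obtain c where "c \<in> ?C" "c < \<alpha>" "\<xi> \<le> c" using \<alpha>(3) unfolding unbounded_in_def by blast
      then have "F \<eta> < c" using order_less_le_trans[OF \<open>\<eta> < \<xi>\<close>] by blast
      then show ?thesis using \<open>c < \<alpha>\<close> by (rule less_trans)
    qed
    then show ?thesis using \<alpha> by blast
  qed
  moreover have "?C \<subseteq> {..<\<kappa>}" by blast
  ultimately show ?thesis unfolding club_def unbounded_in_def[of ?C] by simp
qed

lemma club_superset:
  assumes "club C \<delta>" "C \<subseteq> D" "D \<subseteq> {..<\<delta>}"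
    and "\<And>\<alpha>. \<alpha> < \<delta> \<Longrightarrow> limit_ord \<alpha> \<Longrightarrow> unbounded_in (D \<inter> {..<\<alpha>}) \<alpha> \<Longrightarrow> \<alpha> \<in> D"
  shows "club D \<delta>"
  unfolding club_def
proof (intro conjI allI impI)
  have "\<forall>\<beta><\<delta>. \<exists>\<gamma>\<in>C. \<beta> \<le> \<gamma>" using assms(1) unfolding club_def unbounded_in_def by blast
  then show "unbounded_in D \<delta>" using assms(2,3) unfolding unbounded_in_def by blast
qed (use assms(4) in blast)

section \<open>Clubs and continuous sequences\<close>

lemma club_subset: "club C \<delta> \<Longrightarrow> C \<subseteq> {..<\<delta>}"
  unfolding club_def unbounded_in_def by blast

lemma club_cofinal: "club C \<delta> \<Longrightarrow> \<beta> < \<delta> \<Longrightarrow> \<exists>\<gamma>\<in>C. \<beta> \<le> \<gamma>"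
  unfolding club_def unbounded_in_def by blast

lemma club_closed:
  assumes "club C \<delta>" "\<alpha> < \<delta>" "limit_ord \<alpha>" "\<And>\<beta>. \<beta> < \<alpha> \<Longrightarrow> \<exists>\<gamma>\<in>C. \<beta> \<le> \<gamma> \<and> \<gamma> < \<alpha>"
  shows "\<alpha> \<in> C"
  using assms unfolding club_def unbounded_in_def by blast

lemma club_cofinal_strict:
  assumes "club C \<delta>" "limit_ord \<delta>" "\<beta> < \<delta>"
  shows "\<exists>\<gamma>\<in>C. \<beta> < \<gamma>"
proof -
  obtain \<gamma> where "\<gamma> < \<delta>" "\<beta> < \<gamma>" using assms unfolding limit_ord_def by blast
  then show ?thesis using club_cofinal[OF assms(1)] order_less_le_trans by blast
qed

lemma club_UNIV:
  assumes "limit_ord (\<delta>::'a::wellorder)"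
  shows "club {..<\<delta>} \<delta>"
  unfolding club_def unbounded_in_def by auto

text \<open>Above \<open>\<eta>\<close> pick one point of every \<open>E \<xi>\<close>, and let
  \<open>F \<eta>\<close> bound these fewer than \<open>\<kappa>\<close> points. A limit closed
  under \<open>F\<close> is then a limit of points of each \<open>E \<xi>\<close>.\<close>

lemma club_Inter:
  fixes \<kappa> :: "'a::wellorder"
  assumes \<kappa>: "regular_cardinal \<kappa>" "aleph0 < \<kappa>" and \<zeta>: "\<zeta> < \<kappa>"
    and E: "\<And>\<xi>. \<xi> < \<zeta> \<Longrightarrow> club (E \<xi>) \<kappa>"
  shows "club {x. x < \<kappa> \<and> (\<forall>\<xi><\<zeta>. x \<in> E \<xi>)} \<kappa>"
proof -
  note lim = regular_limit[OF \<kappa>(1)]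
  have "\<exists>y<\<kappa>. \<forall>\<xi><\<zeta>. \<exists>c\<in>E \<xi>. \<eta> < c \<and> c < y" if \<eta>: "\<eta> < \<kappa>" for \<eta>
  proof -
    have "\<exists>c. c \<in> E \<xi> \<and> \<eta> < c" if "\<xi> < \<zeta>" for \<xi>
      using club_cofinal_strict[OF E[OF that] lim \<eta>] by blast
    then obtain c where c: "\<And>\<xi>. \<xi> < \<zeta> \<Longrightarrow> c \<xi> \<in> E \<xi> \<and> \<eta> < c \<xi>" by metis
    have "c \<xi> < \<kappa>" if "\<xi> < \<zeta>" for \<xi> using c[OF that] club_subset[OF E[OF that]] by blast
    then obtain y where "y < \<kappa>" "\<forall>\<xi><\<zeta>. c \<xi> < y" using regular_bounded_fun[OF \<kappa>(1) \<zeta>, of c] by blast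
    then show ?thesis using c by blast
  qed
  then obtain F where F: "\<And>\<eta>. \<eta> < \<kappa> \<Longrightarrow> F \<eta> < \<kappa> \<and> (\<forall>\<xi><\<zeta>. \<exists>c\<in>E \<xi>. \<eta> < c \<and> c < F \<eta>)" by metis
  have "club {\<epsilon>. \<epsilon> < \<kappa> \<and> limit_ord \<epsilon> \<and> (\<forall>\<eta><\<epsilon>. F \<eta> < \<epsilon>)} \<kappa>"
    using closure_points_club[OF \<kappa>] F by blast
  then show ?thesis
  proof (rule club_superset)
    show "{\<epsilon>. \<epsilon> < \<kappa> \<and> limit_ord \<epsilon> \<and> (\<forall>\<eta><\<epsilon>. F \<eta> < \<epsilon>)} \<subseteq> {x. x < \<kappa> \<and> (\<forall>\<xi><\<zeta>. x \<in> E \<xi>)}"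
    proof
      fix \<epsilon> assume "\<epsilon> \<in> {\<epsilon>. \<epsilon> < \<kappa> \<and> limit_ord \<epsilon> \<and> (\<forall>\<eta><\<epsilon>. F \<eta> < \<epsilon>)}"
      then have \<epsilon>: "\<epsilon> < \<kappa>" "limit_ord \<epsilon>" "\<forall>\<eta><\<epsilon>. F \<eta> < \<epsilon>" by blast+
      have "\<epsilon> \<in> E \<xi>" if \<xi>: "\<xi> < \<zeta>" for \<xi>
      proof (rule club_closed[OF E[OF \<xi>] \<epsilon>(1,2)])
        fix \<beta> assume \<beta>: "\<beta> < \<epsilon>"
        then obtain c where "c \<in> E \<xi>" "\<beta> < c" "c < F \<beta>" using F[of \<beta>] \<epsilon>(1) \<xi> less_trans by blast
        then show "\<exists>\<gamma>\<in>E \<xi>. \<beta> \<le> \<gamma> \<and> \<gamma> < \<epsilon>" using \<epsilon>(3) \<beta> less_imp_le less_trans by blast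
      qed
      then show "\<epsilon> \<in> {x. x < \<kappa> \<and> (\<forall>\<xi><\<zeta>. x \<in> E \<xi>)}" using \<epsilon>(1) by blast
    qed
    show "{x. x < \<kappa> \<and> (\<forall>\<xi><\<zeta>. x \<in> E \<xi>)} \<subseteq> {..<\<kappa>}" by blast
    fix \<alpha> assume \<alpha>: "\<alpha> < \<kappa>" "limit_ord \<alpha>"
      and u: "unbounded_in ({x. x < \<kappa> \<and> (\<forall>\<xi><\<zeta>. x \<in> E \<xi>)} \<inter> {..<\<alpha>}) \<alpha>"
    have "\<alpha> \<in> E \<xi>" if "\<xi> < \<zeta>" for \<xi>
      by (rule club_closed[OF E[OF that] \<alpha>]) (use u that in \<open>unfold unbounded_in_def, blast\<close>)
    then show "\<alpha> \<in> {x. x < \<kappa> \<and> (\<forall>\<xi><\<zeta>. x \<in> E \<xi>)}" using \<alpha> by blast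
  qed
qed

lemma club_Int:
  fixes \<kappa> :: "'a::wellorder"
  assumes \<kappa>: "regular_cardinal \<kappa>" "aleph0 < \<kappa>" and CD: "club C \<kappa>" "club D \<kappa>"
  shows "club (C \<inter> D) \<kappa>"
proof -
  note lim = regular_limit[OF \<kappa>(1)]
  obtain a b where ab: "a < b" "b < \<kappa>"
    using lim unfolding limit_ord_def by blast
  \<comment> \<open>Two clubs are arranged as a family indexed below \<open>succ_ord b\<close>: the
    index \<open>a\<close> carries \<open>C\<close>, every other index carries \<open>D\<close>, and
    the index \<open>b\<close> ensures that \<open>D\<close> occurs.\<close>
  have "club {x. x < \<kappa> \<and> (\<forall>\<xi><succ_ord b. x \<in> (if \<xi> = a then C else D))} \<kappa>"
    by (rule club_Inter[OF \<kappa> limit_succ[OF lim ab(2)]]) (use CD in auto)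
  moreover have "{x. x < \<kappa> \<and> (\<forall>\<xi><succ_ord b. x \<in> (if \<xi> = a then C else D))} = C \<inter> D"
  proof -
    have "a < succ_ord b" "b < succ_ord b" "b \<noteq> a" using succ_ord_greater(1)[OF ab(2)] ab by auto
    then show ?thesis using club_subset[OF CD(1)] by (auto split: if_splits)
  qed
  ultimately show ?thesis by simp
qed

text \<open>The two sequences interleave: \<open>F\<close> sends an index of either one to an index
  where the other has passed it. At a limit closed under \<open>F\<close> both values are the same
  supremum.\<close>

lemma incr_cont_agree:
  fixes \<rho> :: "'a::wellorder"
  assumes \<rho>: "regular_cardinal \<rho>" "aleph0 < \<rho>" and s: "incr_cont \<rho> s \<delta>" and t: "incr_cont \<rho> t \<delta>"
  shows "\<exists>E. club E \<rho> \<and> (\<forall>\<epsilon>\<in>E. s \<epsilon> = t \<epsilon>)"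
proof -
  note lim = regular_limit[OF \<rho>(1)]
  have ex: "\<exists>y<\<rho>. \<beta> < s y \<and> \<beta> < t y" if \<beta>: "\<beta> < \<delta>" for \<beta>
  proof -
    obtain y z where yz: "y < \<rho>" "\<beta> < s y" "z < \<rho>" "\<beta> < t z"
      using incr_cont_cofinal[OF s \<beta>] incr_cont_cofinal[OF t \<beta>] by blast
    then have "max y z < \<rho>" "s y \<le> s (max y z)" "t z \<le> t (max y z)"
      using incr_cont_le_iff[OF s, of y "max y z"] incr_cont_le_iff[OF t, of z "max y z"] by auto
    then show ?thesis using yz order_less_le_trans by blast
  qed
  have "\<exists>y<\<rho>. s \<eta> < t y \<and> t \<eta> < s y" if \<eta>: "\<eta> < \<rho>" for \<eta>
  proof -
    have "max (s \<eta>) (t \<eta>) < \<delta>" using incr_cont_below[OF s lim \<eta>] incr_cont_below[OF t lim \<eta>] by simp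
    then show ?thesis using ex by (metis max_less_iff_conj)
  qed
  then obtain F where F: "\<And>\<eta>. \<eta> < \<rho> \<Longrightarrow> F \<eta> < \<rho> \<and> s \<eta> < t (F \<eta>) \<and> t \<eta> < s (F \<eta>)" by metis
  have le: "p \<epsilon> \<le> q \<epsilon>"
    if p: "incr_cont \<rho> p \<delta>" and q: "incr_cont \<rho> q \<delta>" and \<epsilon>: "\<epsilon> < \<rho>" "limit_ord \<epsilon>" "\<forall>\<eta><\<epsilon>. F \<eta> < \<epsilon>"
      and pq: "\<And>\<eta>. \<eta> < \<rho> \<Longrightarrow> p \<eta> < q (F \<eta>)" for p q \<epsilon>
  proof (rule ccontr)
    assume "\<not> p \<epsilon> \<le> q \<epsilon>"
    then obtain \<xi> where \<xi>: "\<xi> < \<epsilon>" "q \<epsilon> < p \<xi>" using incr_cont_cofinal_limit[OF p \<epsilon>(1,2), of "q \<epsilon>"] by force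
    have "p \<xi> < q (F \<xi>)" using pq \<xi>(1) \<epsilon>(1) less_trans by blast
    also have "\<dots> < q \<epsilon>" using incr_cont_less[OF q, of "F \<xi>" \<epsilon>] \<epsilon> \<xi>(1) by blast
    finally show False using \<xi>(2) by simp
  qed
  have "club {\<epsilon>. \<epsilon> < \<rho> \<and> limit_ord \<epsilon> \<and> (\<forall>\<eta><\<epsilon>. F \<eta> < \<epsilon>)} \<rho>"
    using closure_points_club[OF \<rho>] F by blast
  moreover have "s \<epsilon> = t \<epsilon>" if "\<epsilon> < \<rho>" "limit_ord \<epsilon>" "\<forall>\<eta><\<epsilon>. F \<eta> < \<epsilon>" for \<epsilon>
    using le[OF s t that] le[OF t s that] F by (metis antisym)
  ultimately show ?thesis by blast
qed

text \<open>The club \<open>C\<close> and the range of \<open>d\<close> interleave, so at a limit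
  index closed under \<open>F\<close> the value of \<open>d\<close> is a limit of points of
  \<open>C\<close>.\<close>

lemma club_pullback:
  fixes \<kappa> :: "'a::wellorder"
  assumes \<kappa>: "regular_cardinal \<kappa>" "aleph0 < \<kappa>" and d: "incr_cont \<kappa> d \<delta>" and C: "club C \<delta>"
  shows "\<exists>D. club D \<kappa> \<and> (\<forall>k\<in>D. d k \<in> C)"
proof -
  note lim = regular_limit[OF \<kappa>(1)]
  note lim' = incr_cont_limit[OF d lim]
  have "\<exists>y<\<kappa>. \<exists>c\<in>C. d \<eta> < c \<and> c < d y" if \<eta>: "\<eta> < \<kappa>" for \<eta>
  proof -
    obtain c where c: "c \<in> C" "d \<eta> < c"
      using club_cofinal_strict[OF C lim' incr_cont_below[OF d lim \<eta>]] by blast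
    then have "c < \<delta>" using club_subset[OF C] by blast
    then show ?thesis using incr_cont_cofinal[OF d] c by blast
  qed
  then obtain F where F: "\<And>\<eta>. \<eta> < \<kappa> \<Longrightarrow> F \<eta> < \<kappa> \<and> (\<exists>c\<in>C. d \<eta> < c \<and> c < d (F \<eta>))" by metis
  have "club {\<epsilon>. \<epsilon> < \<kappa> \<and> limit_ord \<epsilon> \<and> (\<forall>\<eta><\<epsilon>. F \<eta> < \<epsilon>)} \<kappa>"
    using closure_points_club[OF \<kappa>] F by blast
  moreover have "d \<epsilon> \<in> C" if \<epsilon>: "\<epsilon> < \<kappa>" "limit_ord \<epsilon>" "\<forall>\<eta><\<epsilon>. F \<eta> < \<epsilon>" for \<epsilon>
  proof (rule club_closed[OF C incr_cont_below[OF d lim \<epsilon>(1)] incr_cont_limit_at[OF d \<epsilon>(1,2)]])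
    fix \<beta> assume "\<beta> < d \<epsilon>"
    then obtain \<xi> where \<xi>: "\<xi> < \<epsilon>" "\<beta> < d \<xi>" using incr_cont_cofinal_limit[OF d \<epsilon>(1,2)] by blast
    then obtain c where c: "c \<in> C" "d \<xi> < c" "c < d (F \<xi>)" using F[of \<xi>] \<epsilon>(1) less_trans by blast
    have "d (F \<xi>) < d \<epsilon>" using incr_cont_less[OF d, of "F \<xi>" \<epsilon>] \<epsilon> \<xi>(1) by blast
    then have "\<beta> \<le> c" "c < d \<epsilon>" using \<xi>(2) c by auto
    then show "\<exists>\<gamma>\<in>C. \<beta> \<le> \<gamma> \<and> \<gamma> < d \<epsilon>" using c(1) by blast
  qed
  ultimately show ?thesis by blast
qed

text \<open>Here \<open>Q \<xi> i k\<close> is a demand which the values up to \<open>\<xi>\<close>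
  make on a later value \<open>k\<close>. By \<open>local\<close> it makes sense inside the
  recursion, by \<open>step\<close> and regularity of \<open>\<kappa>\<close> all earlier demands
  can be met at once, and by \<open>up\<close> they survive at suprema. Taking the least admissible
  value, rather than an arbitrary one, is what makes the sequence continuous.\<close>

lemma continuous_chain:
  fixes \<kappa> :: "'a::wellorder" and Q :: "'a \<Rightarrow> ('a \<Rightarrow> 'a) \<Rightarrow> 'a \<Rightarrow> bool"
  assumes \<kappa>: "regular_cardinal \<kappa>" and \<rho>: "regular_cardinal \<rho>" "\<rho> < \<kappa>" and C: "club C \<kappa>"
    and step: "\<And>\<xi> i. \<xi> < \<rho> \<Longrightarrow> \<forall>\<eta>\<le>\<xi>. i \<eta> < \<kappa> \<Longrightarrow> \<exists>k<\<kappa>. Q \<xi> i k"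
    and up: "\<And>\<xi> i k k'. Q \<xi> i k \<Longrightarrow> k \<le> k' \<Longrightarrow> k' < \<kappa> \<Longrightarrow> Q \<xi> i k'"
    and local: "\<And>\<xi> i i' k. \<forall>\<eta>\<le>\<xi>. i \<eta> = i' \<eta> \<Longrightarrow> Q \<xi> i k = Q \<xi> i' k"
  shows "\<exists>i j. j \<in> C \<and> incr_cont \<rho> i j \<and> (\<forall>\<zeta><\<rho>. i \<zeta> \<in> C) \<and> (\<forall>\<xi> \<zeta>. \<xi> < \<zeta> \<longrightarrow> \<zeta> < \<rho> \<longrightarrow> Q \<xi> i (i \<zeta>))"
proof -
  note lim = regular_limit[OF \<rho>(1)]
  have "\<exists>i. \<forall>\<zeta>. i \<zeta> = (LEAST k. k \<in> C \<and> (\<forall>\<xi><\<zeta>. i \<xi> < k \<and> Q \<xi> i k))"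
  proof (rule wellorder_rec[where F = "\<lambda>i \<zeta>. LEAST k. k \<in> C \<and> (\<forall>\<xi><\<zeta>. i \<xi> < k \<and> Q \<xi> i k)"])
    fix i i' :: "'a \<Rightarrow> 'a" and \<zeta> assume eq: "\<And>z. z < \<zeta> \<Longrightarrow> i z = i' z"
    have "i \<xi> < k \<and> Q \<xi> i k \<longleftrightarrow> i' \<xi> < k \<and> Q \<xi> i' k" if "\<xi> < \<zeta>" for \<xi> k
      using eq that local[of \<xi> i i' k] order_le_less_trans by metis
    then show "(LEAST k. k \<in> C \<and> (\<forall>\<xi><\<zeta>. i \<xi> < k \<and> Q \<xi> i k)) = (LEAST k. k \<in> C \<and> (\<forall>\<xi><\<zeta>. i' \<xi> < k \<and> Q \<xi> i' k))"
      by (simp cong: imp_cong)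
  qed
  then obtain i where i: "\<And>\<zeta>. i \<zeta> = (LEAST k. k \<in> C \<and> (\<forall>\<xi><\<zeta>. i \<xi> < k \<and> Q \<xi> i k))" by blast
  have iP: "i \<zeta> \<in> C \<and> (\<forall>\<xi><\<zeta>. i \<xi> < i \<zeta> \<and> Q \<xi> i (i \<zeta>))" if "\<zeta> < \<rho>" for \<zeta>
    using that
  proof (induction \<zeta> rule: less_induct)
    case (less \<zeta>)
    have \<zeta>: "\<zeta> < \<kappa>" using less.prems \<rho>(2) by simp
    have bd: "i \<xi> < \<kappa>" if "\<xi> < \<zeta>" for \<xi> using less that club_subset[OF C] less_trans by blast
    have "\<exists>k<\<kappa>. Q \<xi> i k" if "\<xi> < \<zeta>" for \<xi>
      by (rule step) (use that less.prems bd order_le_less_trans less_trans in blast)+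
    then obtain g where g: "\<And>\<xi>. \<xi> < \<zeta> \<Longrightarrow> g \<xi> < \<kappa> \<and> Q \<xi> i (g \<xi>)" by metis
    obtain b1 where b1: "b1 < \<kappa>" "\<forall>\<xi><\<zeta>. g \<xi> < b1" using regular_bounded_fun[OF \<kappa> \<zeta>, of g] g by blast
    obtain b2 where b2: "b2 < \<kappa>" "\<forall>\<xi><\<zeta>. i \<xi> < b2" using regular_bounded_fun[OF \<kappa> \<zeta>, of i] bd by blast
    obtain k where k: "k \<in> C" "max b1 b2 \<le> k" using club_cofinal[OF C, of "max b1 b2"] b1(1) b2(1) by auto
    have kk: "k < \<kappa>" using k(1) club_subset[OF C] by blast
    have "i \<xi> < k \<and> Q \<xi> i k" if "\<xi> < \<zeta>" for \<xi>
    proof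
      show "i \<xi> < k" using b2(2) that k(2) by force
      have "g \<xi> \<le> k" using b1(2) that k(2) by force
      then show "Q \<xi> i k" using up g[OF that] kk by blast
    qed
    then have "k \<in> C \<and> (\<forall>\<xi><\<zeta>. i \<xi> < k \<and> Q \<xi> i k)" using k(1) by blast
    note P = this
    define K where "K = (LEAST k. k \<in> C \<and> (\<forall>\<xi><\<zeta>. i \<xi> < k \<and> Q \<xi> i k))"
    have "K \<in> C \<and> (\<forall>\<xi><\<zeta>. i \<xi> < K \<and> Q \<xi> i K)" unfolding K_def by (rule LeastI) (rule P)
    moreover have "i \<zeta> = K" unfolding K_def by (rule i)
    ultimately show ?case by simp
  qed
  have ik: "i \<zeta> < \<kappa>" if "\<zeta> < \<rho>" for \<zeta> using iP[OF that] club_subset[OF C] by blast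
  have lub: "\<exists>y. is_sup (i ` {..<\<zeta>}) y \<and> y \<in> C \<and> (\<forall>\<xi><\<zeta>. i \<xi> < y \<and> Q \<xi> i y)"
    if \<zeta>: "\<zeta> \<le> \<rho>" "limit_ord \<zeta>" for \<zeta>
  proof -
    define y where "y = (LEAST y. \<forall>\<xi><\<zeta>. i \<xi> < y)"
    obtain b where b: "b < \<kappa>" "\<forall>\<xi><\<zeta>. i \<xi> < b"
      using regular_bounded_fun[OF \<kappa>, of \<zeta> i] ik \<zeta>(1) \<rho>(2) by (metis order_le_less_trans order_less_le_trans)
    have y1: "\<forall>\<xi><\<zeta>. i \<xi> < y" unfolding y_def by (rule LeastI, rule b(2))
    have y2: "y < \<kappa>" unfolding y_def using Least_le[of "\<lambda>y. \<forall>\<xi><\<zeta>. i \<xi> < y", OF b(2)] b(1) by simp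
    have y3: "\<exists>\<xi><\<zeta>. x < i \<xi>" if x: "x < y" for x
    proof -
      obtain \<xi> where \<xi>: "\<xi> < \<zeta>" "x \<le> i \<xi>"
        using not_less_Least[OF x[unfolded y_def]] not_less by blast
      obtain \<xi>' where \<xi>': "\<xi> < \<xi>'" "\<xi>' < \<zeta>" using \<zeta>(2) \<xi>(1) unfolding limit_ord_def by blast
      have "i \<xi> < i \<xi>'" using iP[of \<xi>'] \<xi>' \<zeta>(1) by simp
      then show ?thesis using \<xi> \<xi>' by auto
    qed
    have "limit_ord y" unfolding limit_ord_def
    proof (intro conjI allI impI)
      show "{..<y} \<noteq> {}" using \<zeta>(2) y1 unfolding limit_ord_def by blast
      fix x assume "x < y"
      then show "\<exists>\<gamma><y. x < \<gamma>" using y1 y3 by blast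
    qed
    then have "y \<in> C"
    proof (rule club_closed[OF C y2])
      fix x assume "x < y"
      then obtain \<xi> where "\<xi> < \<zeta>" "x < i \<xi>" using y3 by blast
      then show "\<exists>\<gamma>\<in>C. x \<le> \<gamma> \<and> \<gamma> < y" using y1 iP[of \<xi>] \<zeta>(1) by (metis less_imp_le order_less_le_trans)
    qed
    moreover have "is_sup (i ` {..<\<zeta>}) y"
      unfolding is_sup_def
    proof (intro conjI allI impI ballI)
      fix x assume "x \<in> i ` {..<\<zeta>}"
      then show "x \<le> y" using y1 by (auto intro: less_imp_le)
    next
      fix \<beta> assume "\<forall>\<alpha>\<in>i ` {..<\<zeta>}. \<alpha> \<le> \<beta>"
      then have "\<not> \<beta> < i \<xi>" if "\<xi> < \<zeta>" for \<xi> using that by (simp add: not_less)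
      then have "\<not> \<beta> < y" using y3 by blast
      then show "y \<le> \<beta>" by simp
    qed
    moreover have "Q \<xi> i y" if \<xi>: "\<xi> < \<zeta>" for \<xi>
    proof -
      obtain \<xi>' where \<xi>': "\<xi> < \<xi>'" "\<xi>' < \<zeta>" using \<zeta>(2) \<xi>(1) unfolding limit_ord_def by blast
      then have "Q \<xi> i (i \<xi>')" using iP[of \<xi>'] \<zeta>(1) by simp
      then show ?thesis using up y1 y2 \<xi>' less_imp_le by blast
    qed
    ultimately show ?thesis using y1 by blast
  qed
  obtain j where j: "is_sup (i ` {..<\<rho>}) j" "j \<in> C" using lub[OF order_refl lim] by blast
  have "incr_cont \<rho> i j"
    unfolding incr_cont_def
  proof (intro conjI allI impI)
    show "strict_mono_on {..<\<rho>} i" using iP by (auto intro: strict_mono_onI)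
    show "is_sup (i ` {..<\<rho>}) j" by (rule j(1))
    fix \<zeta> assume \<zeta>: "\<zeta> < \<rho>" "limit_ord \<zeta>"
    then obtain y where y: "is_sup (i ` {..<\<zeta>}) y" "y \<in> C" "\<forall>\<xi><\<zeta>. i \<xi> < y \<and> Q \<xi> i y"
      using lub[OF less_imp_le] by blast
    \<comment> \<open>The supremum \<open>y\<close> of the earlier values is itself admissible, so
      the least admissible value cannot jump over it.\<close>
    have "i \<zeta> \<le> y" by (subst i, rule Least_le) (use y in blast)
    moreover have "y \<le> i \<zeta>" using y(1) iP[OF \<zeta>(1)] unfolding is_sup_def by (auto intro: less_imp_le)
    ultimately show "is_sup (i ` {..<\<zeta>}) (i \<zeta>)" using y(1) by simp
  qed
  then show ?thesis using j(2) iP by blast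
qed

lemma club_chain:
  fixes \<kappa> :: "'a::wellorder"
  assumes "regular_cardinal \<kappa>" "regular_cardinal \<rho>" "\<rho> < \<kappa>" "club C \<kappa>"
  shows "\<exists>i j. j \<in> C \<and> incr_cont \<rho> i j \<and> (\<forall>\<zeta><\<rho>. i \<zeta> \<in> C)"
proof -
  have "\<exists>k<\<kappa>. True" using assms(3) by blast
  then show ?thesis using continuous_chain[OF assms, of "\<lambda>_ _ _. True"] by blast
qed

section \<open>Club guessing\<close>

lemma card_of_not_ordLeq: "\<not> |A| \<le>o |B| \<longleftrightarrow> |B| <o |A|"
  by (rule not_ordLeq_iff_ordLess[OF card_of_Well_order card_of_Well_order])

lemma card_of_finite_ordLess: "finite A \<Longrightarrow> infinite B \<Longrightarrow> |A| <o |B|"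
  by (rule finite_ordLess_infinite) (simp_all add: card_of_well_order_on Field_card_of)

lemma card_of_Un_ordLeq:
  "infinite C \<Longrightarrow> |A| \<le>o |C| \<Longrightarrow> |B| \<le>o |C| \<Longrightarrow> |A \<union> B| \<le>o |C|"
  by (rule card_of_Un_ordLeq_infinite_Field) (simp_all add: Field_card_of card_of_card_order_on)

text \<open>The ordinal \<open>\<mu>\<close> is the cardinality of \<open>x\<close>, realised in the
  type. It is a cardinal at most \<open>x\<close>, hence below \<open>succ_card \<theta>\<close>,
  and so cannot exceed \<open>\<theta>\<close>.\<close>

lemma below_succ_card:
  fixes \<theta> :: "'a::wellorder"
  assumes x: "x < succ_card \<theta>"
  shows "|{..<x}| \<le>o |{..<\<theta>}|"
proof -
  define \<mu> :: 'a where "\<mu> = (LEAST y. |{..<x}| \<le>o |{..<y}| )"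
  have \<mu>: "|{..<x}| \<le>o |{..<\<mu>}|" unfolding \<mu>_def 
    by (rule LeastI[where P = "\<lambda>y. |{..<x}| \<le>o |{..<y}|" and k = x]) (rule card_of_mono1, rule order_refl)
  have "\<mu> \<le> x" unfolding \<mu>_def by (rule Least_le) (rule card_of_mono1, rule order_refl)
  have "cardinal \<mu>"
    unfolding cardinal_def
  proof (intro allI impI)
    fix \<alpha> assume "\<alpha> < \<mu>"
    then have "\<not> |{..<x}| \<le>o |{..<\<alpha>}|" unfolding \<mu>_def by (rule not_less_Least)
    then have "|{..<\<alpha>}| <o |{..<x}|" unfolding card_of_not_ordLeq .
    then show "|{..<\<alpha>}| <o |{..<\<mu>}|" using \<mu> ordLess_ordLeq_trans by blast
  qed
  then have "\<not> \<theta> < \<mu>"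
    using not_less_Least[of \<mu> "\<lambda>\<mu>. cardinal \<mu> \<and> \<theta> < \<mu>"] \<open>\<mu> \<le> x\<close> x unfolding succ_card_def
    by (meson order_le_less_trans)
  then have "|{..<\<mu>}| \<le>o |{..<\<theta>}|" by (intro card_of_mono1) auto
  then show ?thesis using \<mu> ordLeq_transitive by blast
qed

lemma cardinal_succ_card:
  fixes \<theta> :: "'a::wellorder"
  assumes "cardinal \<rho>" "\<theta> < \<rho>"
  shows "cardinal (succ_card \<theta>)" "\<theta> < succ_card \<theta>"
proof -
  have "cardinal (succ_card \<theta>) \<and> \<theta> < succ_card \<theta>"
    unfolding succ_card_def by (rule LeastI) (use assms in blast)
  then show "cardinal (succ_card \<theta>)" "\<theta> < succ_card \<theta>" by auto
qed

text \<open>The regularity of a successor cardinal in the form used below: an unbounded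
  \<open>f\<close> would cover \<open>succ_card \<theta>\<close> by \<open>\<theta>\<close> many
  sets of size at most \<open>\<theta>\<close>.\<close>

lemma succ_card_bounded:
  fixes \<theta> :: "'a::wellorder"
  assumes inf: "infinite {..<\<theta>}" and c: "cardinal (succ_card \<theta>)" "\<theta> < succ_card \<theta>"
    and f: "\<And>\<eta>. \<eta> < \<theta> \<Longrightarrow> f \<eta> < succ_card \<theta>"
  shows "\<exists>\<beta><succ_card \<theta>. \<forall>\<eta><\<theta>. f \<eta> < \<beta>"
proof (rule ccontr)
  assume "\<not> ?thesis"
  then have "\<exists>\<eta><\<theta>. \<beta> \<le> f \<eta>" if "\<beta> < succ_card \<theta>" for \<beta> using that not_less by blast
  then have "{..<succ_card \<theta>} \<subseteq> (\<Union>\<eta>\<in>{..<\<theta>}. {..f \<eta>})" by force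
  then have 1: "|{..<succ_card \<theta>}| \<le>o |\<Union>\<eta>\<in>{..<\<theta>}. {..f \<eta>}|" by (rule card_of_mono1)
  have "|{..x}| \<le>o |{..<\<theta>}|" if "x < succ_card \<theta>" for x
  proof -
    have "|{..<x} \<union> {x}| \<le>o |{..<\<theta>}|"
      using card_of_Un_ordLeq[OF inf below_succ_card[OF that]] card_of_finite_ordLess[OF _ inf]
        ordLess_imp_ordLeq by blast
    then show ?thesis by (simp only: ivl_disj_un_singleton)
  qed
  then have "|\<Union>\<eta>\<in>{..<\<theta>}. {..f \<eta>}| \<le>o |{..<\<theta>}|"
    using f card_of_mono1[OF order_refl] by (intro card_of_UNION_ordLeq_infinite[OF inf]) auto
  then have "|{..<succ_card \<theta>}| \<le>o |{..<\<theta>}|" using 1 ordLeq_transitive by blast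
  moreover have "|{..<\<theta>}| <o |{..<succ_card \<theta>}|" using c unfolding cardinal_def by blast
  ultimately show False using not_ordLess_ordLeq by blast
qed

text \<open>A relation rather than a function, because \<open>E\<close> may have no point up to
  \<open>\<alpha>\<close>; such an \<open>\<alpha>\<close> then contributes nothing to a
  guess.\<close>

definition greatest_below :: "'a::wellorder set \<Rightarrow> 'a \<Rightarrow> 'a \<Rightarrow> bool" where
  "greatest_below E \<alpha> m \<longleftrightarrow> m \<in> E \<and> m \<le> \<alpha> \<and> (\<forall>x\<in>E. x \<le> \<alpha> \<longrightarrow> x \<le> m)"

lemma greatest_below_unique:
  "greatest_below E \<alpha> m \<Longrightarrow> greatest_below E \<alpha> m' \<Longrightarrow> m = m'"
  unfolding greatest_below_def by (meson antisym)

text \<open>The supremum of the points of \<open>E\<close> up to \<open>\<alpha>\<close> is either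
  one of them or a limit of them, and in the second case it belongs to \<open>E\<close> by
  closure.\<close>

lemma greatest_below_exists:
  fixes E :: "'a::wellorder set"
  assumes E: "club E \<delta>" and \<alpha>: "\<alpha> < \<delta>" and x: "x \<in> E" "x \<le> \<alpha>"
  shows "\<exists>m. greatest_below E \<alpha> m"
proof -
  define m where "m = (LEAST y. \<forall>x\<in>E. x \<le> \<alpha> \<longrightarrow> x \<le> y)"
  have m1: "\<forall>x\<in>E. x \<le> \<alpha> \<longrightarrow> x \<le> m" unfolding m_def by (rule LeastI[of _ \<alpha>]) blast
  have m2: "m \<le> \<alpha>" unfolding m_def by (rule Least_le) blast
  have m3: "\<exists>x\<in>E. x \<le> \<alpha> \<and> y < x" if y: "y < m" for y
    using not_less_Least[OF y[unfolded m_def]] not_less by blast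
  have "m \<in> E"
  proof (rule ccontr)
    assume m: "m \<notin> E"
    have strict: "x < m" if "x \<in> E" "x \<le> \<alpha>" for x using m1 m that by (metis order_le_less)
    have "limit_ord m" unfolding limit_ord_def
    proof (intro conjI allI impI)
      show "{..<m} \<noteq> {}" using strict[OF x] by blast
      fix y assume "y < m"
      then show "\<exists>\<gamma><m. y < \<gamma>" using m3 strict by blast
    qed
    then have "m \<in> E"
    proof (rule club_closed[OF E order_le_less_trans[OF m2 \<alpha>]])
      fix y assume "y < m"
      then show "\<exists>\<gamma>\<in>E. y \<le> \<gamma> \<and> \<gamma> < m" using m3 strict less_imp_le by blast
    qed
    then show False using m by blast
  qed
  then show ?thesis using m1 m2 unfolding greatest_below_def by blast
qed

text \<open>If no club \<open>E\<close> worked, iterate the counterexamples \<open>succ_card \<theta>\<close> times. Along the resulting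
  decreasing sequence, the greatest points below each of the \<open>\<theta>\<close> members of a cofinal set of \<open>\<delta>\<close>
  stabilise, so one stage is contained in its own counterexample.\<close>

lemma club_guessing:
  fixes \<rho> :: "'a::wellorder"
  assumes \<rho>: "regular_cardinal \<rho>" "aleph0 < \<rho>" and \<theta>: "regular_cardinal \<theta>"
    and less: "succ_card \<theta> < \<rho>" "\<theta> < succ_card \<theta>"
  shows "\<exists>C. (\<forall>\<delta>. C \<delta> \<subseteq> {..<\<delta>}) \<and> (\<forall>\<delta>. cf \<delta> = \<theta> \<longrightarrow> |C \<delta>| \<le>o |{..<\<theta>}| ) \<and>
    (\<forall>D. club D \<rho> \<longrightarrow> (\<exists>\<delta><\<rho>. cf \<delta> = \<theta> \<and> C \<delta> \<subseteq> D \<and> is_sup (C \<delta>) \<delta>))"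
proof -
  note lim = regular_limit[OF \<rho>(1)]
  define \<kappa> where "\<kappa> = succ_card \<theta>"
  have \<theta>\<rho>: "\<theta> < \<rho>" using less by simp
  have \<kappa>: "cardinal \<kappa>" "\<theta> < \<kappa>" "\<kappa> < \<rho>"
    using cardinal_succ_card[OF _ \<theta>\<rho>] \<rho>(1) less unfolding \<kappa>_def regular_cardinal_def by auto
  have inf: "infinite {..<\<theta>}" using \<theta> unfolding regular_cardinal_def by blast
  have "\<exists>f. f ` {..<cf \<delta>} \<subseteq> {..<\<delta>} \<and> (\<forall>\<beta><\<delta>. \<exists>\<eta><cf \<delta>. \<beta> \<le> f \<eta>)" for \<delta> :: 'a
    by (rule cf_sequence[of \<delta>]) blast
  then obtain f :: "'a \<Rightarrow> 'a \<Rightarrow> 'a" where f: "\<And>\<delta>. f \<delta> ` {..<cf \<delta>} \<subseteq> {..<\<delta>}"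
    "\<And>\<delta>. \<forall>\<beta><\<delta>. \<exists>\<eta><cf \<delta>. \<beta> \<le> f \<delta> \<eta>" by metis
  \<comment> \<open>The values of \<open>f \<delta>\<close> form a cofinal set of
    \<open>\<delta>\<close> fixed in advance; the guess built from \<open>E\<close> lowers each of
    them to the nearest point of \<open>E\<close>. Improving the guesses thus means shrinking
    \<open>E\<close>.\<close>
  define G where "G E \<delta> = {m. \<exists>\<eta><cf \<delta>. greatest_below E (f \<delta> \<eta>) m}" for E \<delta>
  have G1: "G E \<delta> \<subseteq> {..<\<delta>}" for E \<delta>
    using f(1)[of \<delta>] unfolding G_def greatest_below_def by (auto intro: order_le_less_trans)
  have G2: "|G E \<delta>| \<le>o |{..<\<theta>}|" if c: "cf \<delta> = \<theta>" for E \<delta>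
  proof -
    have "G E \<delta> \<subseteq> (\<lambda>\<eta>. THE m. greatest_below E (f \<delta> \<eta>) m) ` {..<\<theta>}"
    proof
      fix m assume "m \<in> G E \<delta>"
      then obtain \<eta> where \<eta>: "\<eta> < \<theta>" "greatest_below E (f \<delta> \<eta>) m" unfolding G_def c by blast
      then have "(THE m. greatest_below E (f \<delta> \<eta>) m) = m" by (intro the_equality greatest_below_unique)
      then show "m \<in> (\<lambda>\<eta>. THE m. greatest_below E (f \<delta> \<eta>) m) ` {..<\<theta>}" using \<eta>(1) by force
    qed
    then show ?thesis using card_of_image card_of_mono1 ordLeq_transitive by blast
  qed
  define guesses where "guesses E \<longleftrightarrow> (\<forall>D. club D \<rho> \<longrightarrow>
      (\<exists>\<delta><\<rho>. cf \<delta> = \<theta> \<and> G E \<delta> \<subseteq> D \<and> is_sup (G E \<delta>) \<delta>))" for E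
  have "\<exists>E. guesses E"
  proof (rule ccontr)
    assume "\<nexists>E. guesses E"
    then have "\<exists>D. club D \<rho> \<and> (\<forall>\<delta><\<rho>. cf \<delta> = \<theta> \<longrightarrow> is_sup (G E \<delta>) \<delta> \<longrightarrow> \<not> G E \<delta> \<subseteq> D)" for E
      unfolding guesses_def by blast
    then obtain D where D: "\<And>E. club (D E) \<rho>"
      "\<And>E \<delta>. \<delta> < \<rho> \<Longrightarrow> cf \<delta> = \<theta> \<Longrightarrow> is_sup (G E \<delta>) \<delta> \<Longrightarrow> \<not> G E \<delta> \<subseteq> D E" by metis
    \<comment> \<open>Each stage intersects the clubs that defeat the earlier stages, so
      \<open>E (succ_ord b) \<subseteq> D (E b)\<close>.\<close>
    have "\<exists>E :: 'a \<Rightarrow> 'a set. \<forall>\<xi>. E \<xi> = {x. x < \<rho> \<and> (\<forall>\<eta><\<xi>. x \<in> D (E \<eta>))}"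
      by (rule wellorder_rec[where F = "\<lambda>E \<xi>. {x. x < \<rho> \<and> (\<forall>\<eta><\<xi>. x \<in> D (E \<eta>))}"]) simp
    then obtain E :: "'a \<Rightarrow> 'a set" where E: "\<And>\<xi>. E \<xi> = {x. x < \<rho> \<and> (\<forall>\<eta><\<xi>. x \<in> D (E \<eta>))}" by blast
    have clubE: "club (E \<xi>) \<rho>" if "\<xi> < \<rho>" for \<xi>
      by (subst E, rule club_Inter[OF \<rho> that D(1)])
    have anti: "E \<xi> \<subseteq> E \<eta>" if "\<eta> \<le> \<xi>" for \<eta> \<xi>
      using that by (subst (1 2) E) (blast intro: order_less_le_trans)
    \<comment> \<open>This \<open>\<delta>\<close> has cofinality \<open>\<theta>\<close> and is a
      limit of points of \<open>E \<kappa>\<close>, hence of every earlier stage; therefore the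
      guess at \<open>\<delta>\<close> is cofinal at all stages.\<close>
    obtain i \<delta> where \<delta>: "\<delta> \<in> E \<kappa>" and i: "incr_cont \<theta> i \<delta>" "\<forall>\<zeta><\<theta>. i \<zeta> \<in> E \<kappa>"
      using club_chain[OF \<rho>(1) \<theta> \<theta>\<rho> clubE[OF \<kappa>(3)]] by blast
    have \<delta>\<rho>: "\<delta> < \<rho>" using \<delta> club_subset[OF clubE[OF \<kappa>(3)]] by blast
    have cf: "cf \<delta> = \<theta>" by (rule cf_incr_cont[OF i(1) \<theta>])
    have limd: "limit_ord \<delta>" by (rule incr_cont_limit[OF i(1) regular_limit[OF \<theta>]])
    have fd: "f \<delta> \<eta> < \<delta>" if "\<eta> < \<theta>" for \<eta> using f(1)[of \<delta>] cf that by auto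
    have sup: "is_sup (G (E \<xi>) \<delta>) \<delta>" if \<xi>: "\<xi> < \<kappa>" for \<xi>
      unfolding is_sup_iff_unbounded[OF limd G1] unbounded_in_def
    proof (intro conjI allI impI)
      show "G (E \<xi>) \<delta> \<subseteq> {..<\<delta>}" by (rule G1)
      fix \<beta> assume "\<beta> < \<delta>"
      then obtain \<zeta> where \<zeta>: "\<zeta> < \<theta>" "\<beta> < i \<zeta>" using incr_cont_cofinal[OF i(1)] by blast
      obtain \<eta> where \<eta>: "\<eta> < \<theta>" "i \<zeta> \<le> f \<delta> \<eta>"
        using f(2)[of \<delta>] incr_cont_below[OF i(1) regular_limit[OF \<theta>] \<zeta>(1)] cf by blast
      have mem: "i \<zeta> \<in> E \<xi>" using i(2) \<zeta>(1) anti[OF less_imp_le[OF \<xi>]] by blast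
      obtain m where m: "greatest_below (E \<xi>) (f \<delta> \<eta>) m"
        using greatest_below_exists[OF clubE[of \<xi>] _ mem \<eta>(2)] \<xi> \<kappa>(3) fd[OF \<eta>(1)] \<delta>\<rho> less_trans by blast
      then have "i \<zeta> \<le> m" using mem \<eta>(2) unfolding greatest_below_def by blast
      then have "\<beta> \<le> m" using \<zeta>(2) by simp
      then show "\<exists>\<gamma>\<in>G (E \<xi>) \<delta>. \<beta> \<le> \<gamma>" using m \<eta>(1) unfolding G_def cf by blast
    qed
    \<comment> \<open>When the stages shrink, the greatest point up to \<open>\<alpha>\<close> can
      only move down, which happens finitely often. Formulated as a membership, the claim is vacuous
      once a stage has no point up to \<open>\<alpha>\<close>.\<close>
    have stab: "\<exists>\<xi><\<kappa>. \<forall>\<eta> \<eta>' m. \<xi> \<le> \<eta> \<longrightarrow> \<eta> \<le> \<eta>' \<longrightarrow> \<eta>' < \<kappa> \<longrightarrow> greatest_below (E \<eta>) \<alpha> m \<longrightarrow> m \<in> E \<eta>'"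
      if \<alpha>: "\<alpha> < \<delta>" for \<alpha>
    proof (cases "\<exists>\<xi><\<kappa>. \<forall>x\<in>E \<xi>. \<not> x \<le> \<alpha>")
      case True
      then obtain \<xi> where \<xi>: "\<xi> < \<kappa>" "\<forall>x\<in>E \<xi>. \<not> x \<le> \<alpha>" by blast
      have "\<not> greatest_below (E \<eta>) \<alpha> m" if "\<xi> \<le> \<eta>" for \<eta> m
        using \<xi>(2) anti[OF that] unfolding greatest_below_def by blast
      then show ?thesis using \<xi>(1) by blast
    next
      case False
      have ex: "\<exists>m. greatest_below (E \<xi>) \<alpha> m" if \<xi>: "\<xi> < \<kappa>" for \<xi>
      proof -
        obtain x where "x \<in> E \<xi>" "x \<le> \<alpha>" using False \<xi> by blast
        then show ?thesis using greatest_below_exists[OF clubE[of \<xi>], of \<alpha> x] \<xi> \<kappa>(3) \<alpha> \<delta>\<rho> less_trans by blast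
      qed
      define m0 where "m0 = (LEAST m. \<exists>\<xi><\<kappa>. greatest_below (E \<xi>) \<alpha> m)"
      obtain m1 where "greatest_below (E \<theta>) \<alpha> m1" using ex[OF \<kappa>(2)] by blast
      then have "\<exists>\<xi><\<kappa>. greatest_below (E \<xi>) \<alpha> m0"
        unfolding m0_def using \<kappa>(2) by (intro LeastI[where P = "\<lambda>m. \<exists>\<xi><\<kappa>. greatest_below (E \<xi>) \<alpha> m"]) blast
      then obtain \<xi> where \<xi>: "\<xi> < \<kappa>" "greatest_below (E \<xi>) \<alpha> m0" by blast
      have const: "m = m0" if \<eta>: "\<xi> \<le> \<eta>" "\<eta> < \<kappa>" "greatest_below (E \<eta>) \<alpha> m" for \<eta> m
      proof (rule antisym)
        show "m0 \<le> m" unfolding m0_def by (rule Least_le) (use \<eta> in blast)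
        show "m \<le> m0" using \<eta>(3) \<xi>(2) anti[OF \<eta>(1)] unfolding greatest_below_def by blast
      qed
      have "m \<in> E \<eta>'" if h: "\<xi> \<le> \<eta>" "\<eta> \<le> \<eta>'" "\<eta>' < \<kappa>" "greatest_below (E \<eta>) \<alpha> m" for \<eta> \<eta>' m
      proof -
        obtain m' where m': "greatest_below (E \<eta>') \<alpha> m'" using ex h(3) by blast
        have "m = m0" by (rule const[OF h(1) order_le_less_trans[OF h(2,3)] h(4)])
        moreover have "m' = m0" by (rule const[OF order_trans[OF h(1,2)] h(3) m'])
        ultimately show ?thesis using m' unfolding greatest_below_def by blast
      qed
      then show ?thesis using \<xi>(1) by blast
    qed
    have "\<forall>\<eta>. \<exists>\<xi>. \<eta> < \<theta> \<longrightarrow> \<xi> < \<kappa> \<and> (\<forall>\<zeta> \<zeta>' m. \<xi> \<le> \<zeta> \<longrightarrow> \<zeta> \<le> \<zeta>' \<longrightarrow> \<zeta>' < \<kappa> \<longrightarrow>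
        greatest_below (E \<zeta>) (f \<delta> \<eta>) m \<longrightarrow> m \<in> E \<zeta>')"
      using stab fd by blast
    then obtain h where h: "\<And>\<eta>. \<eta> < \<theta> \<Longrightarrow> h \<eta> < \<kappa>"
      "\<And>\<eta> \<zeta> \<zeta>' m. \<eta> < \<theta> \<Longrightarrow> h \<eta> \<le> \<zeta> \<Longrightarrow> \<zeta> \<le> \<zeta>' \<Longrightarrow> \<zeta>' < \<kappa> \<Longrightarrow>
        greatest_below (E \<zeta>) (f \<delta> \<eta>) m \<Longrightarrow> m \<in> E \<zeta>'" by metis
    \<comment> \<open>The \<open>\<theta>\<close> many stabilisation stages have a common bound
      because the iteration has length \<open>succ_card \<theta>\<close>.\<close>
    obtain b where b: "b < \<kappa>" "\<forall>\<eta><\<theta>. h \<eta> < b"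
      using succ_card_bounded[OF inf, of h] \<kappa> h(1) unfolding \<kappa>_def by blast
    obtain \<eta>0 where "\<eta>0 < \<theta>" using infinite_imp_nonempty[OF inf] by blast
    \<comment> \<open>Bounding a constant function shows that \<open>b\<close> is not the last
      element below \<open>\<kappa>\<close>, so there is a next stage.\<close>
    then obtain b' where "b' < \<kappa>" "b < b'"
      using succ_card_bounded[OF inf, of "\<lambda>_. b"] \<kappa> b(1) unfolding \<kappa>_def by blast
    then have sb: "succ_ord b < \<kappa>" "b < succ_ord b" using succ_ord_greater[of b b'] order_le_less_trans by blast+
    have "G (E b) \<delta> \<subseteq> E (succ_ord b)"
    proof
      fix m assume "m \<in> G (E b) \<delta>"
      then obtain \<eta> where "\<eta> < \<theta>" "greatest_below (E b) (f \<delta> \<eta>) m" unfolding G_def cf by blast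
      then show "m \<in> E (succ_ord b)" using h(2)[of \<eta> b "succ_ord b" m] b(2) sb by (simp add: less_imp_le)
    qed
    also have "\<dots> \<subseteq> D (E b)" by (subst E) (use sb in blast)
    finally show False using D(2)[OF \<delta>\<rho> cf sup[OF b(1)]] by blast
  qed
  then obtain E where "guesses E" by blast
  then show ?thesis using G1 G2 unfolding guesses_def by (intro exI[of _ "G E"]) simp
qed

text \<open>The second clause says that the points of cofinality \<open>\<theta>\<close> outside any
  member of the ideal are stationary in \<open>\<rho>\<close>; this is the form in which guessing
  yields reflection.\<close>

lemma guessing_system:
  fixes \<rho> :: "'a::wellorder"
  assumes \<rho>: "regular_cardinal \<rho>" "aleph0 < \<rho>" and \<theta>: "regular_cardinal \<theta>"
    and less: "succ_card \<theta> < \<rho>" "\<theta> < succ_card \<theta>" and \<sigma>: "regular_cardinal \<sigma>" "\<rho> < \<sigma>"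
  shows "\<exists>P. set_system \<rho> (succ_card \<theta>) \<sigma> P \<and>
    (\<forall>E S. club E \<rho> \<longrightarrow> S \<in> ideal_cg \<rho> P \<longrightarrow> (cof_set \<rho> \<theta> - S) \<inter> E \<noteq> {})"
proof -
  obtain C :: "'a \<Rightarrow> 'a set" where C: "\<And>\<delta>. C \<delta> \<subseteq> {..<\<delta>}" "\<And>\<delta>. cf \<delta> = \<theta> \<Longrightarrow> |C \<delta>| \<le>o |{..<\<theta>}|"
    "\<And>D. club D \<rho> \<Longrightarrow> \<exists>\<delta><\<rho>. cf \<delta> = \<theta> \<and> C \<delta> \<subseteq> D \<and> is_sup (C \<delta>) \<delta>"
    using club_guessing[OF \<rho> \<theta> less] by blast
  have \<theta>\<rho>: "\<theta> < \<rho>" using less by simp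
  have "cardinal (succ_card \<theta>)"
    using cardinal_succ_card[OF _ \<theta>\<rho>] \<rho>(1) unfolding regular_cardinal_def by blast
  then have card: "|{..<\<theta>}| <o |{..<succ_card \<theta>}|" using less(2) unfolding cardinal_def by blast
  \<comment> \<open>Cutting \<open>C \<delta>\<close> at \<open>\<delta>\<close> and at its own
    points is just what closure under initial segments demands, and it costs at most
    \<open>\<rho>\<close> sets per level.\<close>
  define P where "P \<alpha> = (\<lambda>\<delta>. C \<delta> \<inter> {..<\<alpha>}) ` {\<delta>. \<delta> < \<rho> \<and> cf \<delta> = \<theta> \<and> (\<alpha> = \<delta> \<or> \<alpha> \<in> C \<delta>)}" for \<alpha>
  have "set_system \<rho> (succ_card \<theta>) \<sigma> P"
    unfolding set_system_def
  proof (intro allI impI conjI ballI)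
    fix \<alpha> assume "\<alpha> < \<rho>"
    have "|P \<alpha>| \<le>o |{\<delta>. \<delta> < \<rho> \<and> cf \<delta> = \<theta> \<and> (\<alpha> = \<delta> \<or> \<alpha> \<in> C \<delta>)}|" unfolding P_def by (rule card_of_image)
    also have "|{\<delta>. \<delta> < \<rho> \<and> cf \<delta> = \<theta> \<and> (\<alpha> = \<delta> \<or> \<alpha> \<in> C \<delta>)}| \<le>o |{..<\<rho>}|" by (rule card_of_mono1) blast
    also have "|{..<\<rho>}| <o |{..<\<sigma>}|" using regular_card_less[OF \<sigma>] .
    finally show "|P \<alpha>| <o |{..<\<sigma>}|" .
  next
    fix \<alpha> a assume a: "a \<in> P \<alpha>"
    then obtain \<delta> where \<delta>: "a = C \<delta> \<inter> {..<\<alpha>}" "cf \<delta> = \<theta>" "\<delta> < \<rho>" unfolding P_def by blast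
    then show "a \<subseteq> {..<\<alpha>}" by blast
    have "|a| \<le>o |C \<delta>|" unfolding \<delta>(1) by (rule card_of_mono1) blast
    then show "|a| <o |{..<succ_card \<theta>}|"
      using C(2)[OF \<delta>(2)] card by (meson ordLeq_transitive ordLeq_ordLess_trans)
    fix \<beta> assume \<beta>: "\<beta> \<in> a"
    then have "a \<inter> {..<\<beta>} = C \<delta> \<inter> {..<\<beta>}" "\<beta> \<in> C \<delta>" unfolding \<delta>(1) by auto
    then show "a \<inter> {..<\<beta>} \<in> P \<beta>" using \<delta> unfolding P_def by blast
  qed
  moreover have "(cof_set \<rho> \<theta> - S) \<inter> E \<noteq> {}" if E: "club E \<rho>" and S: "S \<in> ideal_cg \<rho> P" for E S
  proof -
    obtain E' where E': "club E' \<rho>" "\<not> (\<exists>\<zeta>\<in>S. \<exists>a\<in>P \<zeta>. a \<subseteq> E' \<and> is_sup a \<zeta>)"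
      using S unfolding ideal_cg_def by blast
    \<comment> \<open>Guessing the intersection serves twice: a guess inside \<open>E'\<close> keeps
      \<open>\<delta>\<close> out of \<open>S\<close>, and a guess inside \<open>E\<close> makes
      \<open>\<delta>\<close> a limit of points of \<open>E\<close>.\<close>
    obtain \<delta> where \<delta>: "\<delta> < \<rho>" "cf \<delta> = \<theta>" "C \<delta> \<subseteq> E \<inter> E'" "is_sup (C \<delta>) \<delta>"
      using C(3)[OF club_Int[OF \<rho> E E'(1)]] by blast
    have "C \<delta> \<inter> {..<\<delta>} = C \<delta>" using C(1) by blast
    then have "C \<delta> \<in> P \<delta>" using \<delta> unfolding P_def by force
    then have "\<delta> \<notin> S" using E'(2) \<delta> by blast
    moreover have "limit_ord \<delta>"
      using incr_cont_exists[OF \<theta> \<delta>(2)] incr_cont_limit regular_limit[OF \<theta>] by blast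
    then have "\<delta> \<in> E"
    proof (rule club_closed[OF E \<delta>(1)])
      fix \<beta> assume "\<beta> < \<delta>"
      then show "\<exists>\<gamma>\<in>E. \<beta> \<le> \<gamma> \<and> \<gamma> < \<delta>" using is_sup_lub[OF \<delta>(4)] C(1) \<delta>(3) by (meson IntD1 less_imp_le lessThan_iff subsetD)
    qed
    ultimately show ?thesis using \<delta> unfolding cof_set_def by blast
  qed
  ultimately show ?thesis by blast
qed

section \<open>Systems of coded sets\<close>

lemma card_of_Times_ordLess:
  assumes C: "infinite C" and A: "|A| <o |C|" and B: "|B| <o |C|"
  shows "|A \<times> B| <o |C|"
proof (cases "finite (A <+> B)")
  case True
  then have "finite (A \<times> B)" by (simp add: finite_Plus_iff)
  then show ?thesis using C by (rule card_of_finite_ordLess)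
next
  case False
  have "|A| \<le>o |A <+> B|" "|B| \<le>o |A <+> B|" by (rule card_of_Plus1, rule card_of_Plus2)
  then have "|A \<times> B| \<le>o |A <+> B|"
    using card_of_Sigma_ordLeq_infinite[OF False, of A "\<lambda>_. B"] by blast
  moreover have "|A <+> B| <o |C|" by (rule card_of_Plus_ordLess_infinite[OF C A B])
  ultimately show ?thesis using ordLeq_ordLess_trans by blast
qed

lemma regular_infinite: "regular_cardinal \<kappa> \<Longrightarrow> infinite {..<\<kappa>}"
  unfolding regular_cardinal_def by blast

lemma regular_UN_ordLess:
  fixes \<sigma> :: "'a::wellorder"
  assumes \<sigma>: "regular_cardinal \<sigma>" "\<rho> < \<sigma>" and A: "\<And>\<epsilon>. \<epsilon> < \<rho> \<Longrightarrow> |A \<epsilon>| <o |{..<\<sigma>}|"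
  shows "|\<Union>\<epsilon>\<in>{..<\<rho>}. A \<epsilon>| <o |{..<\<sigma>}|"
proof -
  have "\<exists>\<zeta><\<sigma>. |A \<epsilon>| \<le>o |{..<\<zeta>}|" if lt: "\<epsilon> < \<rho>" for \<epsilon>
  proof -
    obtain \<zeta> h where "\<zeta> < \<sigma>" "h ` {..<\<zeta>} = A \<epsilon>" using card_less_initial[OF A[OF lt]] by blast
    then show ?thesis using card_of_image by metis
  qed
  then obtain z where z: "\<And>\<epsilon>. \<epsilon> < \<rho> \<Longrightarrow> z \<epsilon> < \<sigma>" "\<And>\<epsilon>. \<epsilon> < \<rho> \<Longrightarrow> |A \<epsilon>| \<le>o |{..<z \<epsilon>}|" by metis
  obtain \<beta> where \<beta>: "\<beta> < \<sigma>" "\<forall>\<epsilon><\<rho>. z \<epsilon> < \<beta>" using regular_bounded_fun[OF \<sigma>, of z] z(1) by blast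
  have "|A \<epsilon>| \<le>o |{..<\<beta>}|" if "\<epsilon> < \<rho>" for \<epsilon>
  proof -
    have "{..<z \<epsilon>} \<subseteq> {..<\<beta>}" using \<beta>(2) that by auto
    then show ?thesis using z(2)[OF that] card_of_mono1 ordLeq_transitive by blast
  qed
  then have "|SIGMA \<epsilon>:{..<\<rho>}. A \<epsilon>| \<le>o |{..<\<rho>} \<times> {..<\<beta>}|" by (intro card_of_Sigma_mono1) blast
  moreover have "|{..<\<rho>} \<times> {..<\<beta>}| <o |{..<\<sigma>}|"
    by (intro card_of_Times_ordLess regular_infinite regular_card_less \<sigma> \<beta>)
  ultimately show ?thesis
    using card_of_UNION_Sigma ordLeq_ordLess_trans ordLeq_transitive by blast
qed

text \<open>Discreteness ensures that every proper initial segment of \<open>c\<close> is bounded below the next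
  point of \<open>c\<close>.\<close>

definition thin_cofinal :: "'a::wellorder \<Rightarrow> 'a set \<Rightarrow> 'a set \<Rightarrow> bool" where
  "thin_cofinal \<theta> a c \<longleftrightarrow> c \<subseteq> a \<and> has_order_type c \<theta> \<and> (\<forall>x\<in>a. \<exists>y\<in>c. x \<le> y)
     \<and> (\<forall>\<zeta>\<in>c. \<exists>\<xi><\<zeta>. \<forall>\<eta>\<in>c. \<eta> < \<zeta> \<longrightarrow> \<eta> \<le> \<xi>)"

text \<open>Points of \<open>a\<close> are chosen above the values of a cofinal
  \<open>\<theta>\<close>-sequence. Their records have order type at most \<open>\<theta>\<close>,
  and exactly \<open>\<theta>\<close> because they are cofinal in \<open>\<epsilon>\<close>.\<close>

lemma thin_cofinal_exists:
  fixes \<epsilon> :: "'a::wellorder"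
  assumes \<theta>: "regular_cardinal \<theta>" "cf \<epsilon> = \<theta>" and a: "unbounded_in a \<epsilon>"
  shows "\<exists>c. thin_cofinal \<theta> a c"
proof -
  note lim = regular_limit[OF \<theta>(1)]
  obtain f where "strict_mono_on {..<\<theta>} f" and f: "f ` {..<\<theta>} \<subseteq> {..<\<epsilon>}"
    "\<forall>\<beta><\<epsilon>. \<exists>\<eta><\<theta>. \<beta> \<le> f \<eta>"
    by (rule cf_sequence[of \<epsilon>, unfolded \<theta>(2)])
  have "\<exists>x\<in>a. f \<zeta> \<le> x" if "\<zeta> < \<theta>" for \<zeta>
  proof -
    have "f \<zeta> < \<epsilon>" using f(1) that by blast
    then show ?thesis using a unfolding unbounded_in_def by blast
  qed
  then obtain h where h: "\<And>\<zeta>. \<zeta> < \<theta> \<Longrightarrow> h \<zeta> \<in> a" "\<And>\<zeta>. \<zeta> < \<theta> \<Longrightarrow> f \<zeta> \<le> h \<zeta>" by metis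
  obtain c \<alpha> where c: "\<alpha> \<le> \<theta>" "c \<subseteq> h ` {..<\<theta>}" "has_order_type c \<alpha>" "\<forall>\<eta><\<theta>. \<exists>y\<in>c. h \<eta> \<le> y"
    using cofinal_subset_order_type[of \<theta> h] by blast
  have ca: "c \<subseteq> a" using c(2) h(1) by blast
  have cof: "\<exists>y\<in>c. \<beta> \<le> y" if \<beta>: "\<beta> < \<epsilon>" for \<beta>
  proof -
    obtain \<eta> where \<eta>: "\<eta> < \<theta>" "\<beta> \<le> f \<eta>" using f(2) \<beta> by blast
    obtain y where "y \<in> c" "h \<eta> \<le> y" using c(4) \<eta>(1) by blast
    then show ?thesis using h(2)[OF \<eta>(1)] \<eta>(2) order_trans by metis
  qed
  have "unbounded_in c \<epsilon>" unfolding unbounded_in_def using cof ca a unfolding unbounded_in_def by blast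
  then have "\<alpha> = \<theta>" using cf_le c(1,3) \<theta>(2) by (metis antisym)
  then obtain g where g: "strict_mono_on {..<\<theta>} g" "g ` {..<\<theta>} = c"
    using c(3) unfolding has_order_type_def by blast
  have g_less: "g \<xi> < g \<zeta>" if "\<xi> < \<zeta>" "\<zeta> < \<theta>" for \<xi> \<zeta>
    using g(1) that by (meson lessThan_iff less_trans strict_mono_onD)
  have sl: "succ_ord \<zeta> < \<theta>" "\<zeta> < succ_ord \<zeta>" if "\<zeta> < \<theta>" for \<zeta>
    using limit_succ[OF lim that] succ_ord_greater(1)[OF that] by auto
  \<comment> \<open>Only successor positions are kept: \<open>g z\<close> lies strictly below
    \<open>g (succ_ord z)\<close> and bounds every earlier member of \<open>c'\<close>, which
    provides the gap.\<close>
  define c' where "c' = (g \<circ> succ_ord) ` {..<\<theta>}"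
  have "has_order_type c' \<theta>"
    unfolding c'_def
  proof (rule order_type_image, rule strict_mono_onI)
    fix r s assume rs: "r \<in> {..<\<theta>}" "s \<in> {..<\<theta>}" "r < s"
    then have "succ_ord r < succ_ord s" using succ_ord_greater(2)[OF rs(3)] sl(2)[of s] by auto
    then show "(g \<circ> succ_ord) r < (g \<circ> succ_ord) s" using g_less sl(1)[of s] rs(2) by simp
  qed
  moreover have "c' \<subseteq> a" using g(2) ca sl(1) unfolding c'_def by auto
  moreover have "\<exists>y\<in>c'. x \<le> y" if "x \<in> a" for x
  proof -
    have "x < \<epsilon>" using a that unfolding unbounded_in_def by blast
    then obtain \<zeta> where \<zeta>: "\<zeta> < \<theta>" "x \<le> g \<zeta>" using cof g(2) by blast
    have "g \<zeta> < g (succ_ord \<zeta>)" using g_less sl \<zeta>(1) by blast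
    then have "x \<le> (g \<circ> succ_ord) \<zeta>" using \<zeta>(2) by simp
    then show ?thesis using \<zeta>(1) unfolding c'_def by blast
  qed
  moreover have "\<exists>\<xi><\<zeta>. \<forall>\<eta>\<in>c'. \<eta> < \<zeta> \<longrightarrow> \<eta> \<le> \<xi>" if "\<zeta> \<in> c'" for \<zeta>
  proof -
    obtain z where z: "z < \<theta>" "\<zeta> = g (succ_ord z)" using \<open>\<zeta> \<in> c'\<close> unfolding c'_def by auto
    have "\<eta> \<le> g z" if \<eta>: "\<eta> \<in> c'" "\<eta> < \<zeta>" for \<eta>
    proof -
      obtain w where w: "w < \<theta>" "\<eta> = g (succ_ord w)" using \<eta>(1) unfolding c'_def by auto
      have "\<not> z < succ_ord w"
      proof
        assume "z < succ_ord w"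
        then have "succ_ord z \<le> succ_ord w" by (rule succ_ord_greater(2))
        then have "g (succ_ord z) \<le> g (succ_ord w)"
          using g_less[of "succ_ord z" "succ_ord w"] sl(1)[OF w(1)] by (auto simp: order_le_less)
        then show False using \<eta>(2) w(2) z(2) by simp
      qed
      then have "succ_ord w \<le> z" by simp
      then show ?thesis using g_less[of "succ_ord w" z] z(1) w(2) by (auto simp: order_le_less)
    qed
    moreover have "g z < \<zeta>" unfolding z(2) using g_less sl z(1) by blast
    ultimately show ?thesis by blast
  qed
  ultimately show ?thesis unfolding thin_cofinal_def by blast
qed

definition coded_sets :: "('a::wellorder \<Rightarrow> 'a \<Rightarrow> 'a) \<Rightarrow> 'a set set \<Rightarrow> 'a \<Rightarrow> 'a set set" where
  "coded_sets e B \<beta> = {e \<gamma> ` b | \<gamma> b. \<gamma> < \<beta> \<and> b \<in> B}"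

definition coded_cofinal :: "('a::wellorder \<Rightarrow> 'a \<Rightarrow> 'a) \<Rightarrow> 'a set set \<Rightarrow> 'a \<Rightarrow> 'a \<Rightarrow> 'a set \<Rightarrow> bool" where
  "coded_cofinal e B \<theta> \<beta> u \<longleftrightarrow> unbounded_in u \<beta> \<and> has_order_type u \<theta>
     \<and> (\<forall>\<alpha>\<in>u. u \<inter> {..<\<alpha>} \<in> coded_sets e B \<alpha>)"

text \<open>Each level has at most one coded set per pair of an ordinal below it and a member of
  \<open>B\<close>. A cofinal \<open>u\<close> whose proper initial segments are coded may lack a
  code of its own, so one is added by choice; its segments are coded, so the closure of the system
  is kept, and one per level suffices for goodness.\<close>

lemma coded_system:
  fixes lam :: "'a::wellorder"
  assumes lam: "regular_cardinal lam" and \<theta>: "\<theta> < lam"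
    and B: "|B| <o |{..<lam}|" "\<And>b. b \<in> B \<Longrightarrow> |b| <o |{..<lam}|"
  shows "\<exists>P. set_system lam lam lam P \<and>
    (\<forall>\<delta><lam. cf \<delta> = \<theta> \<longrightarrow> (\<exists>u. coded_cofinal e B \<theta> \<delta> u) \<longrightarrow> \<delta> \<in> good lam \<theta> P)"
proof -
  define T where "T = coded_sets e B"
  define P where "P \<beta> = {u \<in> T \<beta>. u \<subseteq> {..<\<beta>} \<and> (\<forall>\<alpha>\<in>u. u \<inter> {..<\<alpha>} \<in> T \<alpha>)} \<union>
    (if \<exists>u. coded_cofinal e B \<theta> \<beta> u then {SOME u. coded_cofinal e B \<theta> \<beta> u} else {})" for \<beta>
  have Pcases: "a \<in> T \<alpha> \<and> a \<subseteq> {..<\<alpha>} \<and> (\<forall>\<beta>\<in>a. a \<inter> {..<\<beta>} \<in> T \<beta>) \<or> coded_cofinal e B \<theta> \<alpha> a"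
    if "a \<in> P \<alpha>" for a \<alpha>
    using that unfolding P_def by (auto split: if_splits intro: someI)
  have seg: "a \<inter> {..<\<beta>} \<in> P \<beta>" if a: "\<forall>\<beta>\<in>a. a \<inter> {..<\<beta>} \<in> T \<beta>" and \<beta>: "\<beta> \<in> a" for a \<beta>
  proof -
    have "a \<inter> {..<\<beta>} \<inter> {..<\<alpha>} = a \<inter> {..<\<alpha>}" if "\<alpha> < \<beta>" for \<alpha> using that by auto
    then show ?thesis using a \<beta> unfolding P_def by auto
  qed
  have inf: "infinite {..<lam}" using lam by (rule regular_infinite)
  have "set_system lam lam lam P"
    unfolding set_system_def
  proof (intro allI impI conjI ballI)
    fix \<alpha> assume \<alpha>: "\<alpha> < lam"
    have "T \<alpha> \<subseteq> (\<lambda>(\<gamma>, b). e \<gamma> ` b) ` ({..<\<alpha>} \<times> B)" unfolding T_def coded_sets_def by auto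
    then have "|T \<alpha>| \<le>o |{..<\<alpha>} \<times> B|" by (rule ordLeq_transitive[OF card_of_mono1 card_of_image])
    moreover have "|{..<\<alpha>} \<times> B| <o |{..<lam}|"
      by (rule card_of_Times_ordLess[OF inf regular_card_less[OF lam \<alpha>] B(1)])
    ultimately have 1: "|T \<alpha>| <o |{..<lam}|" using ordLeq_ordLess_trans by blast
    have "|T \<alpha> \<union> {SOME u. coded_cofinal e B \<theta> \<alpha> u}| <o |{..<lam}|"
      by (rule card_of_Un_ordLess_infinite[OF inf 1 card_of_finite_ordLess[OF _ inf]]) simp
    moreover have "|P \<alpha>| \<le>o |T \<alpha> \<union> {SOME u. coded_cofinal e B \<theta> \<alpha> u}|"
      by (rule card_of_mono1) (auto simp: P_def)
    ultimately show "|P \<alpha>| <o |{..<lam}|" using ordLeq_ordLess_trans by blast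
  next
    fix \<alpha> a assume "\<alpha> < lam" "a \<in> P \<alpha>"
    show "a \<subseteq> {..<\<alpha>}"
      using Pcases[OF \<open>a \<in> P \<alpha>\<close>] unfolding coded_cofinal_def unbounded_in_def by blast
    from Pcases[OF \<open>a \<in> P \<alpha>\<close>] show "|a| <o |{..<lam}|"
    proof
      assume "a \<in> T \<alpha> \<and> a \<subseteq> {..<\<alpha>} \<and> (\<forall>\<beta>\<in>a. a \<inter> {..<\<beta>} \<in> T \<beta>)"
      then have "a \<in> T \<alpha>" by (rule conjunct1)
      then obtain \<gamma> b where ab: "a = e \<gamma> ` b" "b \<in> B" unfolding T_def coded_sets_def by blast
      have "|a| \<le>o |b|" unfolding ab(1) by (rule card_of_image)
      then show ?thesis using B(2)[OF ab(2)] by (rule ordLeq_ordLess_trans)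
    next
      assume "coded_cofinal e B \<theta> \<alpha> a"
      then have "has_order_type a \<theta>" unfolding coded_cofinal_def by blast
      then show ?thesis
        using order_type_card regular_card_less[OF lam \<theta>] ordIso_ordLess_trans by blast
    qed
    fix \<beta> assume "\<beta> \<in> a"
    moreover have "\<forall>\<beta>\<in>a. a \<inter> {..<\<beta>} \<in> T \<beta>"
      using Pcases[OF \<open>a \<in> P \<alpha>\<close>] unfolding coded_cofinal_def T_def by blast
    ultimately show "a \<inter> {..<\<beta>} \<in> P \<beta>" using seg by blast
  qed
  moreover have "\<delta> \<in> good lam \<theta> P" if \<delta>: "\<delta> < lam" "cf \<delta> = \<theta>" "coded_cofinal e B \<theta> \<delta> u" for \<delta> u
  proof -
    define w where "w = (SOME u. coded_cofinal e B \<theta> \<delta> u)"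
    have w: "coded_cofinal e B \<theta> \<delta> w" unfolding w_def using \<delta>(3) by (rule someI)
    have "w \<in> P \<delta>" using \<delta>(3) unfolding P_def w_def by auto
    moreover have "\<forall>\<alpha>\<in>w. w \<inter> {..<\<alpha>} \<in> P \<alpha>" using w seg unfolding coded_cofinal_def T_def by blast
    ultimately show ?thesis using w \<delta> unfolding good_def coded_cofinal_def by blast
  qed
  ultimately show ?thesis by blast
qed

lemma incr_cont_comp:
  fixes d i :: "'a::wellorder \<Rightarrow> 'a"
  assumes d: "incr_cont \<sigma> d \<delta>" and j: "j < \<sigma>" and i: "incr_cont \<rho> i j" and lim: "limit_ord \<rho>"
  shows "incr_cont \<rho> (d \<circ> i) (d j)"
proof -
  have sup: "is_sup (d ` X) (d s)" if X: "is_sup X s" "X \<subseteq> {..<s}" and s: "s < \<sigma>" "limit_ord s" for X s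
    unfolding is_sup_def
  proof (intro conjI ballI allI impI)
    fix \<alpha> assume "\<alpha> \<in> d ` X"
    then show "\<alpha> \<le> d s" using incr_cont_less[OF d] X(2) s(1) by (auto intro: less_imp_le)
  next
    fix \<beta> assume \<beta>: "\<forall>\<alpha>\<in>d ` X. \<alpha> \<le> \<beta>"
    show "d s \<le> \<beta>"
    proof (rule ccontr)
      assume "\<not> d s \<le> \<beta>"
      then have "\<beta> < d s" by simp
      then obtain k where k: "k < s" "\<beta> < d k" using incr_cont_cofinal_limit[OF d s] by blast
      obtain x where x: "x \<in> X" "k < x" using is_sup_lub[OF X(1) k(1)] by blast
      have "x < \<sigma>" using x(1) X(2) s(1) less_trans by blast
      then have "d k < d x" using incr_cont_less[OF d x(2)] by blast
      then show False using \<beta> x(1) k(2) by force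
    qed
  qed
  have ij: "i \<zeta> < j" if "\<zeta> < \<rho>" for \<zeta> by (rule incr_cont_below[OF i lim that])
  show ?thesis
    unfolding incr_cont_def
  proof (intro conjI allI impI)
    show "strict_mono_on {..<\<rho>} (d \<circ> i)"
    proof (rule strict_mono_onI)
      fix r s assume rs: "r \<in> {..<\<rho>}" "s \<in> {..<\<rho>}" "r < s"
      then have "i r < i s" "i s < \<sigma>" using incr_cont_less[OF i] ij j less_trans by blast+
      then show "(d \<circ> i) r < (d \<circ> i) s" using incr_cont_less[OF d] by simp
    qed
    have "is_sup (i ` {..<\<rho>}) j" using i unfolding incr_cont_def by blast
    then show "is_sup ((d \<circ> i) ` {..<\<rho>}) (d j)"
      unfolding image_comp[symmetric] by (rule sup[OF _ _ j incr_cont_limit[OF i lim]]) (use ij in blast)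
    fix \<zeta> assume \<zeta>: "\<zeta> < \<rho>" "limit_ord \<zeta>"
    then have "is_sup (i ` {..<\<zeta>}) (i \<zeta>)" using i unfolding incr_cont_def by blast
    moreover have "i ` {..<\<zeta>} \<subseteq> {..<i \<zeta>}" using incr_cont_less[OF i] \<zeta>(1) by blast
    ultimately show "is_sup ((d \<circ> i) ` {..<\<zeta>}) ((d \<circ> i) \<zeta>)"
      unfolding image_comp[symmetric] comp_apply
      by (rule sup[OF _ _ less_trans[OF ij[OF \<zeta>(1)] j] incr_cont_limit_at[OF i \<zeta>]])
  qed
qed

text \<open>One choice is fixed for each \<open>a\<close>, so the resulting segments do not vary
  with \<open>\<delta>\<close>, \<open>d\<close> or \<open>i\<close>.\<close>

definition thin_set :: "'a::wellorder \<Rightarrow> 'a set \<Rightarrow> 'a set" where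
  "thin_set \<theta> a = (SOME c. thin_cofinal \<theta> a c)"

definition thin_segments :: "'a::wellorder \<Rightarrow> 'a \<Rightarrow> ('a \<Rightarrow> 'a set set) \<Rightarrow> 'a set set" where
  "thin_segments \<rho> \<theta> Pst =
     (\<lambda>(a, \<zeta>). thin_set \<theta> a \<inter> {..<\<zeta>}) ` ((\<Union>\<epsilon>\<in>{..<\<rho>}. Pst \<epsilon>) \<times> {..<\<rho>})"

lemma card_thin_segments:
  fixes \<sigma> :: "'a::wellorder"
  assumes "regular_cardinal \<sigma>" "\<rho> < \<sigma>" "set_system \<rho> \<tau> \<sigma> Pst"
  shows "|thin_segments \<rho> \<theta> Pst| <o |{..<\<sigma>}|"
proof -
  have "|\<Union>\<epsilon>\<in>{..<\<rho>}. Pst \<epsilon>| <o |{..<\<sigma>}|"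
    using assms(3) unfolding set_system_def by (intro regular_UN_ordLess[OF assms(1,2)]) blast
  then have "|(\<Union>\<epsilon>\<in>{..<\<rho>}. Pst \<epsilon>) \<times> {..<\<rho>}| <o |{..<\<sigma>}|"
    by (rule card_of_Times_ordLess[OF regular_infinite[OF assms(1)] _ regular_card_less[OF assms(1,2)]])
  then show ?thesis unfolding thin_segments_def using card_of_image ordLeq_ordLess_trans by blast
qed

lemma card_thin_segment:
  fixes \<sigma> :: "'a::wellorder"
  assumes "regular_cardinal \<sigma>" "\<rho> < \<sigma>" "b \<in> thin_segments \<rho> \<theta> Pst"
  shows "|b| <o |{..<\<sigma>}|"
proof -
  have "b \<subseteq> {..<\<rho>}" using assms(3) unfolding thin_segments_def by auto
  then show ?thesis using regular_card_less[OF assms(1,2)] card_of_mono1 ordLeq_ordLess_trans by blast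
qed

text \<open>In terms of elementary submodels: a model that contains \<open>i\<close> up to \<open>\<xi>\<close> and whose trace on
  \<open>\<sigma>\<close> is \<open>k\<close> satisfies this condition, by elementarity.\<close>

definition code_step ::
  "('a::wellorder \<Rightarrow> 'a \<Rightarrow> 'a) \<Rightarrow> 'a set set \<Rightarrow> 'a \<Rightarrow> ('a \<Rightarrow> 'a) \<Rightarrow> 'a \<Rightarrow> ('a \<Rightarrow> 'a) \<Rightarrow> 'a \<Rightarrow> bool" where
  "code_step e B \<delta> d \<xi> i k \<longleftrightarrow>
     (\<forall>b\<in>B. b \<subseteq> {..\<xi>} \<longrightarrow> (\<exists>\<gamma><\<delta>. e \<gamma> ` b = d ` i ` b) \<longrightarrow> (\<exists>\<gamma><d k. e \<gamma> ` b = d ` i ` b))"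

lemma code_step_local:
  assumes "\<forall>\<eta>\<le>\<xi>. i \<eta> = i' \<eta>"
  shows "code_step e B \<delta> d \<xi> i k = code_step e B \<delta> d \<xi> i' k"
proof -
  have "i ` b = i' ` b" if "b \<subseteq> {..\<xi>}" for b using that assms by (intro image_cong) auto
  then show ?thesis unfolding code_step_def by simp
qed

lemma code_step_up:
  assumes d: "incr_cont \<sigma> d \<delta>" and "code_step e B \<delta> d \<xi> i k" "k \<le> k'" "k' < \<sigma>"
  shows "code_step e B \<delta> d \<xi> i k'"
proof -
  have "d k \<le> d k'" using incr_cont_le_iff[OF d, of k k'] assms(3,4) by auto
  then show ?thesis using assms(2) unfolding code_step_def by (meson order_less_le_trans)
qed

text \<open>Since \<open>d\<close> is cofinal in \<open>\<delta>\<close>, a code below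
  \<open>\<delta>\<close> lies below some \<open>d k\<close>; fewer than \<open>\<sigma>\<close>
  sets \<open>b\<close> are concerned, so one \<open>k\<close> serves them all.\<close>

lemma code_step_exists:
  fixes \<sigma> :: "'a::wellorder"
  assumes \<sigma>: "regular_cardinal \<sigma>" and d: "incr_cont \<sigma> d \<delta>" and B: "|B| <o |{..<\<sigma>}|"
  shows "\<exists>k<\<sigma>. code_step e B \<delta> d \<xi> i k"
proof -
  define R where "R b \<gamma> \<longleftrightarrow> e \<gamma> ` b = d ` i ` b" for b \<gamma>
  have "\<exists>k<\<sigma>. \<exists>\<gamma><d k. R b \<gamma>" if "\<exists>\<gamma><\<delta>. R b \<gamma>" for b
    using that incr_cont_cofinal[OF d] by blast
  then obtain g where g: "\<And>b. \<exists>\<gamma><\<delta>. R b \<gamma> \<Longrightarrow> g b < \<sigma>"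
    "\<And>b. \<exists>\<gamma><\<delta>. R b \<gamma> \<Longrightarrow> \<exists>\<gamma><d (g b). R b \<gamma>" by metis
  let ?X = "g ` {b \<in> B. \<exists>\<gamma><\<delta>. R b \<gamma>}"
  have "|?X| \<le>o |{b \<in> B. \<exists>\<gamma><\<delta>. R b \<gamma>}|" by (rule card_of_image)
  also have "|{b \<in> B. \<exists>\<gamma><\<delta>. R b \<gamma>}| \<le>o |B|" by (rule card_of_mono1) blast
  finally have "|?X| <o |{..<\<sigma>}|" using B by (rule ordLeq_ordLess_trans)
  then obtain k where k: "k < \<sigma>" "\<forall>x\<in>?X. x < k" using regular_bounded[OF \<sigma>, of ?X] g(1) by blast
  have "\<exists>\<gamma><d k. R b \<gamma>" if b: "b \<in> B" "\<exists>\<gamma><\<delta>. R b \<gamma>" for b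
  proof -
    have "g b < k" using k(2) b by blast
    then have "d (g b) < d k" using incr_cont_less[OF d _ k(1)] by blast
    then show ?thesis using g(2)[OF b(2)] less_trans by blast
  qed
  then have "code_step e B \<delta> d \<xi> i k" unfolding code_step_def R_def[symmetric] by simp
  then show ?thesis using k(1) by blast
qed

lemma coded_cofinal_off_ideal_cg:
  fixes lam \<sigma> \<rho> \<theta> :: "'a::wellorder"
  assumes \<rho>: "regular_cardinal \<rho>" "aleph0 < \<rho>" and \<theta>: "regular_cardinal \<theta>" and \<sigma>: "regular_cardinal \<sigma>"
    and Pst: "set_system \<rho> \<tau> \<sigma> Pst"
    and e: "\<And>\<gamma>. cf \<gamma> = \<rho> \<Longrightarrow> incr_cont \<rho> (e \<gamma>) \<gamma>"
    and d: "incr_cont \<sigma> d \<delta>" and i: "incr_cont \<rho> i j" and j: "j < \<sigma>"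
    and step: "\<And>\<xi> \<zeta>. \<xi> < \<zeta> \<Longrightarrow> \<zeta> < \<rho> \<Longrightarrow> code_step e (thin_segments \<rho> \<theta> Pst) \<delta> d \<xi> i (i \<zeta>)"
  shows "\<exists>S\<in>ideal_cg \<rho> Pst. \<forall>\<epsilon>\<in>cof_set \<rho> \<theta> - S.
    cf (d (i \<epsilon>)) = \<theta> \<and> (\<exists>u. coded_cofinal e (thin_segments \<rho> \<theta> Pst) \<theta> (d (i \<epsilon>)) u)"
proof -
  note lim = regular_limit[OF \<rho>(1)]
  define p where "p = d \<circ> i"
  have p: "incr_cont \<rho> p (d j)" unfolding p_def by (rule incr_cont_comp[OF d j i lim])
  have dj: "d j < \<delta>" by (rule incr_cont_below[OF d regular_limit[OF \<sigma>] j])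
  have "incr_cont \<rho> (e (d j)) (d j)" by (rule e[OF cf_incr_cont[OF p \<rho>(1)]])
  then obtain E where E: "club E \<rho>" "\<forall>\<epsilon>\<in>E. e (d j) \<epsilon> = p \<epsilon>" using incr_cont_agree[OF \<rho> _ p] by blast
  \<comment> \<open>The agreement club \<open>E\<close> is itself the witness that \<open>S\<close>
    belongs to the ideal; outside \<open>S\<close> some guess is contained in
    \<open>E\<close>.\<close>
  define S where "S = {\<zeta>. \<zeta> < \<rho> \<and> \<not> (\<exists>a\<in>Pst \<zeta>. a \<subseteq> E \<and> is_sup a \<zeta>)}"
  have "S \<in> ideal_cg \<rho> Pst" unfolding ideal_cg_def S_def using E(1) by blast
  moreover have "cf (d (i \<epsilon>)) = \<theta> \<and> (\<exists>u. coded_cofinal e (thin_segments \<rho> \<theta> Pst) \<theta> (d (i \<epsilon>)) u)"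
    if mem: "\<epsilon> \<in> cof_set \<rho> \<theta> - S" for \<epsilon>
  proof -
    have \<epsilon>: "\<epsilon> < \<rho>" "cf \<epsilon> = \<theta>" using mem unfolding cof_set_def by auto
    obtain a where a: "a \<in> Pst \<epsilon>" "a \<subseteq> E" "is_sup a \<epsilon>" using mem \<epsilon> unfolding S_def by blast
    obtain s where s: "incr_cont \<theta> s \<epsilon>" using incr_cont_exists[OF \<theta> \<epsilon>(2)] by blast
    have lime: "limit_ord \<epsilon>" by (rule incr_cont_limit[OF s regular_limit[OF \<theta>]])
    \<comment> \<open>By continuity of \<open>p\<close> at \<open>\<epsilon>\<close>, a sequence of
      length \<open>\<theta>\<close> converging to \<open>\<epsilon>\<close> is carried to one
      converging to \<open>p \<epsilon>\<close>.\<close>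
    have "cf (p \<epsilon>) = \<theta>"
      by (rule cf_incr_cont[OF incr_cont_comp[OF p \<epsilon>(1) s regular_limit[OF \<theta>]] \<theta>])
    moreover
    have ae: "a \<subseteq> {..<\<epsilon>}" using Pst a(1) \<epsilon>(1) unfolding set_system_def by blast
    have ua: "unbounded_in a \<epsilon>" using is_sup_iff_unbounded[OF lime ae] a(3) by blast
    define c where "c = thin_set \<theta> a"
    have "thin_cofinal \<theta> a c"
      unfolding c_def thin_set_def using thin_cofinal_exists[OF \<theta> \<epsilon>(2) ua] by (rule someI_ex)
    then have c: "c \<subseteq> a" "has_order_type c \<theta>" "\<forall>x\<in>a. \<exists>y\<in>c. x \<le> y"
      "\<forall>\<zeta>\<in>c. \<exists>\<xi><\<zeta>. \<forall>\<eta>\<in>c. \<eta> < \<zeta> \<longrightarrow> \<eta> \<le> \<xi>" unfolding thin_cofinal_def by blast+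
    have ce: "\<zeta> < \<epsilon>" if "\<zeta> \<in> c" for \<zeta> using that c(1) ae by blast
    have c\<rho>: "\<zeta> < \<rho>" if "\<zeta> \<in> c" for \<zeta> using ce[OF that] \<epsilon>(1) by simp
    have "coded_cofinal e (thin_segments \<rho> \<theta> Pst) \<theta> (p \<epsilon>) (p ` c)"
      unfolding coded_cofinal_def
    proof (intro conjI ballI)
      show "unbounded_in (p ` c) (p \<epsilon>)"
        unfolding unbounded_in_def
      proof (intro conjI allI impI)
        show "p ` c \<subseteq> {..<p \<epsilon>}" using incr_cont_less[OF p _ \<epsilon>(1)] ce by blast
        fix \<beta> assume "\<beta> < p \<epsilon>"
        then obtain \<xi> where \<xi>: "\<xi> < \<epsilon>" "\<beta> < p \<xi>" using incr_cont_cofinal_limit[OF p \<epsilon>(1) lime] by blast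
        obtain x where x: "x \<in> a" "\<xi> \<le> x" using ua \<xi>(1) unfolding unbounded_in_def by blast
        obtain y where y: "y \<in> c" "x \<le> y" using c(3) x(1) by blast
        have "p \<xi> \<le> p y" using incr_cont_le_iff[OF p, of \<xi> y] c\<rho>[OF y(1)] x(2) y(2) \<xi>(1) \<epsilon>(1) by auto
        then have "\<beta> \<le> p y" using \<xi>(2) by simp
        then show "\<exists>\<gamma>\<in>p ` c. \<beta> \<le> \<gamma>" using y(1) by blast
      qed
      obtain g where g: "strict_mono_on {..<\<theta>} g" "g ` {..<\<theta>} = c"
        using c(2) unfolding has_order_type_def by blast
      have "strict_mono_on {..<\<theta>} (p \<circ> g)"
      proof (rule strict_mono_onI)
        fix r s assume rs: "r \<in> {..<\<theta>}" "s \<in> {..<\<theta>}" "r < s"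
        then have "g r < g s" "g s \<in> c" using g by (auto simp: strict_mono_on_def)
        then show "(p \<circ> g) r < (p \<circ> g) s" using incr_cont_less[OF p] c\<rho> by simp
      qed
      then have "has_order_type ((p \<circ> g) ` {..<\<theta>}) \<theta>" by (rule order_type_image)
      then show "has_order_type (p ` c) \<theta>" unfolding image_comp[symmetric] g(2) .
    next
      fix \<alpha> assume "\<alpha> \<in> p ` c"
      then obtain \<zeta> where \<zeta>: "\<zeta> \<in> c" "\<alpha> = p \<zeta>" by blast
      define b where "b = c \<inter> {..<\<zeta>}"
      have bB: "b \<in> thin_segments \<rho> \<theta> Pst"
        unfolding b_def c_def thin_segments_def using a(1) \<epsilon>(1) c\<rho>[OF \<zeta>(1)] by force
      \<comment> \<open>Thinness enters here: \<open>b\<close> is bounded by a stage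
        \<open>\<xi>\<close> strictly before \<open>\<zeta>\<close>, so the demand made at stage
        \<open>\<xi>\<close> is already met by \<open>i \<zeta>\<close>.\<close>
      obtain \<xi> where \<xi>: "\<xi> < \<zeta>" "\<forall>\<eta>\<in>c. \<eta> < \<zeta> \<longrightarrow> \<eta> \<le> \<xi>" using c(4) \<zeta>(1) by blast
      have b\<xi>: "b \<subseteq> {..\<xi>}" unfolding b_def using \<xi>(2) by blast
      have "e (d j) ` b = p ` b"
        using E(2) a(2) c(1) unfolding b_def by (intro image_cong) blast+
      \<comment> \<open>The ordinal \<open>d j\<close> is a code below \<open>\<delta>\<close> but
        too large for the system; \<open>step\<close> replaces it by some \<open>\<gamma>\<close>
        below \<open>d (i \<zeta>)\<close>, which is \<open>\<alpha>\<close>.\<close>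
      then have "d j < \<delta> \<and> e (d j) ` b = d ` i ` b" using dj by (simp add: p_def image_comp)
      then have ex: "\<exists>\<gamma><\<delta>. e \<gamma> ` b = d ` i ` b" ..
      obtain \<gamma> where \<gamma>: "\<gamma> < d (i \<zeta>)" "e \<gamma> ` b = d ` i ` b"
        using step[OF \<xi>(1) c\<rho>[OF \<zeta>(1)], unfolded code_step_def, rule_format, OF bB b\<xi> ex] by (elim exE conjE)
      have "p ` b = e \<gamma> ` b" unfolding \<gamma>(2) p_def image_comp[symmetric] ..
      moreover have "\<gamma> < \<alpha>" using \<gamma>(1) unfolding \<zeta>(2) p_def by simp
      ultimately have "p ` b \<in> coded_sets e (thin_segments \<rho> \<theta> Pst) \<alpha>"
        unfolding coded_sets_def using bB by blast
      moreover have "p ` c \<inter> {..<\<alpha>} = p ` b"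
        unfolding b_def \<zeta>(2) using incr_cont_less_iff[OF p c\<rho> c\<rho>[OF \<zeta>(1)]] by auto
      ultimately show "p ` c \<inter> {..<\<alpha>} \<in> coded_sets e (thin_segments \<rho> \<theta> Pst) \<alpha>" by simp
    qed
    ultimately show ?thesis unfolding p_def by auto
  qed
  ultimately show ?thesis by blast
qed

section \<open>Elementary submodels\<close>

text \<open>The ideal requires \<open>\<chi>\<close> to be a relation on \<open>'c\<close>. The
  successor of \<open>|A|\<close> lives on another type, but is at most \<open>|Pow A|\<close> and
  can therefore be copied into \<open>'c\<close>.\<close>

lemma regular_successor_in_type:
  fixes A :: "'a set"
  assumes inf: "infinite A" and big: "|Pow A| \<le>o |UNIV :: 'c set|"
  shows "\<exists>\<chi> :: 'c rel. Card_order \<chi> \<and> regularCard \<chi> \<and> (\<forall>B :: 'b set. |B| \<le>o |A| \<longrightarrow> |B| <o \<chi>)"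
proof -
  let ?r = "cardSuc |A|"
  have co: "Card_order ?r" by (rule cardSuc_Card_order[OF card_of_Card_order])
  have infr: "infinite (Field ?r)"
    using cardSuc_finite[OF card_of_Card_order, of A] inf by (simp add: Field_card_of)
  have "?r \<le>o |Pow A|" by (rule cardSuc_least[OF card_of_Card_order card_of_Card_order card_of_Pow])
  then have "|Field ?r| \<le>o |UNIV :: 'c set|"
    using big card_of_Field_ordIso[OF co] ordIso_ordLeq_trans ordLeq_transitive by blast
  then obtain f :: "'a set \<Rightarrow> 'c" where f: "inj_on f (Field ?r)"
    unfolding card_of_ordLeq[symmetric] by blast
  define \<chi> where "\<chi> = |f ` Field ?r|"
  have "|Field ?r| =o \<chi>"
    unfolding \<chi>_def using f card_of_ordIso inj_on_imp_bij_betw by blast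
  then have iso: "?r =o \<chi>" using card_of_Field_ordIso[OF co] ordIso_symmetric ordIso_transitive by blast
  \<comment> \<open>Regularity is carried to the copy through \<open>stable\<close>, which is
    invariant under isomorphism of cardinals.\<close>
  have "stable ?r"
    using inf by (intro regularCard_stable[OF co infr] infinite_cardSuc_regularCard card_of_Card_order)
      (simp add: Field_card_of)
  then have "stable \<chi>" using stable_ordIso1 ordIso_symmetric[OF iso] by blast
  moreover have "infinite (Field \<chi>)"
    unfolding \<chi>_def Field_card_of using infr f by (simp add: finite_image_iff)
  moreover have c\<chi>: "Card_order \<chi>" unfolding \<chi>_def by (rule card_of_Card_order)
  ultimately have "regularCard \<chi>" by (intro stable_regularCard)
  moreover have "|B| <o \<chi>" if "|B| \<le>o |A|" for B :: "'b set"
    using ordLeq_ordLess_trans[OF that cardSuc_greater[OF card_of_Card_order]] iso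
    by (rule ordLess_ordIso_trans)
  ultimately show ?thesis using c\<chi> by blast
qed

section \<open>Hereditarily small sets and bounded formulas\<close>

lemma trans_closure_subset:
  assumes "elts x \<subseteq> Z" "\<And>z. z \<in> Z \<Longrightarrow> elts z \<subseteq> Z"
  shows "trans_closure x \<subseteq> Z"
proof
  fix y assume "y \<in> trans_closure x"
  then have "(y, x) \<in> {(u, v). u \<in> elts v}\<^sup>+" unfolding trans_closure_def by blast
  then show "y \<in> Z"
  proof (induction rule: converse_trancl_induct)
    case (base y)
    then show ?case using assms(1) by blast
  next
    case (step y z)
    then show ?case using assms(2) by blast
  qed
qed

lemma H_transitive:
  assumes x: "x \<in> H \<chi>" and y: "y \<in> elts x"
  shows "y \<in> H \<chi>"
proof -
  have "trans_closure y \<subseteq> trans_closure x"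
  proof
    fix z assume "z \<in> trans_closure y"
    then have "(z, y) \<in> {(u, v). u \<in> elts v}\<^sup>+" unfolding trans_closure_def by blast
    then have "(z, x) \<in> {(u, v). u \<in> elts v}\<^sup>+" using y by (blast intro: trancl_into_trancl)
    then show "z \<in> trans_closure x" unfolding trans_closure_def by blast
  qed
  then show ?thesis using x unfolding H_def by (blast intro: ordLeq_ordLess_trans card_of_mono1)
qed

definition Iff_fm :: "fm \<Rightarrow> fm \<Rightarrow> fm" where
  "Iff_fm \<phi> \<psi> = Conj (Neg (Conj \<phi> (Neg \<psi>))) (Neg (Conj \<psi> (Neg \<phi>)))"

lemma sat_Iff_fm [simp]: "sat M R e (Iff_fm \<phi> \<psi>) \<longleftrightarrow> (sat M R e \<phi> \<longleftrightarrow> sat M R e \<psi>)"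
  by (auto simp: Iff_fm_def)

text \<open>The variables 0, 1, 2 and 3 stand for the code of a sequence of models, the parameter, the
  cardinal \<open>\<sigma>\<close> and the value to be computed.\<close>

definition trace_fm :: fm where
  "trace_fm = Exists 7 (Conj (Mem 7 0) (Exists 8 (Conj (Mem 8 7) (Exists 9 (Conj (Mem 9 8)
     (Neg (Exists 10 (Conj (Mem 10 2) (Neg (Iff_fm (Mem 10 9) (Mem 10 6)))))))))))"

text \<open>The parameter is meant as the graph of a function on subsets of \<open>\<sigma>\<close>:
  a member \<open>p\<close> holds an argument, namely its trace on \<open>\<sigma>\<close>, and a
  value, tagged by sharing a set with \<open>\<sigma>\<close>. The formula describes the value at
  the argument read off the sequence code.\<close>

definition value_fm :: fm where
  "value_fm = Conj (Mem 3 2) (Exists 4 (Conj (Mem 4 1)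
     (Conj (Exists 5 (Conj (Mem 5 4) (Conj (Mem 2 5) (Mem 3 5))))
       (Neg (Exists 6 (Conj (Mem 6 2) (Neg (Iff_fm (Mem 6 4) trace_fm))))))))"

text \<open>Three membership steps lead from a sequence code through its pairs to the indices and
  the models. Comparing with \<open>k\<close> on \<open>\<sigma>\<close> turns a model into the
  ordinal it cuts out, without a formula for ordered pairs.\<close>

definition in_trace :: "'c hset \<Rightarrow> 'c hset \<Rightarrow> 'c hset \<Rightarrow> bool" where
  "in_trace s \<sigma> k \<longleftrightarrow> (\<exists>y\<in>elts s. \<exists>z\<in>elts y. \<exists>w\<in>elts z. \<forall>m\<in>elts \<sigma>. m \<in> elts w \<longleftrightarrow> m \<in> elts k)"

text \<open>All quantifiers of the formula are bounded, so in a transitive \<open>M\<close> it means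
  what it means outside.\<close>

lemma sat_value_fm:
  assumes M: "\<And>x y. x \<in> M \<Longrightarrow> y \<in> elts x \<Longrightarrow> y \<in> M" and e: "e 0 \<in> M" "e 1 \<in> M" "e 2 \<in> M"
  shows "sat M R e value_fm \<longleftrightarrow> e 3 \<in> elts (e 2) \<and> (\<exists>p\<in>elts (e 1).
    (\<exists>q\<in>elts p. e 2 \<in> elts q \<and> e 3 \<in> elts q) \<and> (\<forall>k\<in>elts (e 2). k \<in> elts p \<longleftrightarrow> in_trace (e 0) (e 2) k))"
proof -
  have bex: "(\<exists>v\<in>M. v \<in> elts x \<and> Q v) \<longleftrightarrow> (\<exists>v\<in>elts x. Q v)" if "x \<in> M" for x Q
    using M[OF that] by blast
  have ball: "(\<forall>v\<in>M. v \<in> elts x \<longrightarrow> Q v) \<longleftrightarrow> (\<forall>v\<in>elts x. Q v)" if "x \<in> M" for x Q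
    using M[OF that] by blast
  have trace: "sat M R f trace_fm \<longleftrightarrow> in_trace (f 0) (f 2) (f 6)" if "f 0 \<in> M" "f 2 \<in> M" for f
  proof -
    have "sat M R f trace_fm \<longleftrightarrow> (\<exists>y\<in>M. y \<in> elts (f 0) \<and> (\<exists>z\<in>M. z \<in> elts y \<and> (\<exists>w\<in>M. w \<in> elts z \<and>
        \<not> (\<exists>m\<in>M. m \<in> elts (f 2) \<and> \<not> (m \<in> elts w \<longleftrightarrow> m \<in> elts (f 6))))))"
      by (simp add: trace_fm_def)
    also have "\<dots> \<longleftrightarrow> in_trace (f 0) (f 2) (f 6)"
      unfolding in_trace_def by (simp add: bex ball that cong: bex_cong)
    finally show ?thesis .
  qed
  have "sat M R e value_fm \<longleftrightarrow> e 3 \<in> elts (e 2) \<and> (\<exists>p\<in>M. p \<in> elts (e 1) \<and>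
      (\<exists>q\<in>M. q \<in> elts p \<and> e 2 \<in> elts q \<and> e 3 \<in> elts q) \<and>
      \<not> (\<exists>k\<in>M. k \<in> elts (e 2) \<and> \<not> (k \<in> elts p \<longleftrightarrow> in_trace (e 0) (e 2) k)))"
    using e by (simp add: value_fm_def trace)
  also have "\<dots> \<longleftrightarrow> e 3 \<in> elts (e 2) \<and> (\<exists>p\<in>elts (e 1).
    (\<exists>q\<in>elts p. e 2 \<in> elts q \<and> e 3 \<in> elts q) \<and> (\<forall>k\<in>elts (e 2). k \<in> elts p \<longleftrightarrow> in_trace (e 0) (e 2) k))"
    by (simp add: bex ball e e(2)[simplified] cong: bex_cong)
  finally show ?thesis .
qed

text \<open>Elementarity moves the existence of a value into \<open>N\<close>, and truth is then
  returned to the transitive \<open>H \<chi>\<close>, so that the description refers to all members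
  of \<open>x\<close> and \<open>\<sigma>\<close>. That the value found is the intended one is
  settled where \<open>x\<close> is known.\<close>

lemma elementary_value:
  assumes el: "elem_submodel N (H \<chi>) R" and mem: "s \<in> N" "x \<in> N" "\<sigma> \<in> N"
    and v: "v \<in> elts \<sigma>" "p \<in> elts x" "q \<in> elts p" "\<sigma> \<in> elts q" "v \<in> elts q"
      "\<forall>k\<in>elts \<sigma>. k \<in> elts p \<longleftrightarrow> in_trace s \<sigma> k"
  shows "\<exists>v\<in>N. v \<in> elts \<sigma> \<and> (\<exists>p\<in>elts x. (\<exists>q\<in>elts p. \<sigma> \<in> elts q \<and> v \<in> elts q) \<and>
    (\<forall>k\<in>elts \<sigma>. k \<in> elts p \<longleftrightarrow> in_trace s \<sigma> k))"
proof -
  have sub: "N \<subseteq> H \<chi>" and iff: "\<And>\<phi> f. range f \<subseteq> N \<Longrightarrow> sat N R f \<phi> \<longleftrightarrow> sat (H \<chi>) R f \<phi>"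
    using el unfolding elem_submodel_def by blast+
  define f :: "nat \<Rightarrow> 'a hset" where "f = (\<lambda>_. s)(1 := x, 2 := \<sigma>)"
  have f: "f 0 = s" "f 1 = x" "f 2 = \<sigma>" "range f \<subseteq> N" using mem by (auto simp: f_def)
  have sv: "sat (H \<chi>) R (f(3 := w)) value_fm \<longleftrightarrow> w \<in> elts \<sigma> \<and> (\<exists>p\<in>elts x. (\<exists>q\<in>elts p. \<sigma> \<in> elts q \<and> w \<in> elts q) \<and>
    (\<forall>k\<in>elts \<sigma>. k \<in> elts p \<longleftrightarrow> in_trace s \<sigma> k))" for w
    using sat_value_fm[of "H \<chi>" "f(3 := w)" R] H_transitive[of _ \<chi>] mem sub f(1-3) by (simp add: subset_iff)
  have "v \<in> H \<chi>" using H_transitive v(1) mem(3) sub by blast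
  then have "sat (H \<chi>) R f (Exists 3 value_fm)" using sv[of v] v by auto
  then have "sat N R f (Exists 3 value_fm)" using iff[OF f(4)] by blast
  then obtain w where w: "w \<in> N" "sat N R (f(3 := w)) value_fm" by auto
  have "range (f(3 := w)) \<subseteq> N" using f(4) w(1) by auto
  then have "sat (H \<chi>) R (f(3 := w)) value_fm" using iff w(2) by blast
  then show ?thesis using sv[of w] w(1) by blast
qed

lemma card_of_finite_ordLeq: "finite A \<Longrightarrow> infinite B \<Longrightarrow> |A| \<le>o |B|"
  by (rule ordLess_imp_ordLeq[OF card_of_finite_ordLess])

lemma elts_kpair:
  assumes "infinite (UNIV :: 'c set)"
  shows "\<Union> (elts ` elts (kpair (a :: 'c hset) b)) = {a, b}"
proof -
  have fin: "elts (set_of X) = X" if "finite X" for X :: "'c hset set"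
    by (rule elts_set_of[OF card_of_finite_ordLeq[OF that assms]])
  show ?thesis unfolding kpair_def by (auto simp: fin)
qed

text \<open>Translates model sequences into ordinal sequences. The graph of an arbitrary
  \<open>G\<close> is coded by one \<open>x\<close>; as each model contains \<open>x\<close> and the
  code of the sequence so far, its trace must exceed \<open>G\<close> of that history. Monotonicity
  is only weak at this point; a suitable \<open>G\<close> makes it strict.\<close>

lemma ac_parameter:
  fixes \<sigma> \<rho> :: "'a::wellorder" and G :: "'a set \<Rightarrow> 'a"
  assumes \<sigma>: "regular_cardinal \<sigma>" and \<rho>: "regular_cardinal \<rho>" "\<rho> < \<sigma>"
    and big: "|Pow (Pow {..<\<sigma>})| \<le>o |UNIV :: 'c set|"
    and G: "\<And>r. r \<subseteq> {..<\<sigma>} \<Longrightarrow> G r < \<sigma>"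
  obtains \<chi> :: "'c rel" and x :: "'c hset" where
    "Card_order \<chi>" "regularCard \<chi>" "|{..<\<sigma>}| <o \<chi>" "x \<in> H \<chi>"
    "\<And>W j N. ac_sequence W \<chi> x \<sigma> \<rho> {j} N \<Longrightarrow> j < \<sigma> \<Longrightarrow>
       \<exists>i. (\<forall>\<epsilon><\<rho>. \<rho> < i \<epsilon> \<and> i \<epsilon> < \<sigma>) \<and> (\<forall>\<epsilon><\<rho>. \<forall>\<zeta><\<epsilon>. i \<zeta> \<le> i \<epsilon>)
         \<and> (\<forall>\<epsilon><\<rho>. limit_ord \<epsilon> \<longrightarrow> is_sup (i ` {..<\<epsilon>}) (i \<epsilon>)) \<and> is_sup (i ` {..<\<rho>}) j
         \<and> (\<forall>\<xi><\<rho>. G ({..\<xi>} \<union> i ` {..\<xi>}) < i (succ_ord \<xi>))"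
proof -
  define V :: "'a \<Rightarrow> 'c hset" where "V = von"
  define q :: "'a \<Rightarrow> 'c hset" where "q v = set_of {V \<sigma>, V v}" for v
  define p :: "'a set \<Rightarrow> 'c hset" where "p r = set_of (V ` r \<union> {q (G r)})" for r
  \<comment> \<open>\<open>p r\<close> codes the pair of \<open>r\<close> and \<open>G r\<close>: the member \<open>q (G r)\<close> is recognised by \<open>V \<sigma>\<close>, which belongs
    to no ordinal below \<open>\<sigma>\<close>.\<close>
  define x :: "'c hset" where "x = set_of (p ` Pow {..<\<sigma>})"
  have inf\<sigma>: "infinite {..<\<sigma>}" by (rule regular_infinite[OF \<sigma>])
  have bigP: "|Pow {..<\<sigma>}| \<le>o |UNIV :: 'c set|"
    by (rule ordLeq_transitive[OF ordLess_imp_ordLeq[OF card_of_Pow] big])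
  have big\<sigma>: "|{..<\<sigma>}| \<le>o |UNIV :: 'c set|"
    by (rule ordLeq_transitive[OF ordLess_imp_ordLeq[OF card_of_Pow] bigP])
  have infc: "infinite (UNIV :: 'c set)" using big\<sigma> inf\<sigma> card_of_ordLeq_infinite by blast
  have small: "|{..<\<alpha>}| \<le>o |UNIV :: 'c set|" if "\<alpha> \<le> \<sigma>" for \<alpha>
    using ordLeq_transitive[OF card_of_mono1 big\<sigma>, of "{..<\<alpha>}"] that by auto
  have eltsV: "elts (V \<alpha>) = V ` {..<\<alpha>}" if "\<alpha> \<le> \<sigma>" for \<alpha>
    unfolding V_def by (rule elts_von[OF small[OF that]])
  have Vinj: "V \<alpha> = V \<beta> \<longleftrightarrow> \<alpha> = \<beta>" if "\<alpha> \<le> \<sigma>" "\<beta> \<le> \<sigma>" for \<alpha> \<beta>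
    using von_inject[OF small small, OF that] unfolding V_def by blast
  have Vmem: "V \<alpha> \<in> elts (V \<beta>) \<longleftrightarrow> \<alpha> < \<beta>" if le: "\<alpha> \<le> \<sigma>" "\<beta> \<le> \<sigma>" for \<alpha> \<beta>
  proof
    assume "V \<alpha> \<in> elts (V \<beta>)"
    then obtain \<gamma> where \<gamma>: "\<gamma> < \<beta>" "V \<alpha> = V \<gamma>" unfolding eltsV[OF le(2)] by blast
    have "\<gamma> \<le> \<sigma>" using \<gamma>(1) le(2) by simp
    then show "\<alpha> < \<beta>" using \<gamma> Vinj[OF le(1)] by blast
  qed (simp add: eltsV[OF le(2)])
  have fin: "elts (set_of X) = X" if "finite X" for X :: "'c hset set"
    by (rule elts_set_of[OF card_of_finite_ordLeq[OF that infc]])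
  have eltsq: "elts (q v) = {V \<sigma>, V v}" for v unfolding q_def by (rule fin) simp
  have eltsp: "elts (p r) = V ` r \<union> {q (G r)}" if "r \<subseteq> {..<\<sigma>}" for r
    unfolding p_def
  proof (rule elts_set_of, rule card_of_Un_ordLeq[OF infc])
    have "|r| \<le>o |{..<\<sigma>}|" using that by (rule card_of_mono1)
    then show "|V ` r| \<le>o |UNIV :: 'c set|"
      by (rule ordLeq_transitive[OF card_of_image ordLeq_transitive[OF _ big\<sigma>]])
    show "|{q (G r)}| \<le>o |UNIV :: 'c set|" by (rule card_of_finite_ordLeq[OF _ infc]) simp
  qed
  have eltsx: "elts x = p ` Pow {..<\<sigma>}"
    unfolding x_def by (rule elts_set_of[OF ordLeq_transitive[OF card_of_image bigP]])

  \<comment> \<open>The parameter has a member for each subset of \<open>\<sigma>\<close>, so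
    \<open>\<chi>\<close> is taken as the successor of \<open>|Pow {..<\<sigma>}|\<close>; the
    double power set in \<open>big\<close> leaves room for it.\<close>
  obtain \<chi> :: "'c rel" where \<chi>: "Card_order \<chi>" "regularCard \<chi>"
    "\<forall>B :: 'c hset set. |B| \<le>o |Pow {..<\<sigma>}| \<longrightarrow> |B| <o \<chi>"
    using regular_successor_in_type[of "Pow {..<\<sigma>}"] big inf\<sigma> by auto
  have injV: "inj_on V {..<\<sigma>}" using Vinj by (auto intro!: inj_onI)
  have V\<sigma>: "|V ` {..<\<sigma>}| =o |{..<\<sigma>}|"
    using injV card_of_ordIso inj_on_imp_bij_betw ordIso_symmetric by blast
  have "|{..<\<sigma>}| <o \<chi>"
  proof -
    have "|V ` {..<\<sigma>}| \<le>o |Pow {..<\<sigma>}|"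
      by (rule ordLeq_transitive[OF card_of_image ordLess_imp_ordLeq[OF card_of_Pow]])
    then have "|V ` {..<\<sigma>}| <o \<chi>" using \<chi>(3) by blast
    then show ?thesis using V\<sigma> ordIso_symmetric ordIso_ordLess_trans by blast
  qed
  moreover have "x \<in> H \<chi>"
  proof -
    define Z where "Z = p ` Pow {..<\<sigma>} \<union> (V ` {..<\<sigma>} \<union> ({V \<sigma>} \<union> q ` {..<\<sigma>}))"
    have VZ: "V \<alpha> \<in> Z" if "\<alpha> \<le> \<sigma>" for \<alpha> using that unfolding Z_def by (cases "\<alpha> = \<sigma>") auto
    have "trans_closure x \<subseteq> Z"
    proof (rule trans_closure_subset)
      show "elts x \<subseteq> Z" unfolding eltsx Z_def by blast
      fix z assume "z \<in> Z"
      then consider r where "r \<subseteq> {..<\<sigma>}" "z = p r" | \<alpha> where "\<alpha> \<le> \<sigma>" "z = V \<alpha>" | v where "v < \<sigma>" "z = q v"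
        unfolding Z_def by (auto dest: less_imp_le)
      then show "elts z \<subseteq> Z"
      proof cases
        case 1
        have "q (G r) \<in> Z" using G[OF 1(1)] unfolding Z_def by blast
        moreover have "V ` r \<subseteq> Z" using 1(1) unfolding Z_def by blast
        ultimately show ?thesis unfolding 1(2) eltsp[OF 1(1)] by blast
      next
        case 2
        then show ?thesis using eltsV[OF 2(1)] VZ by (auto dest: order_less_le_trans)
      next
        case 3
        then show ?thesis using VZ eltsq by auto
      qed
    qed
    then have "|trans_closure x| \<le>o |Z|" by (rule card_of_mono1)
    also have "|Z| \<le>o |Pow {..<\<sigma>}|"
    proof -
      have infP: "infinite (Pow {..<\<sigma>})" using inf\<sigma> by simp
      have P\<sigma>: "|{..<\<sigma>}| \<le>o |Pow {..<\<sigma>}|" by (rule ordLess_imp_ordLeq[OF card_of_Pow])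
      show ?thesis unfolding Z_def
        by (intro card_of_Un_ordLeq[OF infP] card_of_image ordLeq_transitive[OF card_of_image P\<sigma>]
            card_of_finite_ordLeq[OF _ infP]) simp
    qed
    finally show ?thesis unfolding H_def using \<chi>(3) by blast
  qed
  moreover have "\<exists>i. (\<forall>\<epsilon><\<rho>. \<rho> < i \<epsilon> \<and> i \<epsilon> < \<sigma>) \<and> (\<forall>\<epsilon><\<rho>. \<forall>\<zeta><\<epsilon>. i \<zeta> \<le> i \<epsilon>)
         \<and> (\<forall>\<epsilon><\<rho>. limit_ord \<epsilon> \<longrightarrow> is_sup (i ` {..<\<epsilon>}) (i \<epsilon>)) \<and> is_sup (i ` {..<\<rho>}) j
         \<and> (\<forall>\<xi><\<rho>. G ({..\<xi>} \<union> i ` {..\<xi>}) < i (succ_ord \<xi>))"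
    if ac: "ac_sequence W \<chi> x \<sigma> \<rho> {j} N" and j: "j < \<sigma>" for W j N
  proof -
    note lim = regular_limit[OF \<rho>(1)]
    note acs = ac[unfolded ac_sequence_def V_def[symmetric]]
    note acs' = acs[THEN conjunct2, THEN conjunct2, THEN conjunct2, THEN conjunct2]
    have el: "elem_submodel (N \<epsilon>) (H \<chi>) (W \<chi> - Id)" if "\<epsilon> < \<rho>" for \<epsilon>
      using acs[THEN conjunct1] that by blast
    have mono: "N \<zeta> \<subseteq> N \<epsilon>" if "\<zeta> \<le> \<epsilon>" "\<epsilon> < \<rho>" for \<zeta> \<epsilon>
      using acs[THEN conjunct2, THEN conjunct1] that by (cases "\<zeta> = \<epsilon>") auto
    have cont: "N \<epsilon> = (\<Union>\<zeta><\<epsilon>. N \<zeta>)" if "\<epsilon> < \<rho>" "limit_ord \<epsilon>" for \<epsilon>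
      using acs[THEN conjunct2, THEN conjunct2, THEN conjunct1] that by blast
    have seq: "sequence_code \<epsilon> N \<in> N (succ_ord \<epsilon>)" if "\<epsilon> < \<rho>" for \<epsilon>
      using acs[THEN conjunct2, THEN conjunct2, THEN conjunct2, THEN conjunct1] that by blast
    have card: "|N \<epsilon>| <o |{..<\<sigma>}|" if "\<epsilon> < \<rho>" for \<epsilon>
      using acs'[THEN conjunct1] that by blast
    have ord: "\<exists>\<alpha>\<le>\<sigma>. N \<epsilon> \<inter> V ` {..<\<sigma>} = V ` {..<\<alpha>}" if "\<epsilon> < \<rho>" for \<epsilon>
      using acs'[THEN conjunct1] that by blast
    have "x \<in> N zero_ord" "V \<sigma> \<in> N zero_ord" "V \<rho> \<in> N zero_ord"
      by (rule acs'[THEN conjunct2, THEN conjunct1],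
          rule acs'[THEN conjunct2, THEN conjunct2, THEN conjunct1],
          rule acs'[THEN conjunct2, THEN conjunct2, THEN conjunct2, THEN conjunct1])
    moreover have "zero_ord \<le> \<epsilon>" for \<epsilon> :: 'a unfolding zero_ord_def by (rule Least_le) simp
    ultimately have N0: "x \<in> N \<epsilon>" "V \<sigma> \<in> N \<epsilon>" "V \<rho> \<in> N \<epsilon>" if "\<epsilon> < \<rho>" for \<epsilon>
      using mono[OF _ that] by blast+
    have union: "(\<Union>\<epsilon><\<rho>. N \<epsilon> \<inter> V ` {..<\<sigma>}) = V ` {..<j}"
      using acs'[THEN conjunct2, THEN conjunct2, THEN conjunct2, THEN conjunct2] by blast
    have "\<exists>\<alpha><\<sigma>. N \<epsilon> \<inter> V ` {..<\<sigma>} = V ` {..<\<alpha>}" if \<epsilon>: "\<epsilon> < \<rho>" for \<epsilon>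
    proof -
      obtain \<alpha> where \<alpha>: "\<alpha> \<le> \<sigma>" "N \<epsilon> \<inter> V ` {..<\<sigma>} = V ` {..<\<alpha>}" using ord[OF \<epsilon>] by blast
      have "\<alpha> \<noteq> \<sigma>"
      proof
        assume "\<alpha> = \<sigma>"
        then have "V ` {..<\<sigma>} \<subseteq> N \<epsilon>" using \<alpha>(2) by blast
        then have "|V ` {..<\<sigma>}| \<le>o |N \<epsilon>|" by (rule card_of_mono1)
        then have "|V ` {..<\<sigma>}| <o |{..<\<sigma>}|" using card[OF \<epsilon>] by (rule ordLeq_ordLess_trans)
        then show False using V\<sigma> not_ordLess_ordIso by blast
      qed
      then show ?thesis using \<alpha> by (auto simp: order_le_less)
    qed
    then obtain i where i: "\<And>\<epsilon>. \<epsilon> < \<rho> \<Longrightarrow> i \<epsilon> < \<sigma>" "\<And>\<epsilon>. \<epsilon> < \<rho> \<Longrightarrow> N \<epsilon> \<inter> V ` {..<\<sigma>} = V ` {..<i \<epsilon>}"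
      by metis
    have iN: "V \<alpha> \<in> N \<epsilon> \<longleftrightarrow> \<alpha> < i \<epsilon>" if "\<alpha> < \<sigma>" "\<epsilon> < \<rho>" for \<alpha> \<epsilon>
    proof -
      have "V \<alpha> \<in> N \<epsilon> \<longleftrightarrow> V \<alpha> \<in> V ` {..<i \<epsilon>}" using i(2)[OF that(2)] that(1) by blast
      also have "\<dots> \<longleftrightarrow> \<alpha> < i \<epsilon>" using Vmem[of \<alpha> "i \<epsilon>"] eltsV[of "i \<epsilon>"] i(1)[OF that(2)] that(1) by (simp add: less_imp_le)
      finally show ?thesis .
    qed
    \<comment> \<open>The model contains \<open>V \<rho>\<close>. That all values exceed
      \<open>\<rho>\<close> is what later separates them from the indices.\<close>
    have i\<rho>: "\<rho> < i \<epsilon>" if "\<epsilon> < \<rho>" for \<epsilon> using iN[OF \<rho>(2) that] N0(3)[OF that] by blast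
    have ileI: "i \<epsilon> \<le> \<beta>" if \<epsilon>: "\<epsilon> < \<rho>" and \<beta>: "\<And>\<alpha>. \<alpha> < \<sigma> \<Longrightarrow> V \<alpha> \<in> N \<epsilon> \<Longrightarrow> \<alpha> < \<beta>" for \<epsilon> \<beta>
    proof (rule ccontr)
      assume "\<not> i \<epsilon> \<le> \<beta>"
      then have b: "\<beta> < i \<epsilon>" by simp
      then have "\<beta> < \<sigma>" using i(1)[OF \<epsilon>] by (rule less_trans)
      then show False using iN[OF _ \<epsilon>] b \<beta> by blast
    qed
    have imono: "i \<zeta> \<le> i \<epsilon>" if h: "\<zeta> \<le> \<epsilon>" "\<epsilon> < \<rho>" for \<zeta> \<epsilon>
    proof (rule ileI)
      show "\<zeta> < \<rho>" using h by simp
      fix \<alpha> assume "\<alpha> < \<sigma>" "V \<alpha> \<in> N \<zeta>"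
      then show "\<alpha> < i \<epsilon>" using iN[OF _ h(2)] mono[OF h] by blast
    qed
    have sup: "is_sup (i ` {..<\<epsilon>}) (i \<epsilon>)" if \<epsilon>: "\<epsilon> < \<rho>" "limit_ord \<epsilon>" for \<epsilon>
      unfolding is_sup_def
    proof (intro conjI ballI allI impI)
      fix \<alpha> assume "\<alpha> \<in> i ` {..<\<epsilon>}"
      then show "\<alpha> \<le> i \<epsilon>" using imono \<epsilon>(1) by (auto dest: less_imp_le)
    next
      fix \<beta> assume \<beta>: "\<forall>\<alpha>\<in>i ` {..<\<epsilon>}. \<alpha> \<le> \<beta>"
      show "i \<epsilon> \<le> \<beta>"
      proof (rule ileI[OF \<epsilon>(1)])
        fix \<alpha> assume \<alpha>: "\<alpha> < \<sigma>" "V \<alpha> \<in> N \<epsilon>"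
        then obtain \<zeta> where \<zeta>: "\<zeta> < \<epsilon>" "V \<alpha> \<in> N \<zeta>" using cont[OF \<epsilon>] by blast
        then have "\<alpha> < i \<zeta>" using iN[OF \<alpha>(1), of \<zeta>] \<epsilon>(1) by (meson less_trans)
        then show "\<alpha> < \<beta>" using \<beta> \<zeta>(1) by (meson imageI lessThan_iff order_less_le_trans)
      qed
    qed
    have supj: "is_sup (i ` {..<\<rho>}) j"
      unfolding is_sup_def
    proof (intro conjI ballI allI impI)
      fix \<alpha> assume "\<alpha> \<in> i ` {..<\<rho>}"
      then obtain \<epsilon> where \<epsilon>: "\<epsilon> < \<rho>" "\<alpha> = i \<epsilon>" by blast
      show "\<alpha> \<le> j" unfolding \<epsilon>(2)
      proof (rule ileI[OF \<epsilon>(1)])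
        fix \<beta> assume "\<beta> < \<sigma>" "V \<beta> \<in> N \<epsilon>"
        then have "V \<beta> \<in> elts (V j)" "\<beta> \<le> \<sigma>" using union \<epsilon>(1) eltsV[of j] j by (auto simp: less_imp_le)
        then show "\<beta> < j" using Vmem j by (simp add: less_imp_le)
      qed
    next
      fix \<beta> assume \<beta>: "\<forall>\<alpha>\<in>i ` {..<\<rho>}. \<alpha> \<le> \<beta>"
      show "j \<le> \<beta>"
      proof (rule ccontr)
        assume "\<not> j \<le> \<beta>"
        then have bj: "\<beta> < j" by simp
        then obtain \<epsilon> where \<epsilon>: "\<epsilon> < \<rho>" "V \<beta> \<in> N \<epsilon>" using union by blast
        then have "\<beta> < i \<epsilon>" using iN less_trans[OF bj j] by blast
        then show False using \<beta> \<epsilon>(1) by force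
      qed
    qed
    have step: "G ({..\<xi>} \<union> i ` {..\<xi>}) < i (succ_ord \<xi>)" if \<xi>: "\<xi> < \<rho>" for \<xi>
    proof -
      \<comment> \<open>The history up to \<open>\<xi>\<close>, indices and traces together, as one
        subset of \<open>\<sigma>\<close> that can be read off the sequence code.\<close>
      define r where "r = {..\<xi>} \<union> i ` {..\<xi>}"
      define s where "s = sequence_code \<xi> N"
      have \<xi>': "succ_ord \<xi> < \<rho>" by (rule limit_succ[OF lim \<xi>])
      have le\<rho>: "\<zeta> < \<rho>" "\<zeta> < \<sigma>" if "\<zeta> \<le> \<xi>" for \<zeta> using that \<xi> \<rho>(2) by auto
      have rsub: "r \<subseteq> {..<\<sigma>}" unfolding r_def using le\<rho> i(1) by auto
      have eltsN: "elts (set_of (N \<zeta>)) = N \<zeta>" if "\<zeta> \<le> \<xi>" for \<zeta>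
        using card[OF le\<rho>(1)[OF that]] big\<sigma>
        by (intro elts_set_of) (rule ordLeq_transitive[OF ordLess_imp_ordLeq])
      have "{kpair (von \<zeta>) (set_of (N \<zeta>)) | \<zeta>. \<zeta> \<le> \<xi>} = (\<lambda>\<zeta>. kpair (V \<zeta>) (set_of (N \<zeta>))) ` {..\<xi>}"
        unfolding V_def by blast
      moreover have "|(\<lambda>\<zeta>. kpair (V \<zeta>) (set_of (N \<zeta>))) ` {..\<xi>}| \<le>o |UNIV :: 'c set|"
      proof (rule ordLeq_transitive[OF card_of_image], rule ordLeq_transitive[OF _ big\<sigma>], rule card_of_mono1)
        show "{..\<xi>} \<subseteq> {..<\<sigma>}" using le\<rho>(2) by blast
      qed
      ultimately have eltss: "elts s = (\<lambda>\<zeta>. kpair (V \<zeta>) (set_of (N \<zeta>))) ` {..\<xi>}"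
        unfolding s_def sequence_code_def using elts_set_of by metis
      have "(\<exists>y\<in>elts s. \<exists>z\<in>elts y. \<exists>w\<in>elts z. Q w) \<longleftrightarrow> (\<exists>\<zeta>\<le>\<xi>. Q (V \<zeta>) \<or> Q (set_of (N \<zeta>)))" for Q
      proof -
        have "(\<exists>z\<in>elts y. \<exists>w\<in>elts z. Q w) \<longleftrightarrow> (\<exists>w\<in>\<Union> (elts ` elts y). Q w)" for y by blast
        then have "(\<exists>z\<in>elts (kpair a b). \<exists>w\<in>elts z. Q w) \<longleftrightarrow> Q a \<or> Q b" for a b
          by (simp only: elts_kpair[OF infc]) blast
        then show ?thesis unfolding eltss by auto
      qed
      then have trace: "in_trace s (V \<sigma>) k \<longleftrightarrow>
          (\<exists>\<zeta>\<le>\<xi>. (\<forall>m\<in>elts (V \<sigma>). m \<in> elts (V \<zeta>) \<longleftrightarrow> m \<in> elts k) \<or>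
            (\<forall>m\<in>elts (V \<sigma>). m \<in> elts (set_of (N \<zeta>)) \<longleftrightarrow> m \<in> elts k))" for k
        by (simp only: in_trace_def)
      \<comment> \<open>On \<open>\<sigma>\<close>, \<open>V \<zeta>\<close> and
        \<open>N \<zeta>\<close> cut out initial segments of lengths \<open>\<zeta>\<close> and
        \<open>i \<zeta>\<close>, and a segment determines its length.\<close>
      have eq: "(\<forall>\<alpha>\<in>{..<\<sigma>}. \<alpha> < \<beta> \<longleftrightarrow> \<alpha> < k) \<longleftrightarrow> \<beta> = k" if "\<beta> < \<sigma>" "k < \<sigma>" for \<beta> k
        using that by (metis lessThan_iff less_irrefl linorder_neqE)
      have trace': "in_trace s (V \<sigma>) (V k) \<longleftrightarrow> k \<in> r" if k: "k < \<sigma>" for k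
      proof -
        have "(\<forall>m\<in>elts (V \<sigma>). m \<in> elts (V \<zeta>) \<longleftrightarrow> m \<in> elts (V k)) \<longleftrightarrow> \<zeta> = k" if "\<zeta> \<le> \<xi>" for \<zeta>
          using eq[OF le\<rho>(2)[OF that] k] le\<rho>(2)[OF that] k
          by (simp add: eltsV[OF order_refl] Vmem less_imp_le)
        moreover have "(\<forall>m\<in>elts (V \<sigma>). m \<in> elts (set_of (N \<zeta>)) \<longleftrightarrow> m \<in> elts (V k)) \<longleftrightarrow> i \<zeta> = k" if "\<zeta> \<le> \<xi>" for \<zeta>
          using eq[OF i(1)[OF le\<rho>(1)[OF that]] k] k le\<rho>(1)[OF that]
          by (simp add: eltsV[OF order_refl] Vmem less_imp_le eltsN[OF that] iN)
        ultimately have "in_trace s (V \<sigma>) (V k) \<longleftrightarrow> (\<exists>\<zeta>\<le>\<xi>. \<zeta> = k \<or> i \<zeta> = k)" unfolding trace by blast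
        then show ?thesis unfolding r_def by auto
      qed
      have qV: "q v \<noteq> V k" if "k < \<sigma>" for v k
      proof
        assume "q v = V k"
        then have "V \<sigma> \<in> elts (V k)" using eltsq[of v] by simp
        then show False using Vmem[of \<sigma> k] that by (simp add: less_imp_le)
      qed
      have memp: "V k \<in> elts (p r') \<longleftrightarrow> k \<in> r'" if "k < \<sigma>" "r' \<subseteq> {..<\<sigma>}" for k r'
        unfolding eltsp[OF that(2)] using qV[OF that(1), of "G r'"] inj_on_image_mem_iff[OF injV _ that(2), of k] that(1)
        by auto
      have "\<exists>v\<in>N (succ_ord \<xi>). v \<in> elts (V \<sigma>) \<and> (\<exists>p\<in>elts x. (\<exists>q\<in>elts p. V \<sigma> \<in> elts q \<and> v \<in> elts q) \<and>
          (\<forall>k\<in>elts (V \<sigma>). k \<in> elts p \<longleftrightarrow> in_trace s (V \<sigma>) k))"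
      proof (rule elementary_value[OF el[OF \<xi>'] _ N0(1,2)[OF \<xi>']])
        show "s \<in> N (succ_ord \<xi>)" unfolding s_def by (rule seq[OF \<xi>])
        show "V (G r) \<in> elts (V \<sigma>)" using eltsV[OF order_refl] G[OF rsub] by blast
        show "p r \<in> elts x" unfolding eltsx using rsub by blast
        show "q (G r) \<in> elts (p r)" unfolding eltsp[OF rsub] by blast
        show "V \<sigma> \<in> elts (q (G r))" "V (G r) \<in> elts (q (G r))" unfolding eltsq by blast+
        show "\<forall>k\<in>elts (V \<sigma>). k \<in> elts (p r) \<longleftrightarrow> in_trace s (V \<sigma>) k"
          using memp[OF _ rsub] trace' by (simp add: eltsV[OF order_refl])
      qed
      then obtain v r' q' where v: "v \<in> N (succ_ord \<xi>)" "v \<in> elts (V \<sigma>)" and r': "r' \<subseteq> {..<\<sigma>}"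
        and q': "q' \<in> elts (p r')" "V \<sigma> \<in> elts q'" "v \<in> elts q'"
        and k: "\<forall>k\<in>elts (V \<sigma>). k \<in> elts (p r') \<longleftrightarrow> in_trace s (V \<sigma>) k"
        unfolding eltsx by blast
      \<comment> \<open>Uniqueness of the value: the trace identifies the argument \<open>r'\<close>
        with \<open>r\<close>, and the tag \<open>V \<sigma>\<close> singles out
        \<open>q (G r')\<close> among the members of \<open>p r'\<close>, leaving
        \<open>V (G r)\<close> as the only possible \<open>v\<close>.\<close>
      have "k \<in> r' \<longleftrightarrow> k \<in> r" if "k < \<sigma>" for k
        using k memp[OF that r'] trace'[OF that] that by (simp add: eltsV[OF order_refl])
      then have "r' = r" using r' rsub by blast
      moreover have "q' = q (G r')"
      proof -
        have "q' \<notin> V ` r'" using q'(2) r' Vmem[of \<sigma>] by (auto simp: less_imp_le subset_iff)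
        then show ?thesis using q'(1) eltsp[OF r'] by blast
      qed
      moreover have "v \<noteq> V \<sigma>" using v(2) not_mem_self by blast
      ultimately have "v = V (G r)" using q'(3) eltsq by blast
      then have "G r < i (succ_ord \<xi>)" using v(1) iN[OF G[OF rsub] \<xi>'] by blast
      then show ?thesis unfolding r_def .
    qed
    show ?thesis
      by (rule exI[of _ i]) (use i(1) i\<rho> imono sup supj step less_imp_le in blast)
  qed
  ultimately show thesis using that \<chi>(1,2) by blast
qed

section \<open>The closure condition\<close>

text \<open>Only the last requirement mentions \<open>A\<close>, and it is witnessed by one ordinal.
  Hence the set of all \<open>j\<close> at which no sequence ends is itself in the ideal.\<close>

lemma ac_sequence_singleton:
  assumes "ac_sequence W \<chi> x \<sigma> \<rho> A N"
  shows "\<exists>\<alpha>\<in>A. ac_sequence W \<chi> x \<sigma> \<rho> {\<alpha>} N"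
  using assms unfolding ac_sequence_def by simp

text \<open>Values above \<open>\<rho>\<close> can be separated from the indices, so that the set below determines both the
  length and the sequence.\<close>

lemma trace_unique:
  fixes i i' :: "'a::wellorder \<Rightarrow> 'a"
  assumes \<xi>: "\<xi> < \<rho>" "\<xi>' < \<rho>" and mono: "strict_mono_on {..\<xi>} i" "strict_mono_on {..\<xi>'} i'"
    and above: "\<And>\<eta>. \<eta> \<le> \<xi> \<Longrightarrow> \<rho> < i \<eta>" "\<And>\<eta>. \<eta> \<le> \<xi>' \<Longrightarrow> \<rho> < i' \<eta>"
    and eq: "{..\<xi>} \<union> i ` {..\<xi>} = {..\<xi>'} \<union> i' ` {..\<xi>'}"
  shows "\<xi> = \<xi>'" "\<forall>\<eta>\<le>\<xi>. i \<eta> = i' \<eta>"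
proof -
  have low: "({..x} \<union> f ` {..x}) \<inter> {..\<rho>} = {..x}" "({..x} \<union> f ` {..x}) \<inter> {\<rho><..} = f ` {..x}"
    if "x < \<rho>" "\<And>\<eta>. \<eta> \<le> x \<Longrightarrow> \<rho> < f \<eta>" for x f
    using that by fastforce+
  have "{..\<xi>} = {..\<xi>'}" using low(1)[of \<xi> i, OF \<xi>(1) above(1)] low(1)[of \<xi>' i', OF \<xi>(2) above(2)] eq by simp
  then show same: "\<xi> = \<xi>'" by (simp add: atMost_eq_iff)
  have "i ` {..\<xi>} = i' ` {..\<xi>'}"
    using low(2)[of \<xi> i, OF \<xi>(1) above(1)] low(2)[of \<xi>' i', OF \<xi>(2) above(2)] eq by simp
  then have im: "i ` {..\<xi>} = i' ` {..\<xi>}" by (simp only: same)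
  have half: "f \<eta> \<le> g \<eta>"
    if fg: "strict_mono_on {..\<xi>} f" "strict_mono_on {..\<xi>} g" "f ` {..\<xi>} = g ` {..\<xi>}"
      and \<eta>: "\<eta> \<le> \<xi>" and IH: "\<And>z. z < \<eta> \<Longrightarrow> f z = g z" for f g :: "'a \<Rightarrow> 'a" and \<eta>
  proof -
    obtain \<zeta> where \<zeta>: "\<zeta> \<le> \<xi>" "g \<eta> = f \<zeta>" using fg(3) \<eta> by blast
    have "\<not> \<zeta> < \<eta>"
    proof
      assume "\<zeta> < \<eta>"
      then have "g \<zeta> < g \<eta>" using fg(2) \<zeta>(1) \<eta> by (auto simp: strict_mono_on_def)
      then show False using IH[OF \<open>\<zeta> < \<eta>\<close>] \<zeta>(2) by simp
    qed
    then have "\<eta> = \<zeta> \<or> \<eta> < \<zeta>" by auto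
    then show ?thesis using fg(1) \<zeta> \<eta> by (auto simp: strict_mono_on_def less_imp_le)
  qed
  have "i \<eta> = i' \<eta>" if "\<eta> \<le> \<xi>" for \<eta>
    using that
  proof (induction \<eta> rule: less_induct)
    case (less \<eta>)
    have IH: "i z = i' z" if "z < \<eta>" for z using less.IH[OF that] less.prems that by simp
    show ?case
      using half[OF mono(1) mono(2)[folded same] im less.prems IH]
        half[OF mono(2)[folded same] mono(1) im[symmetric] less.prems IH[symmetric]] by (rule antisym)
  qed
  then show "\<forall>\<eta>\<le>\<xi>. i \<eta> = i' \<eta>" by blast
qed

text \<open>For use as a parameter, the closure condition must depend on the set \<open>r\<close>
  alone; \<open>trace_unique\<close> says that \<open>r\<close> determines the stage and the values
  up to it. The clause that \<open>G r\<close> exceeds every element of a bounded \<open>r\<close>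
  later forces strict growth.\<close>

lemma code_step_function:
  fixes \<sigma> :: "'a::wellorder"
  assumes \<sigma>: "regular_cardinal \<sigma>" and d: "incr_cont \<sigma> d \<delta>" and B: "|B| <o |{..<\<sigma>}|"
  shows "\<exists>G. \<forall>r. G r < \<sigma> \<and> (\<forall>\<beta><\<sigma>. (\<forall>y\<in>r. y < \<beta>) \<longrightarrow> (\<forall>y\<in>r. y < G r)) \<and>
    (\<forall>\<xi><\<rho>. \<forall>i. strict_mono_on {..\<xi>} i \<longrightarrow> (\<forall>\<eta>\<le>\<xi>. \<rho> < i \<eta>) \<longrightarrow> r = {..\<xi>} \<union> i ` {..\<xi>} \<longrightarrow>
      code_step e B \<delta> d \<xi> i (G r))"
proof (rule choice, rule allI)
  fix r :: "'a set"
  define T where "T \<xi> i \<longleftrightarrow> \<xi> < \<rho> \<and> strict_mono_on {..\<xi>} i \<and> (\<forall>\<eta>\<le>\<xi>. \<rho> < i \<eta>) \<and> r = {..\<xi>} \<union> i ` {..\<xi>}" for \<xi> i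
  obtain k1 where k1: "k1 < \<sigma>" "\<forall>\<xi> i. T \<xi> i \<longrightarrow> code_step e B \<delta> d \<xi> i k1"
  proof (cases "\<exists>\<xi> i. T \<xi> i")
    case True
    then obtain \<xi> i where T: "T \<xi> i" by blast
    obtain k where k: "k < \<sigma>" "code_step e B \<delta> d \<xi> i k" using code_step_exists[OF \<sigma> d B] by blast
    have "code_step e B \<delta> d \<xi>' i' k" if T': "T \<xi>' i'" for \<xi>' i'
    proof -
      have t: "\<xi> < \<rho>" "strict_mono_on {..\<xi>} i" "\<And>\<eta>. \<eta> \<le> \<xi> \<Longrightarrow> \<rho> < i \<eta>" "r = {..\<xi>} \<union> i ` {..\<xi>}"
        using T unfolding T_def by blast+
      have t': "\<xi>' < \<rho>" "strict_mono_on {..\<xi>'} i'" "\<And>\<eta>. \<eta> \<le> \<xi>' \<Longrightarrow> \<rho> < i' \<eta>"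
        "r = {..\<xi>'} \<union> i' ` {..\<xi>'}"
        using T' unfolding T_def by blast+
      note u = trace_unique[OF t(1) t'(1) t(2) t'(2) t(3) t'(3) trans[OF t(4)[symmetric] t'(4)]]
      have "code_step e B \<delta> d \<xi> i' k" using k(2) code_step_local[OF u(2)] by (rule iffD1[rotated])
      moreover have "\<xi>' = \<xi>" by (rule u(1)[symmetric])
      ultimately show ?thesis by simp
    qed
    then show thesis using that k(1) by blast
  next
    case False
    obtain k where "k < \<sigma>" using regular_limit[OF \<sigma>] unfolding limit_ord_def by blast
    then show thesis using that False by blast
  qed
  \<comment> \<open>A bound of \<open>r\<close> serves as \<open>k2\<close>; for \<open>r\<close>
    without a bound below \<open>\<sigma>\<close> the requirement is vacuous.\<close>
  obtain k2 where k2: "k2 < \<sigma>" "\<forall>\<beta><\<sigma>. (\<forall>y\<in>r. y < \<beta>) \<longrightarrow> (\<forall>y\<in>r. y < k2)"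
  proof (cases "\<exists>\<beta><\<sigma>. \<forall>y\<in>r. y < \<beta>")
    case True
    then show thesis using that by blast
  next
    case False
    then show thesis using that[OF k1(1)] by blast
  qed
  define k where "k = max k1 k2"
  have k: "k < \<sigma>" "k1 \<le> k" "k2 \<le> k" using k1(1) k2(1) by (auto simp: k_def)
  have "\<forall>\<beta><\<sigma>. (\<forall>y\<in>r. y < \<beta>) \<longrightarrow> (\<forall>y\<in>r. y < k)" using k2(2) k(3) order_less_le_trans by blast
  moreover have "\<forall>\<xi> i. T \<xi> i \<longrightarrow> code_step e B \<delta> d \<xi> i k"
    using k1(2) code_step_up[OF d _ k(2,1)] by blast
  ultimately show "\<exists>k. k < \<sigma> \<and> (\<forall>\<beta><\<sigma>. (\<forall>y\<in>r. y < \<beta>) \<longrightarrow> (\<forall>y\<in>r. y < k)) \<and>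
    (\<forall>\<xi><\<rho>. \<forall>i. strict_mono_on {..\<xi>} i \<longrightarrow> (\<forall>\<eta>\<le>\<xi>. \<rho> < i \<eta>) \<longrightarrow> r = {..\<xi>} \<union> i ` {..\<xi>} \<longrightarrow>
      code_step e B \<delta> d \<xi> i k)"
    using k(1) unfolding T_def by blast
qed

lemma code_step_off_ideal_ac:
  fixes \<sigma> \<rho> :: "'a::wellorder" and W :: "'c rel \<Rightarrow> 'c hset rel"
  assumes \<sigma>: "regular_cardinal \<sigma>" and \<rho>: "regular_cardinal \<rho>" "\<rho> < \<sigma>"
    and big: "|Pow (Pow {..<\<sigma>})| \<le>o |UNIV :: 'c set|"
    and d: "incr_cont \<sigma> d \<delta>" and B: "|B| <o |{..<\<sigma>}|"
  shows "\<exists>S\<in>ideal_ac W \<rho> \<sigma>. \<forall>j\<in>cof_set \<sigma> \<rho> - S. \<exists>i. incr_cont \<rho> i j \<and>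
    (\<forall>\<xi> \<zeta>. \<xi> < \<zeta> \<longrightarrow> \<zeta> < \<rho> \<longrightarrow> code_step e B \<delta> d \<xi> i (i \<zeta>))"
proof -
  note lim = regular_limit[OF \<rho>(1)]
  obtain G where G0: "\<forall>r. G r < \<sigma> \<and> (\<forall>\<beta><\<sigma>. (\<forall>y\<in>r. y < \<beta>) \<longrightarrow> (\<forall>y\<in>r. y < G r)) \<and>
    (\<forall>\<xi><\<rho>. \<forall>i. strict_mono_on {..\<xi>} i \<longrightarrow> (\<forall>\<eta>\<le>\<xi>. \<rho> < i \<eta>) \<longrightarrow> r = {..\<xi>} \<union> i ` {..\<xi>} \<longrightarrow>
      code_step e B \<delta> d \<xi> i (G r))"
    using code_step_function[OF \<sigma> d B, of \<rho> e] by (rule exE)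
  have G: "\<And>r. G r < \<sigma>" "\<And>r \<beta>. \<beta> < \<sigma> \<Longrightarrow> \<forall>y\<in>r. y < \<beta> \<Longrightarrow> \<forall>y\<in>r. y < G r"
    "\<And>\<xi> i. \<xi> < \<rho> \<Longrightarrow> strict_mono_on {..\<xi>} i \<Longrightarrow> \<forall>\<eta>\<le>\<xi>. \<rho> < i \<eta> \<Longrightarrow>
      code_step e B \<delta> d \<xi> i (G ({..\<xi>} \<union> i ` {..\<xi>}))"
    using G0 by simp_all
  obtain \<chi> :: "'c rel" and x :: "'c hset" where \<chi>: "Card_order \<chi>" "regularCard \<chi>" "|{..<\<sigma>}| <o \<chi>" "x \<in> H \<chi>"
    and ac: "\<And>W j N. ac_sequence W \<chi> x \<sigma> \<rho> {j} N \<Longrightarrow> j < \<sigma> \<Longrightarrow>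
       \<exists>i. (\<forall>\<epsilon><\<rho>. \<rho> < i \<epsilon> \<and> i \<epsilon> < \<sigma>) \<and> (\<forall>\<epsilon><\<rho>. \<forall>\<zeta><\<epsilon>. i \<zeta> \<le> i \<epsilon>)
         \<and> (\<forall>\<epsilon><\<rho>. limit_ord \<epsilon> \<longrightarrow> is_sup (i ` {..<\<epsilon>}) (i \<epsilon>)) \<and> is_sup (i ` {..<\<rho>}) j
         \<and> (\<forall>\<xi><\<rho>. G ({..\<xi>} \<union> i ` {..\<xi>}) < i (succ_ord \<xi>))"
    using ac_parameter[OF \<sigma> \<rho> big, of G] G(1) by metis
  define S where "S = {j \<in> cof_set \<sigma> \<rho>. \<not> (\<exists>N. ac_sequence W \<chi> x \<sigma> \<rho> {j} N)}"
  have "\<not> (\<exists>N. ac_sequence W \<chi> x \<sigma> \<rho> S N)" using ac_sequence_singleton unfolding S_def by fast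
  then have "S \<in> ideal_ac W \<rho> \<sigma>" unfolding ideal_ac_def using \<chi> unfolding S_def by blast
  moreover have "\<exists>i. incr_cont \<rho> i j \<and> (\<forall>\<xi> \<zeta>. \<xi> < \<zeta> \<longrightarrow> \<zeta> < \<rho> \<longrightarrow> code_step e B \<delta> d \<xi> i (i \<zeta>))"
    if mem: "j \<in> cof_set \<sigma> \<rho> - S" for j
  proof -
    have "j < \<sigma>" using mem unfolding cof_set_def by blast
    moreover obtain N where "ac_sequence W \<chi> x \<sigma> \<rho> {j} N" using mem unfolding S_def by blast
    ultimately obtain i where i: "\<forall>\<epsilon><\<rho>. \<rho> < i \<epsilon> \<and> i \<epsilon> < \<sigma>" "\<forall>\<epsilon><\<rho>. \<forall>\<zeta><\<epsilon>. i \<zeta> \<le> i \<epsilon>"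
      "\<forall>\<epsilon><\<rho>. limit_ord \<epsilon> \<longrightarrow> is_sup (i ` {..<\<epsilon>}) (i \<epsilon>)" "is_sup (i ` {..<\<rho>}) j"
      "\<forall>\<xi><\<rho>. G ({..\<xi>} \<union> i ` {..\<xi>}) < i (succ_ord \<xi>)"
      using ac by blast
    have le: "i \<xi> \<le> i \<zeta>" if "\<xi> \<le> \<zeta>" "\<zeta> < \<rho>" for \<xi> \<zeta> using i(2) that by (cases "\<xi> = \<zeta>") auto
    have Gless: "G ({..\<xi>} \<union> i ` {..\<xi>}) < i \<zeta>" if "\<xi> < \<zeta>" "\<zeta> < \<rho>" for \<xi> \<zeta>
      using i(5) le[OF succ_ord_greater(2)[OF that(1)] that(2)] that by (meson less_trans order_less_le_trans)
    \<comment> \<open>Together with \<open>Gless\<close> this places a value of \<open>G\<close>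
      strictly between \<open>i \<xi>\<close> and any later \<open>i \<zeta>\<close>, turning weak
      into strict monotonicity.\<close>
    have iG: "i \<xi> < G ({..\<xi>} \<union> i ` {..\<xi>})" if \<xi>: "\<xi> < \<rho>" for \<xi>
    proof -
      have s: "succ_ord (i \<xi>) < \<sigma>" "i \<xi> < succ_ord (i \<xi>)"
        using limit_succ[OF regular_limit[OF \<sigma>]] succ_ord_greater(1) i(1) \<xi> by blast+
      have "\<eta> < succ_ord (i \<xi>)" "i \<eta> < succ_ord (i \<xi>)" if "\<eta> \<le> \<xi>" for \<eta>
      proof -
        have "\<eta> < i \<xi>" using that \<xi> i(1) by (meson order_le_less_trans less_trans)
        then show "\<eta> < succ_ord (i \<xi>)" using s(2) by (rule less_trans)
        show "i \<eta> < succ_ord (i \<xi>)" using le[OF that \<xi>] s(2) by (rule order_le_less_trans)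
      qed
      then have "\<forall>y\<in>{..\<xi>} \<union> i ` {..\<xi>}. y < succ_ord (i \<xi>)" by auto
      then show ?thesis using G(2)[OF s(1)] by blast
    qed
    have less: "i \<xi> < i \<zeta>" if "\<xi> < \<zeta>" "\<zeta> < \<rho>" for \<xi> \<zeta>
      by (rule less_trans[OF iG[OF less_trans[OF that]] Gless[OF that]])
    have "incr_cont \<rho> i j"
      unfolding incr_cont_def using less i(3,4) by (auto intro: strict_mono_onI)
    moreover have "code_step e B \<delta> d \<xi> i (i \<zeta>)" if \<xi>: "\<xi> < \<zeta>" "\<zeta> < \<rho>" for \<xi> \<zeta>
    proof (rule code_step_up[OF d])
      have \<xi>\<rho>: "\<xi> < \<rho>" by (rule less_trans[OF \<xi>])
      have "strict_mono_on {..\<xi>} i" using less \<xi>\<rho> by (auto intro!: strict_mono_onI)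
      moreover have "\<forall>\<eta>\<le>\<xi>. \<rho> < i \<eta>" using i(1) \<xi>\<rho> order_le_less_trans by blast
      ultimately show "code_step e B \<delta> d \<xi> i (G ({..\<xi>} \<union> i ` {..\<xi>}))" by (rule G(3)[OF \<xi>\<rho>])
      show "G ({..\<xi>} \<union> i ` {..\<xi>}) \<le> i \<zeta>" using Gless[OF \<xi>] by (rule less_imp_le)
      show "i \<zeta> < \<sigma>" using i(1) \<xi>(2) by blast
    qed
    ultimately show ?thesis by blast
  qed
  ultimately show ?thesis by blast
qed

section \<open>Good points outside the two ideals, and reflection\<close>

theorem theorem0p1:
  fixes lam \<sigma> \<rho> \<theta> :: "'a::wellorder"
    and W :: "'c rel \<Rightarrow> 'c hset rel"
  assumes "regular_cardinal lam" "regular_cardinal \<sigma>" "regular_cardinal \<rho>" "regular_cardinal \<theta>"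
    and "\<sigma> < lam" "\<rho> < \<sigma>" "succ_card \<theta> < \<rho>" "\<theta> < succ_card \<theta>" "aleph0 < \<theta>"
    and universe_large: "|Pow (Pow (Pow {..<lam}))| \<le>o |UNIV :: 'c set|"
    and W: "\<And>\<chi>. Card_order \<chi> \<Longrightarrow> well_order_on (H \<chi>) (W \<chi>)"
  shows "(\<exists>S\<in>ideal_I lam \<theta>. \<forall>\<delta>\<in>cof_set lam \<sigma>. reflects_in S \<delta>)
    \<and> (\<exists>S\<in>ideal_I lam \<theta>. \<forall>\<delta>\<in>cof_set lam \<sigma>. reflects_in S \<delta>
         \<and> stationary {\<delta>1. \<delta>1 < \<delta> \<and> cf \<delta>1 = \<rho> \<and> reflects_in S \<delta>1} \<delta>)
    \<and> (\<forall>Pst. set_system \<rho> (succ_card \<theta>) \<sigma> Pst \<longrightarrow>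
         (\<exists>P. set_system lam lam lam P \<and>
           (\<forall>\<delta>\<in>cof_set lam \<sigma>. \<forall>d. incr_cont \<sigma> d \<delta> \<longrightarrow>
             (\<exists>S1\<in>ideal_ac W \<rho> \<sigma>. \<forall>j\<in>cof_set \<sigma> \<rho> - S1.
               \<exists>S2\<in>ideal_cg \<rho> Pst. \<exists>i. incr_cont \<rho> i j \<and>
                 (\<forall>\<epsilon>\<in>cof_set \<rho> \<theta> - S2. d (i \<epsilon>) \<in> good lam \<theta> P)))))"
proof -
  note lam = assms(1) and \<sigma> = assms(2) and \<rho> = assms(3) and \<theta> = assms(4)
  note less = assms(5-9)
  have unc: "aleph0 < \<rho>" "aleph0 < \<sigma>" and \<theta>lam: "\<theta> < lam" and \<rho>lam: "\<rho> < lam" using less by auto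
  note lim\<sigma> = regular_limit[OF \<sigma>] and lim\<rho> = regular_limit[OF \<rho>]
  have \<sigma>lam: "|{..<\<sigma>}| <o |{..<lam}|" by (rule regular_card_less[OF lam less(1)])
  have "\<forall>\<gamma>. \<exists>s. cf \<gamma> = \<rho> \<longrightarrow> incr_cont \<rho> s \<gamma>" using incr_cont_exists[OF \<rho>] by blast
  then obtain e where e: "\<And>\<gamma>. cf \<gamma> = \<rho> \<Longrightarrow> incr_cont \<rho> (e \<gamma>) \<gamma>" by metis

  \<comment> \<open>What the parts share: the system is built before \<open>\<delta>\<close>,
    \<open>d\<close> and \<open>i\<close> are given, and the closure condition remains a hypothesis.
    Elementary submodels supply it for the third part, a recursion inside a club for the first
    two.\<close>
  have core: "\<exists>P. set_system lam lam lam P \<and> (\<forall>\<delta>\<in>cof_set lam \<sigma>. \<forall>d i j. incr_cont \<sigma> d \<delta> \<longrightarrow> incr_cont \<rho> i j \<longrightarrow>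
      j < \<sigma> \<longrightarrow> (\<forall>\<xi> \<zeta>. \<xi> < \<zeta> \<longrightarrow> \<zeta> < \<rho> \<longrightarrow> code_step e (thin_segments \<rho> \<theta> Pst) \<delta> d \<xi> i (i \<zeta>)) \<longrightarrow>
      (\<exists>S\<in>ideal_cg \<rho> Pst. \<forall>\<epsilon>\<in>cof_set \<rho> \<theta> - S. d (i \<epsilon>) \<in> good lam \<theta> P))"
    if Pst: "set_system \<rho> (succ_card \<theta>) \<sigma> Pst" for Pst
  proof -
    let ?B = "thin_segments \<rho> \<theta> Pst"
    have B: "|?B| <o |{..<lam}|"
      using card_thin_segments[OF \<sigma> less(2) Pst] \<sigma>lam by (rule ordLess_transitive)
    have b: "|b| <o |{..<lam}|" if "b \<in> ?B" for b by (rule card_thin_segment[OF lam \<rho>lam that])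
    obtain P where P: "set_system lam lam lam P"
      "\<forall>\<delta><lam. cf \<delta> = \<theta> \<longrightarrow> (\<exists>u. coded_cofinal e ?B \<theta> \<delta> u) \<longrightarrow> \<delta> \<in> good lam \<theta> P"
      using coded_system[OF lam \<theta>lam B b, of e] by blast
    have "\<exists>S\<in>ideal_cg \<rho> Pst. \<forall>\<epsilon>\<in>cof_set \<rho> \<theta> - S. d (i \<epsilon>) \<in> good lam \<theta> P"
      if \<delta>: "\<delta> \<in> cof_set lam \<sigma>" and d: "incr_cont \<sigma> d \<delta>" and i: "incr_cont \<rho> i j" and j: "j < \<sigma>"
        and step: "\<forall>\<xi> \<zeta>. \<xi> < \<zeta> \<longrightarrow> \<zeta> < \<rho> \<longrightarrow> code_step e ?B \<delta> d \<xi> i (i \<zeta>)" for \<delta> d i j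
    proof -
      obtain S where S: "S \<in> ideal_cg \<rho> Pst" "\<forall>\<epsilon>\<in>cof_set \<rho> \<theta> - S.
          cf (d (i \<epsilon>)) = \<theta> \<and> (\<exists>u. coded_cofinal e ?B \<theta> (d (i \<epsilon>)) u)"
        using coded_cofinal_off_ideal_cg[OF \<rho> unc(1) \<theta> \<sigma> Pst e d i j] step by blast
      have "d (i \<epsilon>) < lam" if "\<epsilon> \<in> cof_set \<rho> \<theta>" for \<epsilon>
      proof -
        have "i \<epsilon> < \<sigma>" using incr_cont_below[OF i lim\<rho>] that j less_trans unfolding cof_set_def by blast
        then have "d (i \<epsilon>) < \<delta>" by (rule incr_cont_below[OF d lim\<sigma>])
        then show ?thesis using \<delta> less_trans unfolding cof_set_def by blast
      qed
      then have "\<forall>\<epsilon>\<in>cof_set \<rho> \<theta> - S. d (i \<epsilon>) \<in> good lam \<theta> P" using S(2) P(2) by blast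
      then show ?thesis using S(1) by blast
    qed
    then show ?thesis using P(1) by blast
  qed

  have part3: "\<exists>P. set_system lam lam lam P \<and>
           (\<forall>\<delta>\<in>cof_set lam \<sigma>. \<forall>d. incr_cont \<sigma> d \<delta> \<longrightarrow>
             (\<exists>S1\<in>ideal_ac W \<rho> \<sigma>. \<forall>j\<in>cof_set \<sigma> \<rho> - S1.
               \<exists>S2\<in>ideal_cg \<rho> Pst. \<exists>i. incr_cont \<rho> i j \<and>
                 (\<forall>\<epsilon>\<in>cof_set \<rho> \<theta> - S2. d (i \<epsilon>) \<in> good lam \<theta> P)))"
    if Pst: "set_system \<rho> (succ_card \<theta>) \<sigma> Pst" for Pst
  proof -
    have "Pow (Pow {..<\<sigma>}) \<subseteq> Pow (Pow {..<lam})" using less(1) by (intro Pow_mono) auto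
    then have "|Pow (Pow {..<\<sigma>})| \<le>o |Pow (Pow {..<lam})|" by (rule card_of_mono1)
    also have "|Pow (Pow {..<lam})| \<le>o |Pow (Pow (Pow {..<lam}))|"
      by (rule ordLess_imp_ordLeq[OF card_of_Pow])
    finally have big: "|Pow (Pow {..<\<sigma>})| \<le>o |UNIV :: 'c set|" using universe_large by (rule ordLeq_transitive)
    obtain P where P: "set_system lam lam lam P" "\<forall>\<delta>\<in>cof_set lam \<sigma>. \<forall>d i j. incr_cont \<sigma> d \<delta> \<longrightarrow> incr_cont \<rho> i j \<longrightarrow>
      j < \<sigma> \<longrightarrow> (\<forall>\<xi> \<zeta>. \<xi> < \<zeta> \<longrightarrow> \<zeta> < \<rho> \<longrightarrow> code_step e (thin_segments \<rho> \<theta> Pst) \<delta> d \<xi> i (i \<zeta>)) \<longrightarrow>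
      (\<exists>S\<in>ideal_cg \<rho> Pst. \<forall>\<epsilon>\<in>cof_set \<rho> \<theta> - S. d (i \<epsilon>) \<in> good lam \<theta> P)"
      using core[OF Pst] by blast
    have "\<exists>S1\<in>ideal_ac W \<rho> \<sigma>. \<forall>j\<in>cof_set \<sigma> \<rho> - S1. \<exists>S2\<in>ideal_cg \<rho> Pst. \<exists>i. incr_cont \<rho> i j \<and>
        (\<forall>\<epsilon>\<in>cof_set \<rho> \<theta> - S2. d (i \<epsilon>) \<in> good lam \<theta> P)"
      if \<delta>: "\<delta> \<in> cof_set lam \<sigma>" and d: "incr_cont \<sigma> d \<delta>" for \<delta> d
    proof -
      obtain S1 where S1: "S1 \<in> ideal_ac W \<rho> \<sigma>" "\<forall>j\<in>cof_set \<sigma> \<rho> - S1. \<exists>i. incr_cont \<rho> i j \<and>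
          (\<forall>\<xi> \<zeta>. \<xi> < \<zeta> \<longrightarrow> \<zeta> < \<rho> \<longrightarrow> code_step e (thin_segments \<rho> \<theta> Pst) \<delta> d \<xi> i (i \<zeta>))"
        using code_step_off_ideal_ac[OF \<sigma> \<rho> less(2) big d card_thin_segments[OF \<sigma> less(2) Pst], of W e] by blast
      have "\<exists>S2\<in>ideal_cg \<rho> Pst. \<exists>i. incr_cont \<rho> i j \<and> (\<forall>\<epsilon>\<in>cof_set \<rho> \<theta> - S2. d (i \<epsilon>) \<in> good lam \<theta> P)"
        if j: "j \<in> cof_set \<sigma> \<rho> - S1" for j
      proof -
        obtain i where i: "incr_cont \<rho> i j"
          "\<forall>\<xi> \<zeta>. \<xi> < \<zeta> \<longrightarrow> \<zeta> < \<rho> \<longrightarrow> code_step e (thin_segments \<rho> \<theta> Pst) \<delta> d \<xi> i (i \<zeta>)"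
          using S1(2) j by blast
        have "j < \<sigma>" using j unfolding cof_set_def by blast
        then show ?thesis using P(2)[rule_format, OF \<delta> d i(1)] i by blast
      qed
      then show ?thesis using S1(1) by blast
    qed
    then show ?thesis using P(1) by blast
  qed

  obtain Pst where Pst: "set_system \<rho> (succ_card \<theta>) \<sigma> Pst"
    and guess: "\<And>E S. club E \<rho> \<Longrightarrow> S \<in> ideal_cg \<rho> Pst \<Longrightarrow> (cof_set \<rho> \<theta> - S) \<inter> E \<noteq> {}"
    using guessing_system[OF \<rho> unc(1) \<theta> less(3,4) \<sigma> less(2)] by blast
  obtain P where P: "set_system lam lam lam P" "\<forall>\<delta>\<in>cof_set lam \<sigma>. \<forall>d i j. incr_cont \<sigma> d \<delta> \<longrightarrow> incr_cont \<rho> i j \<longrightarrow>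
      j < \<sigma> \<longrightarrow> (\<forall>\<xi> \<zeta>. \<xi> < \<zeta> \<longrightarrow> \<zeta> < \<rho> \<longrightarrow> code_step e (thin_segments \<rho> \<theta> Pst) \<delta> d \<xi> i (i \<zeta>)) \<longrightarrow>
      (\<exists>S\<in>ideal_cg \<rho> Pst. \<forall>\<epsilon>\<in>cof_set \<rho> \<theta> - S. d (i \<epsilon>) \<in> good lam \<theta> P)"
    using core[OF Pst] by blast
  \<comment> \<open>With all good points in \<open>S\<close>, the club of all ordinals below
    \<open>lam\<close> witnesses membership in the ideal, and the same \<open>S\<close> serves both
    reflection statements.\<close>
  define S where "S = good lam \<theta> P"
  have "S \<subseteq> cof_set lam \<theta>" unfolding S_def good_def cof_set_def by blast
  then have SI: "S \<in> ideal_I lam \<theta>"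
    unfolding ideal_I_def S_def using P(1) club_UNIV[OF regular_limit[OF lam]] by blast
  have part2: "reflects_in S \<delta> \<and> stationary {\<delta>1. \<delta>1 < \<delta> \<and> cf \<delta>1 = \<rho> \<and> reflects_in S \<delta>1} \<delta>"
    if \<delta>: "\<delta> \<in> cof_set lam \<sigma>" for \<delta>
  proof -
    have cf\<delta>: "cf \<delta> = \<sigma>" using \<delta> unfolding cof_set_def by blast
    obtain d where d: "incr_cont \<sigma> d \<delta>" using incr_cont_exists[OF \<sigma> cf\<delta>] by blast
    have club: "(\<exists>\<delta>1\<in>C. \<delta>1 < \<delta> \<and> cf \<delta>1 = \<rho> \<and> reflects_in S \<delta>1) \<and> S \<inter> C \<noteq> {}" if C: "club C \<delta>" for C
    proof -
      obtain D where D: "club D \<sigma>" "\<forall>k\<in>D. d k \<in> C" using club_pullback[OF \<sigma> unc(2) d C] by blast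
      \<comment> \<open>One chain inside the pulled-back club settles both claims: its limit gives a
        point \<open>d j\<close> of \<open>C\<close> where \<open>S\<close> reflects, and its
        members give a point of \<open>S\<close> in \<open>C\<close>.\<close>
      have chain: "\<exists>i j. j \<in> D \<and> incr_cont \<rho> i j \<and> (\<forall>\<zeta><\<rho>. i \<zeta> \<in> D) \<and>
        (\<forall>\<xi> \<zeta>. \<xi> < \<zeta> \<longrightarrow> \<zeta> < \<rho> \<longrightarrow> code_step e (thin_segments \<rho> \<theta> Pst) \<delta> d \<xi> i (i \<zeta>))"
      proof (rule continuous_chain[OF \<sigma> \<rho> less(2) D(1)])
        show "\<exists>k<\<sigma>. code_step e (thin_segments \<rho> \<theta> Pst) \<delta> d \<xi> i k" for \<xi> i
          by (rule code_step_exists[OF \<sigma> d card_thin_segments[OF \<sigma> less(2) Pst]])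
      qed (rule code_step_up[OF d] code_step_local; assumption)+
      obtain i j where ij: "j \<in> D" "incr_cont \<rho> i j" "\<forall>\<zeta><\<rho>. i \<zeta> \<in> D"
        "\<forall>\<xi> \<zeta>. \<xi> < \<zeta> \<longrightarrow> \<zeta> < \<rho> \<longrightarrow> code_step e (thin_segments \<rho> \<theta> Pst) \<delta> d \<xi> i (i \<zeta>)"
        using chain by blast
      have j: "j < \<sigma>" using ij(1) club_subset[OF D(1)] by blast
      obtain S2 where S2: "S2 \<in> ideal_cg \<rho> Pst" "\<forall>\<epsilon>\<in>cof_set \<rho> \<theta> - S2. d (i \<epsilon>) \<in> S"
        using P(2)[rule_format, OF \<delta> d ij(2) j] ij(4) unfolding S_def by blast
      have di: "incr_cont \<rho> (d \<circ> i) (d j)" by (rule incr_cont_comp[OF d j ij(2) lim\<rho>])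
      have cfj: "cf (d j) = \<rho>" by (rule cf_incr_cont[OF di \<rho>])
      \<comment> \<open>Outside \<open>S2\<close> every index of cofinality \<open>\<theta>\<close>
        leads into \<open>S\<close>, and club guessing places such an index in every club of
        \<open>\<rho>\<close>, in particular in the pullback of a club of
        \<open>d j\<close>.\<close>
      have hit: "\<exists>\<epsilon>\<in>E. \<epsilon> < \<rho> \<and> d (i \<epsilon>) \<in> S" if E: "club E \<rho>" for E
        using guess[OF E S2(1)] S2(2) unfolding cof_set_def by blast
      have "stationary (S \<inter> {..<d j}) (d j)"
        unfolding stationary_def
      proof (intro conjI allI impI)
        fix K assume K: "club K (d j)"
        obtain E where E: "club E \<rho>" "\<forall>k\<in>E. (d \<circ> i) k \<in> K" using club_pullback[OF \<rho> unc(1) di K] by blast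
        obtain \<epsilon> where \<epsilon>: "\<epsilon> \<in> E" "\<epsilon> < \<rho>" "d (i \<epsilon>) \<in> S" using hit[OF E(1)] by blast
        have "d (i \<epsilon>) < d j" using incr_cont_below[OF di lim\<rho> \<epsilon>(2)] by simp
        then show "S \<inter> {..<d j} \<inter> K \<noteq> {}" using E(2) \<epsilon> by auto
      qed blast
      then have "reflects_in S (d j)" unfolding reflects_in_def cfj using unc(1) by blast
      moreover have "d j < \<delta>" by (rule incr_cont_below[OF d lim\<sigma> j])
      moreover have "S \<inter> C \<noteq> {}"
      proof -
        obtain \<epsilon> where "\<epsilon> < \<rho>" "d (i \<epsilon>) \<in> S" using hit[OF club_UNIV[OF lim\<rho>]] by blast
        then show ?thesis using ij(3) D(2) by blast
      qed
      ultimately show ?thesis using cfj D(2) ij(1) by blast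
    qed
    have "S \<inter> C \<inter> {..<\<delta>} \<noteq> {}" if "club C \<delta>" for C using club[OF that] club_subset[OF that] by blast
    then have "stationary (S \<inter> {..<\<delta>}) \<delta>" unfolding stationary_def by blast
    then have "reflects_in S \<delta>" unfolding reflects_in_def cf\<delta> using unc(2) by blast
    moreover have "stationary {\<delta>1. \<delta>1 < \<delta> \<and> cf \<delta>1 = \<rho> \<and> reflects_in S \<delta>1} \<delta>"
      unfolding stationary_def using club by blast
    ultimately show ?thesis by blast
  qed
  show ?thesis using SI part2 part3 by blast
qed

end
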